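(* Let $(M,g)$ and $(N,h)$ be Riemannian manifolds, let $\phi\colon M\to N$ be a smooth map, let $s\geq 1$ be an integer, and assume that $N$ has a Killing vector field $X$. Let $J^{2s}(\phi)$ be the vector field on $M$ determined by requiring, for all vector fields $U$ on $M$, $$ \begin{aligned} g(J^{2s}(\phi),U)=&\ \langle\bar\nabla_U\bar\Delta^{2s-2}\tau(\phi),X\circ\phi\rangle-\langle\bar\nabla_U(X\circ\phi),\bar\Delta^{2s-2}\tau(\phi)\rangle\\ &+\sum_{l=1}^{s-1}\Big(\langle\nabla^N_{\bar\nabla_U\bar\Delta^{s+l-2}\tau(\phi)}X,\ \bar\Delta^{s-l-1}\tau(\phi)\rangle+\langle\nabla^N_{\bar\nabla_U\bar\Delta^{s-l-1}\tau(\phi)}X,\ \bar\Delta^{s+l-2}\tau(\phi)\rangle\Big). \end{aligned} $$ Then $$\operatorname{div}J^{2s}(\phi)=-\langle\tau_{2s}(\phi),X\circ\phi\rangle .$$ In particular, $J^{2s}(\phi)$ is divergence-free whenever $\phi$ is a polyharmonic map of order $2s$, i.e. $\tau_{2s}(\phi)=0$.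
   Context: $\bar\nabla$ denotes the connection on the pull-back bundle $\phi^\ast TN$ induced by the Levi-Civita connection $\nabla^N$ of $(N,h)$, and $\langle\cdot,\cdot\rangle$ the bundle metric induced by $h$. The tension field is $\tau(\phi)=\operatorname{Tr}_g\bar\nabla d\phi\in\Gamma(\phi^\ast TN)$. The rough Laplacian on $\phi^\ast TN$ has the sign convention $\bar\Delta=-\operatorname{Tr}_g(\bar\nabla\bar\nabla-\bar\nabla_{\nabla})$, i.e. $\bar\Delta=-\sum_j(\bar\nabla_{e_j}\bar\nabla_{e_j}-\bar\nabla_{\nabla_{e_j}e_j})$ for a local orthonormal frame $\{e_j\}$ of $TM$; $\bar\Delta^0$ is the identity. The curvature convention is $R^N(X,Y)Z=[\nabla_X,\nabla_Y]Z-\nabla_{[X,Y]}Z$. A vector field $X$ on $N$ is Killing if $\langle\nabla^N_YX,Z\rangle+\langle\nabla^N_ZX,Y\rangle=0$ for all vector fields $Y,Z$ on $N$. $X\circ\phi$ is the section $p\mapsto X(\phi(p))$ of $\phi^\ast TN$. For a section $W$ of $\phi^\ast TN$, $\nabla^N_WX$ denotes the section $p\mapsto(\nabla^N_{W(p)}X)(\phi(p))$ of $\phi^\ast TN$. The $2s$-tension field (sum over repeated index $j$, $\{e_j\}$ a local orthonormal frame of $TM$) is $$ \begin{aligned} \tau_{2s}(\phi)=&\ \bar\Delta^{2s-1}\tau(\phi)-R^N(\bar\Delta^{2s-2}\tau(\phi),d\phi(e_j))d\phi(e_j)\\ &-\sum_{\ell=1}^{s-1}\Big(R^N(\bar\nabla_{e_j}\bar\Delta^{s+\ell-2}\tau(\phi),\bar\Delta^{s-\ell-1}\tau(\phi))d\phi(e_j)-R^N(\bar\Delta^{s+\ell-2}\tau(\phi),\bar\nabla_{e_j}\bar\Delta^{s-\ell-1}\tau(\phi))d\phi(e_j)\Big).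 \end{aligned} $$ Empty sums are zero. Polyharmonic maps of order $2s$ are the critical points of $E_{2s}(\phi)=\frac12\int_M|\bar\Delta^{s-1}\tau(\phi)|^2\,dv_g$, which are characterized by $\tau_{2s}(\phi)=0$. *)

theory Defs
  imports "HOL-Analysis.Analysis" "HOL-Library.Function_Algebras"
begin

section \<open>Pointwise real vector space structure on functions\<close>

instantiation "fun" :: (type, real_vector) real_vector
begin

definition scaleR_fun :: "real \<Rightarrow> ('a \<Rightarrow> 'b) \<Rightarrow> 'a \<Rightarrow> 'b"
  where "scaleR_fun r f = (\<lambda>x. r *\<^sub>R f x)"

instance
  by standard (auto simp: scaleR_fun_def fun_eq_iff algebra_simps)

end


section \<open>Smooth manifolds and smooth maps\<close>

primrec differentiable_times_on ::
    "nat \<Rightarrow> 'a::real_normed_vector set \<Rightarrow> ('a \<Rightarrow> 'b::real_normed_vector) \<Rightarrow> bool"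
  where
    "differentiable_times_on 0 S f \<longleftrightarrow> continuous_on S f"
  | "differentiable_times_on (Suc k) S f \<longleftrightarrow>
       (\<forall>x\<in>S. f differentiable (at x)) \<and>
       (\<forall>v. differentiable_times_on k S (\<lambda>x. frechet_derivative f (at x) v))"

text \<open>Used for open sets in finite-dimensional spaces only, where this is the class of
  infinitely differentiable functions.\<close>

definition smooth_on :: "'a::real_normed_vector set \<Rightarrow> ('a \<Rightarrow> 'b::real_normed_vector) \<Rightarrow> bool"
  where "smooth_on S f \<longleftrightarrow> (\<forall>k. differentiable_times_on k S f)"

text \<open>A manifold is a Hausdorff, second countable type with an atlas (not necessarily
  maximal). A chart is its domain together with the coordinate map, whose values outside the
  domain are irrelevant.\<close>

type_synonym ('m, 'a) atlas = "('m set \<times> ('m \<Rightarrow> 'a)) set"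

definition smooth_atlas ::
    "('m::{t2_space, second_countable_topology}, 'a::euclidean_space) atlas \<Rightarrow> bool"
  where "smooth_atlas A \<longleftrightarrow>
    (\<Union>(U, c)\<in>A. U) = UNIV \<and>
    (\<forall>(U, c)\<in>A. open U \<and> open (c ` U) \<and> homeomorphism U (c ` U) c (inv_into U c)) \<and>
    (\<forall>(U, c)\<in>A. \<forall>(V, d)\<in>A. smooth_on (c ` (U \<inter> V)) (d \<circ> inv_into U c))"

text \<open>Smoothness on a neighbourhood of a point. The values away from the point are arbitrary,
  so total functions with this property serve as representatives of germs and of functions
  that are only locally defined; the same applies to vector fields and sections below.\<close>

definition smooth_at ::
    "('m::topological_space, 'a::euclidean_space) atlas \<Rightarrow> 'm \<Rightarrow> ('m \<Rightarrow> 'b::real_normed_vector) \<Rightarrow> bool"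
  where "smooth_at A p f \<longleftrightarrow>
    (\<exists>(U, c)\<in>A. \<exists>V. open V \<and> p \<in> V \<and> V \<subseteq> U \<and> smooth_on (c ` V) (f \<circ> inv_into U c))"

definition smooth_map ::
    "('m::topological_space, 'a::euclidean_space) atlas \<Rightarrow>
     ('n::topological_space, 'b::euclidean_space) atlas \<Rightarrow> ('m \<Rightarrow> 'n) \<Rightarrow> bool"
  where "smooth_map A B \<phi> \<longleftrightarrow>
    (\<forall>p. \<exists>(V, d)\<in>B. \<phi> p \<in> V \<and> (\<forall>\<^sub>F q in nhds p. \<phi> q \<in> V) \<and> smooth_at A p (d \<circ> \<phi>))"


section \<open>Tangent vectors, vector fields and sections along a map\<close>

type_synonym 'm tvec = "('m \<Rightarrow> real) \<Rightarrow> real"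

text \<open>Tangent vectors are derivations of germs of smooth functions, extended by zero to the
  functions that are not smooth near the point (so that they are equal as soon as they agree
  on germs).\<close>

definition tangent_space ::
    "('m::topological_space, 'a::euclidean_space) atlas \<Rightarrow> 'm \<Rightarrow> 'm tvec set"
  where "tangent_space A p = {v.
    (\<forall>f. \<not> smooth_at A p f \<longrightarrow> v f = 0) \<and>
    (\<forall>f f'. smooth_at A p f \<longrightarrow> smooth_at A p f' \<longrightarrow>
       v (\<lambda>q. f q + f' q) = v f + v f' \<and>
       v (\<lambda>q. f q * f' q) = v f * f' p + f p * v f') \<and>
    (\<forall>f r. smooth_at A p f \<longrightarrow> v (\<lambda>q. r * f q) = r * v f)}"

definition pushforward ::
    "('n::topological_space, 'b::euclidean_space) atlas \<Rightarrow> ('m \<Rightarrow> 'n) \<Rightarrow> 'm \<Rightarrow> 'm tvec \<Rightarrow> 'n tvec"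
  where "pushforward B \<phi> p v = (\<lambda>f. if smooth_at B (\<phi> p) f then v (f \<circ> \<phi>) else 0)"

text \<open>Sections of the pull-back bundle along \<open>\<phi>\<close>, smooth near \<open>p\<close>. Vector fields are
  the sections along the identity.\<close>

definition section_at ::
    "('m::topological_space, 'a::euclidean_space) atlas \<Rightarrow>
     ('n::topological_space, 'b::euclidean_space) atlas \<Rightarrow>
     ('m \<Rightarrow> 'n) \<Rightarrow> 'm \<Rightarrow> ('m \<Rightarrow> 'n tvec) \<Rightarrow> bool"
  where "section_at A B \<phi> p W \<longleftrightarrow>
    (\<forall>\<^sub>F q in nhds p. W q \<in> tangent_space B (\<phi> q)) \<and>
    (\<forall>f. smooth_at B (\<phi> p) f \<longrightarrow> smooth_at A p (\<lambda>q. W q f))"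

abbreviation vector_field_at ::
    "('m::topological_space, 'a::euclidean_space) atlas \<Rightarrow> 'm \<Rightarrow> ('m \<Rightarrow> 'm tvec) \<Rightarrow> bool"
  where "vector_field_at A p X \<equiv> section_at A A id p X"

definition vector_field ::
    "('m::topological_space, 'a::euclidean_space) atlas \<Rightarrow> ('m \<Rightarrow> 'm tvec) \<Rightarrow> bool"
  where "vector_field A X \<longleftrightarrow> (\<forall>p. vector_field_at A p X)"

definition lie_bracket ::
    "('m::topological_space, 'a::euclidean_space) atlas \<Rightarrow>
     ('m \<Rightarrow> 'm tvec) \<Rightarrow> ('m \<Rightarrow> 'm tvec) \<Rightarrow> 'm \<Rightarrow> 'm tvec"
  where "lie_bracket A X Y p =
    (\<lambda>f. if smooth_at A p f then X p (\<lambda>q. Y q f) - Y p (\<lambda>q. X q f) else 0)"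


section \<open>Riemannian metrics and connections\<close>

definition riemannian_metric ::
    "('m::topological_space, 'a::euclidean_space) atlas \<Rightarrow> ('m \<Rightarrow> 'm tvec \<Rightarrow> 'm tvec \<Rightarrow> real) \<Rightarrow> bool"
  where "riemannian_metric A g \<longleftrightarrow>
    (\<forall>p. \<forall>u\<in>tangent_space A p. \<forall>v\<in>tangent_space A p.
       g p u v = g p v u \<and>
       (u \<noteq> 0 \<longrightarrow> g p u u > 0) \<and>
       (\<forall>w\<in>tangent_space A p. \<forall>r t. g p (r *\<^sub>R u + t *\<^sub>R v) w = r * g p u w + t * g p v w)) \<and>
    (\<forall>p X Y. vector_field_at A p X \<longrightarrow> vector_field_at A p Y \<longrightarrow>
       smooth_at A p (\<lambda>q. g q (X q) (Y q)))"

text \<open>A connection on the pull-back bundle along \<open>\<phi>\<close>: \<open>D p v W\<close> is the covariant derivative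
  at \<open>p\<close>, in the direction of the tangent vector \<open>v\<close> at \<open>p\<close>, of a section \<open>W\<close> that is smooth
  near \<open>p\<close>. Since the Leibniz rule is required for all functions smooth near \<open>p\<close>, the value
  depends only on the germ of \<open>W\<close>: a section vanishing near \<open>p\<close> is its own multiple by the
  function that is zero near \<open>p\<close> and one elsewhere.\<close>

type_synonym ('m, 'n) conn = "'m \<Rightarrow> 'm tvec \<Rightarrow> ('m \<Rightarrow> 'n tvec) \<Rightarrow> 'n tvec"

definition connection_along ::
    "('m::topological_space, 'a::euclidean_space) atlas \<Rightarrow>
     ('n::topological_space, 'b::euclidean_space) atlas \<Rightarrow>
     ('m \<Rightarrow> 'n) \<Rightarrow> ('m, 'n) conn \<Rightarrow> bool"
  where "connection_along A B \<phi> D \<longleftrightarrow>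
    (\<forall>p W. section_at A B \<phi> p W \<longrightarrow>
       (\<forall>v\<in>tangent_space A p. D p v W \<in> tangent_space B (\<phi> p) \<and>
          (\<forall>u\<in>tangent_space A p. \<forall>r t.
             D p (r *\<^sub>R u + t *\<^sub>R v) W = r *\<^sub>R D p u W + t *\<^sub>R D p v W) \<and>
          (\<forall>W'. section_at A B \<phi> p W' \<longrightarrow>
             D p v (\<lambda>q. W q + W' q) = D p v W + D p v W') \<and>
          (\<forall>f. smooth_at A p f \<longrightarrow>
             D p v (\<lambda>q. f q *\<^sub>R W q) = v f *\<^sub>R W p + f p *\<^sub>R D p v W)) \<and>
       (\<forall>V. vector_field_at A p V \<longrightarrow> section_at A B \<phi> p (\<lambda>q. D q (V q) W)))"

definition levi_civita ::
    "('m::topological_space, 'a::euclidean_space) atlas \<Rightarrow>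
     ('m \<Rightarrow> 'm tvec \<Rightarrow> 'm tvec \<Rightarrow> real) \<Rightarrow> ('m, 'm) conn \<Rightarrow> bool"
  where "levi_civita A g D \<longleftrightarrow>
    connection_along A A id D \<and>
    (\<forall>p X Y. vector_field_at A p X \<longrightarrow> vector_field_at A p Y \<longrightarrow>
       D p (X p) Y - D p (Y p) X = lie_bracket A X Y p \<and>
       (\<forall>v\<in>tangent_space A p.
          v (\<lambda>q. g q (X q) (Y q)) = g p (D p v X) (Y p) + g p (X p) (D p v Y)))"

definition pullback_connection ::
    "('m::topological_space, 'a::euclidean_space) atlas \<Rightarrow>
     ('n::topological_space, 'b::euclidean_space) atlas \<Rightarrow>
     ('n, 'n) conn \<Rightarrow> ('m \<Rightarrow> 'n) \<Rightarrow> ('m, 'n) conn \<Rightarrow> bool"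
  where "pullback_connection A B DN \<phi> Db \<longleftrightarrow>
    connection_along A B \<phi> Db \<and>
    (\<forall>p Y. vector_field_at B (\<phi> p) Y \<longrightarrow>
       (\<forall>v\<in>tangent_space A p.
          Db p v (\<lambda>q. Y (\<phi> q)) = DN (\<phi> p) (pushforward B \<phi> p v) Y))"

text \<open>The curvature as a tensor: the value on tangent vectors \<open>u\<close>, \<open>v\<close>, \<open>w\<close> at \<open>p\<close> is the common
  value for all local vector fields extending them.\<close>

definition curvature ::
    "('m::topological_space, 'a::euclidean_space) atlas \<Rightarrow> ('m, 'm) conn \<Rightarrow>
     'm \<Rightarrow> 'm tvec \<Rightarrow> 'm tvec \<Rightarrow> 'm tvec \<Rightarrow> 'm tvec"
  where "curvature A D p u v w = (THE r. \<forall>X Y Z.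
    vector_field_at A p X \<and> X p = u \<longrightarrow> vector_field_at A p Y \<and> Y p = v \<longrightarrow>
    vector_field_at A p Z \<and> Z p = w \<longrightarrow>
    r = D p u (\<lambda>q. D q (Y q) Z) - D p v (\<lambda>q. D q (X q) Z) - D p (lie_bracket A X Y p) Z)"

definition killing_field ::
    "('m::topological_space, 'a::euclidean_space) atlas \<Rightarrow>
     ('m \<Rightarrow> 'm tvec \<Rightarrow> 'm tvec \<Rightarrow> real) \<Rightarrow> ('m, 'm) conn \<Rightarrow> ('m \<Rightarrow> 'm tvec) \<Rightarrow> bool"
  where "killing_field A g D X \<longleftrightarrow> vector_field A X \<and>
    (\<forall>Y Z. vector_field A Y \<longrightarrow> vector_field A Z \<longrightarrow>
       (\<forall>p. g p (D p (Y p) X) (Z p) + g p (D p (Z p) X) (Y p) = 0))"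


section \<open>Traces, divergence, tension field and rough Laplacian\<close>

text \<open>The members of a frame are indexed by the standard basis of the model space, so there
  are as many as the dimension.\<close>

definition local_orthonormal_frame ::
    "('m::topological_space, 'a::euclidean_space) atlas \<Rightarrow>
     ('m \<Rightarrow> 'm tvec \<Rightarrow> 'm tvec \<Rightarrow> real) \<Rightarrow> 'm \<Rightarrow> ('a \<Rightarrow> 'm \<Rightarrow> 'm tvec) \<Rightarrow> bool"
  where "local_orthonormal_frame A g p e \<longleftrightarrow>
    (\<forall>i\<in>Basis. vector_field_at A p (e i)) \<and>
    (\<forall>\<^sub>F q in nhds p. \<forall>i\<in>Basis. \<forall>j\<in>Basis. g q (e i q) (e j q) = (if i = j then 1 else 0))"

text \<open>\<open>frame_trace A g p F\<close> is the sum of \<open>F (e\<^sub>j)\<close> over a local orthonormal frame near \<open>p\<close>. It is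
  applied only to expressions for which the sum does not depend on the frame.\<close>

definition frame_trace ::
    "('m::topological_space, 'a::euclidean_space) atlas \<Rightarrow>
     ('m \<Rightarrow> 'm tvec \<Rightarrow> 'm tvec \<Rightarrow> real) \<Rightarrow> 'm \<Rightarrow>
     (('m \<Rightarrow> 'm tvec) \<Rightarrow> 'r::comm_monoid_add) \<Rightarrow> 'r"
  where "frame_trace A g p F =
    (let e = (SOME e. local_orthonormal_frame A g p e) in \<Sum>j\<in>Basis. F (e j))"

definition divergence ::
    "('m::topological_space, 'a::euclidean_space) atlas \<Rightarrow>
     ('m \<Rightarrow> 'm tvec \<Rightarrow> 'm tvec \<Rightarrow> real) \<Rightarrow> ('m, 'm) conn \<Rightarrow> ('m \<Rightarrow> 'm tvec) \<Rightarrow> 'm \<Rightarrow> real"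
  where "divergence A g D J p = frame_trace A g p (\<lambda>E. g p (D p (E p) J) (E p))"

definition tension ::
    "('m::topological_space, 'a::euclidean_space) atlas \<Rightarrow>
     ('m \<Rightarrow> 'm tvec \<Rightarrow> 'm tvec \<Rightarrow> real) \<Rightarrow> ('m, 'm) conn \<Rightarrow>
     ('n::topological_space, 'b::euclidean_space) atlas \<Rightarrow> ('m \<Rightarrow> 'n) \<Rightarrow> ('m, 'n) conn \<Rightarrow>
     'm \<Rightarrow> 'n tvec"
  where "tension A g D B \<phi> Db p = frame_trace A g p (\<lambda>E.
    Db p (E p) (\<lambda>q. pushforward B \<phi> q (E q)) - pushforward B \<phi> p (D p (E p) E))"

definition rough_laplacian ::
    "('m::topological_space, 'a::euclidean_space) atlas \<Rightarrow>
     ('m \<Rightarrow> 'm tvec \<Rightarrow> 'm tvec \<Rightarrow> real) \<Rightarrow> ('m, 'm) conn \<Rightarrow> ('m, 'n) conn \<Rightarrow>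
     ('m \<Rightarrow> 'n tvec) \<Rightarrow> 'm \<Rightarrow> 'n tvec"
  where "rough_laplacian A g D Db W p = - frame_trace A g p (\<lambda>E.
    Db p (E p) (\<lambda>q. Db q (E q) W) - Db p (D p (E p) E) W)"

definition laplacian_tension ::
    "('m::topological_space, 'a::euclidean_space) atlas \<Rightarrow>
     ('m \<Rightarrow> 'm tvec \<Rightarrow> 'm tvec \<Rightarrow> real) \<Rightarrow> ('m, 'm) conn \<Rightarrow>
     ('n::topological_space, 'b::euclidean_space) atlas \<Rightarrow> ('m \<Rightarrow> 'n) \<Rightarrow> ('m, 'n) conn \<Rightarrow>
     nat \<Rightarrow> 'm \<Rightarrow> 'n tvec"
  where "laplacian_tension A g D B \<phi> Db k =
    (rough_laplacian A g D Db ^^ k) (tension A g D B \<phi> Db)"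


section \<open>The even order tension fields and the associated currents\<close>

text \<open>For \<open>s \<ge> 1\<close> none of the natural number subtractions below is truncated.\<close>

definition even_tension ::
    "('m::topological_space, 'a::euclidean_space) atlas \<Rightarrow>
     ('m \<Rightarrow> 'm tvec \<Rightarrow> 'm tvec \<Rightarrow> real) \<Rightarrow> ('m, 'm) conn \<Rightarrow>
     ('n::topological_space, 'b::euclidean_space) atlas \<Rightarrow> ('n, 'n) conn \<Rightarrow>
     ('m \<Rightarrow> 'n) \<Rightarrow> ('m, 'n) conn \<Rightarrow> nat \<Rightarrow> 'm \<Rightarrow> 'n tvec"
  where "even_tension A g D B DN \<phi> Db s p =
    (let T = laplacian_tension A g D B \<phi> Db;
         R = curvature B DN (\<phi> p);
         d\<phi> = pushforward B \<phi> p
     in T (2 * s - 1) p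
        - frame_trace A g p (\<lambda>E. R (T (2 * s - 2) p) (d\<phi> (E p)) (d\<phi> (E p)))
        - (\<Sum>l = 1..s - 1. frame_trace A g p (\<lambda>E.
             R (Db p (E p) (T (s + l - 2))) (T (s - l - 1) p) (d\<phi> (E p))
             - R (T (s + l - 2) p) (Db p (E p) (T (s - l - 1))) (d\<phi> (E p)))))"

text \<open>The one-form dual to the current of \<open>\<phi>\<close> associated with a vector field \<open>X\<close> on the target.\<close>

definition current_form ::
    "('m::topological_space, 'a::euclidean_space) atlas \<Rightarrow>
     ('m \<Rightarrow> 'm tvec \<Rightarrow> 'm tvec \<Rightarrow> real) \<Rightarrow> ('m, 'm) conn \<Rightarrow>
     ('n::topological_space, 'b::euclidean_space) atlas \<Rightarrow>
     ('n \<Rightarrow> 'n tvec \<Rightarrow> 'n tvec \<Rightarrow> real) \<Rightarrow> ('n, 'n) conn \<Rightarrow>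
     ('m \<Rightarrow> 'n) \<Rightarrow> ('m, 'n) conn \<Rightarrow> nat \<Rightarrow> ('n \<Rightarrow> 'n tvec) \<Rightarrow> 'm \<Rightarrow> 'm tvec \<Rightarrow> real"
  where "current_form A g D B h DN \<phi> Db s X p u =
    (let T = laplacian_tension A g D B \<phi> Db
     in h (\<phi> p) (Db p u (T (2 * s - 2))) (X (\<phi> p))
        - h (\<phi> p) (Db p u (\<lambda>q. X (\<phi> q))) (T (2 * s - 2) p)
        + (\<Sum>l = 1..s - 1.
             h (\<phi> p) (DN (\<phi> p) (Db p u (T (s + l - 2))) X) (T (s - l - 1) p)
             + h (\<phi> p) (DN (\<phi> p) (Db p u (T (s - l - 1))) X) (T (s + l - 2) p)))"

definition is_current ::
    "('m::topological_space, 'a::euclidean_space) atlas \<Rightarrow>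
     ('m \<Rightarrow> 'm tvec \<Rightarrow> 'm tvec \<Rightarrow> real) \<Rightarrow> ('m, 'm) conn \<Rightarrow>
     ('n::topological_space, 'b::euclidean_space) atlas \<Rightarrow>
     ('n \<Rightarrow> 'n tvec \<Rightarrow> 'n tvec \<Rightarrow> real) \<Rightarrow> ('n, 'n) conn \<Rightarrow>
     ('m \<Rightarrow> 'n) \<Rightarrow> ('m, 'n) conn \<Rightarrow> nat \<Rightarrow> ('n \<Rightarrow> 'n tvec) \<Rightarrow> ('m \<Rightarrow> 'm tvec) \<Rightarrow> bool"
  where "is_current A g D B h DN \<phi> Db s X J \<longleftrightarrow> vector_field A J \<and>
    (\<forall>U. vector_field A U \<longrightarrow>
       (\<forall>p. g p (J p) (U p) = current_form A g D B h DN \<phi> Db s X p (U p)))"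

end

theory Submission
  imports Defs
begin

text \<open>
  Write \<open>T\<^sub>k\<close> for the \<open>k\<close>-th iterated rough Laplacian of the tension field, \<open>S W = \<nabla>\<^sub>W X\<close> and
  \<open>\<sigma>(W,Z)(U) = \<langle>\<nabla>\<^sub>U W, Z\<rangle>\<close>. Since \<open>S\<close> is skew, the one-form of the current is
  \<open>\<sigma>(T\<^bsub>2s-2\<^esub>, X) - \<sigma>(X, T\<^bsub>2s-2\<^esub>) - \<Sum>\<^sub>l (\<sigma>(a\<^sub>l, S b\<^sub>l) + \<sigma>(b\<^sub>l, S a\<^sub>l))\<close> with \<open>a\<^sub>l = T\<^bsub>s+l-2\<^esub>\<close>
  and \<open>b\<^sub>l = T\<^bsub>s-l-1\<^esub>\<close>, and the divergence of \<open>\<sigma>(W,Z)\<close> is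
  \<open>- \<langle>\<Delta>W, Z\<rangle> + \<Sum>\<^sub>j \<langle>\<nabla>\<^sub>j W, \<nabla>\<^sub>j Z\<rangle>\<close>. Kostant's formula for the second derivative of a Killing field
  gives \<open>\<nabla>\<^sub>j (S W) = S (\<nabla>\<^sub>j W) - R(X, d\<phi> e\<^sub>j) W\<close>. Hence the first-order terms cancel up to the
  curvature terms of the tension field of order \<open>2s\<close>, while the terms \<open>\<langle>\<Delta>a\<^sub>l, S b\<^sub>l\<rangle> + \<langle>\<Delta>b\<^sub>l, S a\<^sub>l\<rangle>\<close>
  telescope and cancel against the term \<open>S T\<^sub>0\<close> in \<open>\<Delta>X\<close>.
\<close>

subsection \<open>Smooth functions between Euclidean spaces\<close>

text \<open>The obstacle is that every object is given on germs or by a choice. A tangent vector is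
  an abstract derivation, so finite dimension and coordinate expansions have to be derived from
  Hadamard's lemma. The Killing condition is tested on global fields only, while the computation
  needs it on single tangent vectors; this is the purpose of the bump functions.
  \<open>frame_trace\<close> picks a frame anew at each point, so a trace can be differentiated only
  once it is known not to depend on the frame, and \<open>curvature\<close> is a definite
  description that has a value only because of tensoriality. Tensoriality is therefore set up for
  maps on sections rather than on vectors. The basic identities along \<phi> follow one pattern: the
  defect of the identity is tensorial in the section, hence may be computed on sections
  \<open>Y \<circ> \<phi>\<close>, where it becomes an identity on the target. The telescoping sum
  closes at its lower end because its boundary term pairs \<open>T (s - 1)\<close> with
  \<open>S (T (s - 1))\<close>, which is zero as \<open>S\<close> is skew.\<close>

lemma differentiable_times_on_subset:
  "differentiable_times_on k S f \<Longrightarrow> T \<subseteq> S \<Longrightarrow> differentiable_times_on k T f"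
  by (induction k arbitrary: f) (auto intro: continuous_on_subset)

lemma differentiable_times_on_SucI:
  assumes "\<And>x. x \<in> S \<Longrightarrow> (f has_derivative f' x) (at x)"
    and "\<And>v. differentiable_times_on k S (\<lambda>x. frechet_derivative f (at x) v)"
  shows "differentiable_times_on (Suc k) S f"
  using assms by (auto simp: differentiable_def)

lemma differentiable_times_on_SucD:
  assumes "differentiable_times_on (Suc k) S f" "x \<in> S"
  shows "(f has_derivative frechet_derivative f (at x)) (at x)"
  using assms frechet_derivative_works by auto

text \<open>A derivative at \<open>x\<close> only sees the values near \<open>x\<close>, so on an
  open set agreement passes on to all directional derivatives.\<close>

lemma differentiable_times_on_cong:
  assumes "open S" "differentiable_times_on k S f" "\<And>x. x \<in> S \<Longrightarrow> f x = g x"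
  shows "differentiable_times_on k S g"
  using assms(2,3)
proof (induction k arbitrary: f g)
  case 0
  then show ?case
    using continuous_on_cong[of S S f g] by simp
next
  case (Suc k)
  have *: "(g has_derivative frechet_derivative f (at x)) (at x)" if "x \<in> S" for x
    using has_derivative_transform_within_open[OF differentiable_times_on_SucD[OF Suc.prems(1) that] assms(1) that] Suc.prems(2)
    by blast
  show ?case
  proof (rule differentiable_times_on_SucI)
    show "(g has_derivative frechet_derivative f (at x)) (at x)" if "x \<in> S" for x
      using * that .
    show "differentiable_times_on k S (\<lambda>x. frechet_derivative g (at x) v)" for v
    proof (rule Suc.IH)
      show "differentiable_times_on k S (\<lambda>x. frechet_derivative f (at x) v)"
        using Suc.prems(1) by simp
      show "frechet_derivative f (at x) v = frechet_derivative g (at x) v" if "x \<in> S" for x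
        using frechet_derivative_at[OF *[OF that]] by simp
    qed
  qed
qed

text \<open>\<open>frechet_derivative\<close> is defined by choice; this rule lets an explicit
  derivative \<open>f'\<close> stand in for it, and the closure properties below rest on it.\<close>

lemma differentiable_times_on_SucI':
  assumes "open S" and d: "\<And>x. x \<in> S \<Longrightarrow> (f has_derivative f' x) (at x)"
    and "\<And>v. differentiable_times_on k S (\<lambda>x. f' x v)"
  shows "differentiable_times_on (Suc k) S f"
proof (rule differentiable_times_on_SucI[OF d])
  show "differentiable_times_on k S (\<lambda>x. frechet_derivative f (at x) v)" for v
    by (rule differentiable_times_on_cong[OF assms(1,3)]) (use frechet_derivative_at[OF d] in \<open>auto simp: fun_eq_iff\<close>)
qed

lemma differentiable_times_on_Suc_lower:
  "differentiable_times_on (Suc k) S f \<Longrightarrow> differentiable_times_on k S f"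
proof (induction k arbitrary: f)
  case 0
  then show ?case
    by (auto intro!: continuous_at_imp_continuous_on differentiable_imp_continuous_within)
next
  case (Suc k)
  then show ?case
    by (metis differentiable_times_on.simps(2))
qed

lemma differentiable_times_on_const:
  assumes "open S" shows "differentiable_times_on k S (\<lambda>x. c)"
proof (induction k arbitrary: c)
  case (Suc k)
  show ?case
    by (rule differentiable_times_on_SucI'[OF assms, where f' = "\<lambda>x v. 0"]) (auto simp: Suc)
qed simp

lemma differentiable_times_on_add:
  assumes "open S" "differentiable_times_on k S f" "differentiable_times_on k S g"
  shows "differentiable_times_on k S (\<lambda>x. f x + g x)"
  using assms(2,3)
proof (induction k arbitrary: f g)
  case 0
  then show ?case by (auto intro: continuous_intros)
next
  case (Suc k)
  show ?case
    by (rule differentiable_times_on_SucI'[OF assms(1)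
          has_derivative_add[OF differentiable_times_on_SucD[OF Suc.prems(1)]
            differentiable_times_on_SucD[OF Suc.prems(2)]]])
      (use Suc in \<open>simp_all\<close>)
qed

lemma differentiable_times_on_sum:
  assumes "open S" "\<And>i. i \<in> I \<Longrightarrow> differentiable_times_on k S (f i)"
  shows "differentiable_times_on k S (\<lambda>x. \<Sum>i\<in>I. f i x)"
  using assms(2)
  by (induction I rule: infinite_finite_induct)
    (auto intro: differentiable_times_on_const[OF assms(1)] differentiable_times_on_add[OF assms(1)])

lemma differentiable_times_on_bounded_linear:
  assumes "open S" "bounded_linear L" "differentiable_times_on k S f"
  shows "differentiable_times_on k S (\<lambda>x. L (f x))"
  using assms(3)
proof (induction k arbitrary: f)
  case 0
  then show ?case by (auto intro: bounded_linear.continuous_on[OF assms(2)])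
next
  case (Suc k)
  show ?case
    by (rule differentiable_times_on_SucI'[OF assms(1)
          bounded_linear.has_derivative[OF assms(2) differentiable_times_on_SucD[OF Suc.prems(1)]]])
      (use Suc in \<open>simp_all\<close>)
qed

lemma differentiable_times_on_scaleR:
  assumes "open S" "differentiable_times_on k S f" "differentiable_times_on k S g"
  shows "differentiable_times_on k S (\<lambda>x. f x *\<^sub>R g x)"
  using assms(2,3)
proof (induction k arbitrary: f g)
  case 0
  then show ?case by (auto intro: continuous_intros)
next
  case (Suc k)
  show ?case
  proof (rule differentiable_times_on_SucI'[OF assms(1)
          has_derivative_scaleR[OF differentiable_times_on_SucD[OF Suc.prems(1)]
            differentiable_times_on_SucD[OF Suc.prems(2)]]])
    show "differentiable_times_on k S
       (\<lambda>x. f x *\<^sub>R frechet_derivative g (at x) v + frechet_derivative f (at x) v *\<^sub>R g x)" for v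
      using Suc.prems Suc.prems[THEN differentiable_times_on_Suc_lower]
      by (intro differentiable_times_on_add[OF assms(1)] Suc.IH) (simp_all del: differentiable_times_on.simps add: differentiable_times_on.simps(2))
  qed
qed

lemma differentiable_times_on_id:
  assumes "open S" shows "differentiable_times_on k S (\<lambda>x. x)"
proof (cases k)
  case (Suc l)
  show ?thesis unfolding Suc
    by (rule differentiable_times_on_SucI'[OF assms, where f' = "\<lambda>x v. v"])
      (auto simp: differentiable_times_on_const[OF assms])
qed simp

lemma has_derivative_eq_sum_Basis:
  fixes f :: "'a::euclidean_space \<Rightarrow> 'b::real_normed_vector"
  assumes "(f has_derivative f') F"
  shows "f' v = (\<Sum>i\<in>Basis. (v \<bullet> i) *\<^sub>R f' i)"
proof -
  interpret bounded_linear f' using assms by (rule has_derivative_bounded_linear)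
  have "f' v = f' (\<Sum>i\<in>Basis. (v \<bullet> i) *\<^sub>R i)" by (simp add: euclidean_representation)
  then show ?thesis by (simp add: sum scale)
qed

lemma differentiable_times_on_compose:
  fixes f :: "'a::real_normed_vector \<Rightarrow> 'b::euclidean_space" and g :: "'b \<Rightarrow> 'c::real_normed_vector"
  assumes "open S" "open T" "differentiable_times_on k S f" "differentiable_times_on k T g" "f ` S \<subseteq> T"
  shows "differentiable_times_on k S (\<lambda>x. g (f x))"
  using assms(3,4)
proof (induction k arbitrary: g)
  case 0
  then show ?case using assms(5) by (auto intro: continuous_on_compose2)
next
  case (Suc k)
  have in_T: "f x \<in> T" if "x \<in> S" for x using assms(5) that by auto
  show ?case
  proof (rule differentiable_times_on_SucI'[OF assms(1)])
    \<comment> \<open>The direction in which \<open>g\<close> is differentiated moves with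
      \<open>x\<close>, whereas \<open>differentiable_times_on\<close> speaks of fixed directions.
      Expanding it in the basis leaves sums of products, which the induction covers.\<close>
    show "((\<lambda>x. g (f x)) has_derivative
        (\<lambda>v. \<Sum>i\<in>Basis. (frechet_derivative f (at x) v \<bullet> i) *\<^sub>R frechet_derivative g (at (f x)) i)) (at x)"
      if "x \<in> S" for x
      using has_derivative_compose[OF differentiable_times_on_SucD[OF Suc.prems(1) that]
          differentiable_times_on_SucD[OF Suc.prems(2) in_T[OF that]]]
      by (simp add: has_derivative_eq_sum_Basis[OF differentiable_times_on_SucD[OF Suc.prems(2) in_T[OF that]], symmetric])
    fix v
    have 1: "differentiable_times_on k S (\<lambda>x. frechet_derivative f (at x) v)"
      using Suc.prems by simp
    have 2: "differentiable_times_on k S (\<lambda>x. frechet_derivative g (at (f x)) i)" for i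
      by (rule Suc.IH) (use Suc.prems differentiable_times_on_Suc_lower[OF Suc.prems(1)] in auto)
    show "differentiable_times_on k S
       (\<lambda>x. \<Sum>i\<in>Basis. (frechet_derivative f (at x) v \<bullet> i) *\<^sub>R frechet_derivative g (at (f x)) i)"
      by (intro differentiable_times_on_sum differentiable_times_on_scaleR assms(1) 2
          differentiable_times_on_bounded_linear[OF assms(1) bounded_linear_inner_left] 1)
  qed
qed

section \<open>Infinitely differentiable functions\<close>

lemma smooth_on_subset: "smooth_on S f \<Longrightarrow> T \<subseteq> S \<Longrightarrow> smooth_on T f"
  unfolding smooth_on_def using differentiable_times_on_subset by blast

lemma smooth_on_cong:
  "open S \<Longrightarrow> smooth_on S f \<Longrightarrow> (\<And>x. x \<in> S \<Longrightarrow> f x = g x) \<Longrightarrow> smooth_on S g"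
  unfolding smooth_on_def using differentiable_times_on_cong by blast

lemma smooth_on_const: "open S \<Longrightarrow> smooth_on S (\<lambda>x. c)"
  unfolding smooth_on_def using differentiable_times_on_const by blast

lemma smooth_on_id: "open S \<Longrightarrow> smooth_on S (\<lambda>x. x)"
  unfolding smooth_on_def using differentiable_times_on_id by blast

lemma smooth_on_add: "open S \<Longrightarrow> smooth_on S f \<Longrightarrow> smooth_on S g \<Longrightarrow> smooth_on S (\<lambda>x. f x + g x)"
  unfolding smooth_on_def using differentiable_times_on_add by blast

lemma smooth_on_scaleR: "open S \<Longrightarrow> smooth_on S f \<Longrightarrow> smooth_on S g \<Longrightarrow> smooth_on S (\<lambda>x. f x *\<^sub>R g x)"
  unfolding smooth_on_def using differentiable_times_on_scaleR by blast

lemma smooth_on_mult: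
  "open S \<Longrightarrow> smooth_on S f \<Longrightarrow> smooth_on S g \<Longrightarrow> smooth_on S (\<lambda>x. f x * g x :: real)"
  using smooth_on_scaleR[of S f g] by simp

lemma smooth_on_sum:
  "open S \<Longrightarrow> (\<And>i. i \<in> I \<Longrightarrow> smooth_on S (f i)) \<Longrightarrow> smooth_on S (\<lambda>x. \<Sum>i\<in>I. f i x)"
  unfolding smooth_on_def by (simp add: differentiable_times_on_sum)

lemma smooth_on_bounded_linear:
  "open S \<Longrightarrow> bounded_linear L \<Longrightarrow> smooth_on S f \<Longrightarrow> smooth_on S (\<lambda>x. L (f x))"
  unfolding smooth_on_def by (simp add: differentiable_times_on_bounded_linear)

lemma smooth_on_compose:
  fixes f :: "'a::real_normed_vector \<Rightarrow> 'b::euclidean_space" and g :: "'b \<Rightarrow> 'c::real_normed_vector"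
  shows "open S \<Longrightarrow> open T \<Longrightarrow> smooth_on S f \<Longrightarrow> smooth_on T g \<Longrightarrow> f ` S \<subseteq> T
    \<Longrightarrow> smooth_on S (\<lambda>x. g (f x))"
  unfolding smooth_on_def by (auto intro: differentiable_times_on_compose)

lemma smooth_on_has_derivative:
  "smooth_on S f \<Longrightarrow> x \<in> S \<Longrightarrow> (f has_derivative frechet_derivative f (at x)) (at x)"
  unfolding smooth_on_def using differentiable_times_on_SucD by blast

lemma smooth_on_frechet_derivative:
  assumes "smooth_on S f" shows "smooth_on S (\<lambda>x. frechet_derivative f (at x) v)"
  using assms unfolding smooth_on_def by (metis differentiable_times_on.simps(2))

lemma smooth_on_imp_continuous_on: "smooth_on S f \<Longrightarrow> continuous_on S f"
  unfolding smooth_on_def by (metis differentiable_times_on.simps(1))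

text \<open>The family \<open>c * x powr a\<close> is closed under differentiation, hence the
  general \<open>c\<close> and \<open>a\<close> in the induction. The exponent -1/2 serves to
  normalise vectors in the Gram-Schmidt process.\<close>

lemma smooth_on_powr: "smooth_on {0<..} (\<lambda>x::real. x powr a)"
proof -
  have "differentiable_times_on k {0<..} (\<lambda>x::real. c * x powr a)" for k c
  proof (induction k arbitrary: a c)
    case 0
    then show ?case by (auto intro!: continuous_intros)
  next
    case (Suc k)
    show ?case
    proof (rule differentiable_times_on_SucI')
      show "((\<lambda>x. c * x powr a) has_derivative (\<lambda>v. (v * c * a) * x powr (a - 1))) (at x)"
        if "x \<in> {0<..}" for x
        using that by (auto intro!: derivative_eq_intros simp: powr_diff field_simps)
    qed (use Suc in auto)
  qed
  from this[of _ 1] show ?thesis by (simp add: smooth_on_def)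
qed


subsection \<open>Bump functions\<close>

text \<open>For \<open>P = 1\<close> this is the classical function exp(-1/x), flat at 0; the
  polynomial in 1/x absorbs the factors that differentiation produces.\<close>

definition flat_poly :: "real poly \<Rightarrow> real \<Rightarrow> real"
  where "flat_poly P x = (if x > 0 then poly P (inverse x) * exp (- inverse x) else 0)"

lemma tendsto_poly_mult_exp: "((\<lambda>x. poly P x * exp (- x)) \<longlongrightarrow> (0::real)) at_top"
proof -
  have "((\<lambda>x. \<Sum>i\<le>degree P. coeff P i * (x ^ i / exp x)) \<longlongrightarrow> (\<Sum>i\<le>degree P. coeff P i * 0)) at_top"
    by (intro tendsto_intros tendsto_power_div_exp_0)
  then show ?thesis
    by (simp add: poly_altdef exp_minus sum_distrib_right sum_divide_distrib field_simps)
qed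

lemma tendsto_flat_poly_0: "(flat_poly P \<longlongrightarrow> 0) (at 0)"
proof -
  have "((\<lambda>x. poly P (inverse x) * exp (- inverse x)) \<longlongrightarrow> 0) (at_right 0)"
    using filterlim_compose[OF tendsto_poly_mult_exp filterlim_inverse_at_top_right] .
  then have "(flat_poly P \<longlongrightarrow> 0) (at_right 0)"
    by (rule Lim_transform_eventually) (auto simp: eventually_at_filter flat_poly_def)
  moreover have "(flat_poly P \<longlongrightarrow> 0) (at_left 0)"
    by (rule Lim_transform_eventually[OF tendsto_const]) (auto simp: eventually_at_filter flat_poly_def)
  ultimately show ?thesis by (simp add: filterlim_split_at)
qed

text \<open>With \<open>u = 1/x\<close>, the derivative of \<open>P(u) exp(-u)\<close> is \<open>u\<^sup>2 (P(u) - P'(u)) exp(-u)\<close>,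
  so the functions \<^const>\<open>flat_poly\<close> are closed under differentiation.\<close>

lemma flat_poly_has_derivative:
  "(flat_poly P has_field_derivative flat_poly ([:0,0,1:] * (P - pderiv P)) x) (at x)"
proof -
  consider "x > 0" | "x < 0" | "x = 0" by linarith
  then show ?thesis
  proof cases
    case 1
    have "((\<lambda>x. poly P (inverse x) * exp (- inverse x)) has_field_derivative
        flat_poly ([:0,0,1:] * (P - pderiv P)) x) (at x)"
      using 1 by (auto intro!: derivative_eq_intros simp: flat_poly_def field_simps)
    then show ?thesis
      by (rule has_field_derivative_transform_within_open[of _ _ _ "{0<..}"]) (use 1 in \<open>auto simp: flat_poly_def\<close>)
  next
    case 2
    have "((\<lambda>x. 0) has_field_derivative flat_poly ([:0,0,1:] * (P - pderiv P)) x) (at x)"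
      using 2 by (simp add: flat_poly_def)
    then show ?thesis
      by (rule has_field_derivative_transform_within_open[of _ _ _ "{..<0}"]) (use 2 in \<open>auto simp: flat_poly_def\<close>)
  next
    case 3
    \<comment> \<open>The difference quotient at 0 is again a flat function, with one more factor
      1/y, so its limit is already known.\<close>
    have eq: "flat_poly (pCons 0 P) y = flat_poly P y / y" for y
      by (simp add: flat_poly_def field_simps)
    have "((\<lambda>y. (flat_poly P y - flat_poly P 0) / (y - 0)) \<longlongrightarrow> 0) (at 0)"
      using tendsto_flat_poly_0[of "pCons 0 P"] unfolding eq by (simp add: flat_poly_def)
    then show ?thesis using 3 by (simp add: has_field_derivative_iff flat_poly_def)
  qed
qed

lemma smooth_on_flat_poly: "smooth_on UNIV (flat_poly P)"
proof -
  have "differentiable_times_on k UNIV (\<lambda>x. c * flat_poly P x)" for k c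
  proof (induction k arbitrary: P c)
    case 0
    have "continuous_on UNIV (flat_poly P)"
      by (meson DERIV_continuous continuous_at_imp_continuous_on flat_poly_has_derivative)
    then show ?case by (auto intro: continuous_intros)
  next
    case (Suc k)
    define Q where "Q = [:0,0,1:] * (P - pderiv P)"
    show ?case
    proof (rule differentiable_times_on_SucI')
      show "((\<lambda>x. c * flat_poly P x) has_derivative (\<lambda>v. c * flat_poly Q x * v)) (at x)" for x
        using DERIV_cmult[OF flat_poly_has_derivative[of P x], of c]
        unfolding has_field_derivative_def Q_def[symmetric] .
      show "differentiable_times_on k UNIV (\<lambda>x. c * flat_poly Q x * v)" for v
        using Suc[of "c * v" Q] by (simp add: mult_ac)
    qed simp
  qed
  from this[of _ 1] show ?thesis by (simp add: smooth_on_def)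
qed

text \<open>The flat function is composed with \<open>r\<^sup>2 - (norm (x - x0))\<^sup>2\<close>
  and divided by its value exp(-1/r^2) at the centre. No plateau is asked for, since extending a
  tangent vector prescribes a value at one point only.\<close>

lemma exists_smooth_bump:
  fixes x0 :: "'a::euclidean_space"
  assumes "r > 0"
  obtains b :: "'a \<Rightarrow> real" where "smooth_on UNIV b" "b x0 = 1" "\<And>x. x \<notin> ball x0 r \<Longrightarrow> b x = 0"
proof
  let ?q = "\<lambda>x. r\<^sup>2 + (\<Sum>i\<in>Basis. (- 1) * (((x - x0) \<bullet> i) * ((x - x0) \<bullet> i)))"
  let ?b = "\<lambda>x. exp (inverse (r\<^sup>2)) * flat_poly 1 (?q x)"
  have q: "?q x = r\<^sup>2 - (norm (x - x0))\<^sup>2" for x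
    by (simp add: sum_negf power2_norm_eq_inner euclidean_inner[of "x - x0" "x - x0"])
  have 0: "smooth_on UNIV (\<lambda>x. (x - x0) \<bullet> i)" for i
    using smooth_on_add[OF _ smooth_on_bounded_linear[OF open_UNIV bounded_linear_inner_left smooth_on_id[OF open_UNIV]]
        smooth_on_const[OF open_UNIV], of i "- (x0 \<bullet> i)"]
    by (simp add: inner_diff_left)
  have "smooth_on UNIV ?q"
    by (intro smooth_on_add smooth_on_const smooth_on_sum smooth_on_mult 0 open_UNIV)
  then have "smooth_on UNIV (\<lambda>x. flat_poly 1 (?q x))"
    by (rule smooth_on_compose[OF open_UNIV open_UNIV _ smooth_on_flat_poly]) simp
  then show "smooth_on UNIV ?b"
    by (intro smooth_on_mult smooth_on_const open_UNIV)
  show "?b x0 = 1" using assms unfolding q by (simp add: flat_poly_def flip: exp_add)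
  show "?b x = 0" if "x \<notin> ball x0 r" for x
  proof -
    have "r\<^sup>2 \<le> (norm (x - x0))\<^sup>2"
      using that assms by (intro power_mono) (auto simp: dist_norm norm_minus_commute)
    then show ?thesis unfolding q by (simp add: flat_poly_def)
  qed
qed


subsection \<open>Hadamard's lemma\<close>

text \<open>Differentiating under the integral along the segment from \<open>p\<close> to
  \<open>x\<close> brings down a factor \<open>t\<close>, so the induction has to carry a general
  weight \<open>t ^ m\<close>.\<close>

lemma differentiable_times_on_radial_integral:
  fixes f :: "'a::euclidean_space \<Rightarrow> real"
  assumes "differentiable_times_on k (ball p r) f" "smooth_on (ball p r) f"
  shows "differentiable_times_on k (ball p r) (\<lambda>x. integral (cbox 0 1) (\<lambda>t. t ^ m * f (p + t *\<^sub>R (x - p))))"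
  using assms
proof (induction k arbitrary: f m)
  have in_ball: "p + t *\<^sub>R (x - p) \<in> ball p r" if "x \<in> ball p r" "t \<in> cbox 0 (1::real)" for x t
  proof -
    have "norm (t *\<^sub>R (x - p)) \<le> 1 * norm (x - p)"
      using that unfolding norm_scaleR by (intro mult_right_mono) auto
    then show ?thesis using that by (simp add: dist_norm norm_minus_commute)
  qed
  have cont: "continuous_on (ball p r \<times> cbox 0 1) (\<lambda>(x, t). t ^ m * f (p + t *\<^sub>R (x - p)))"
    if "continuous_on (ball p r) f" for m and f :: "'a \<Rightarrow> real"
    unfolding split_def
    by (intro continuous_intros continuous_on_compose2[OF that]) (use in_ball in auto)
  {
    case 0
    show ?case
      using integral_continuous_on_param[OF cont[OF smooth_on_imp_continuous_on[OF 0(2)]], of m] by simp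
  next
    case (Suc k)
    let ?f' = "\<lambda>x. frechet_derivative f (at x)"
    have d: "(f has_derivative ?f' x) (at x)" if "x \<in> ball p r" for x
      using smooth_on_has_derivative[OF Suc.prems(2) that] .
    \<comment> \<open>\<open>leibniz_rule\<close> wants the derivative as a jointly continuous map
      into the bounded linear functions. In finite dimension this continuity can be checked on basis
      vectors.\<close>
    let ?F = "\<lambda>x t. Blinfun (\<lambda>v. t ^ Suc m * ?f' (p + t *\<^sub>R (x - p)) v)"
    have bl: "bounded_linear (\<lambda>v. t ^ Suc m * ?f' (p + t *\<^sub>R (x - p)) v)"
      if "x \<in> ball p r" "t \<in> cbox 0 1" for x t
      using bounded_linear_const_mult[OF has_derivative_bounded_linear[OF d[OF in_ball[OF that]]]] .
    have contF: "continuous_on (ball p r \<times> cbox 0 1) (\<lambda>(x, t). ?F x t)"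
    proof (rule continuous_on_blinfun_componentwise)
      fix i :: 'a
      show "continuous_on (ball p r \<times> cbox 0 1) (\<lambda>z. blinfun_apply (case z of (x, t) \<Rightarrow> ?F x t) i)"
        by (rule continuous_on_cong[THEN iffD1, OF refl _
              cont[OF smooth_on_imp_continuous_on[OF smooth_on_frechet_derivative[OF Suc.prems(2)]], of "Suc m" i]])
          (use bl in \<open>auto simp: bounded_linear_Blinfun_apply\<close>)
    qed
    show ?case
    proof (rule differentiable_times_on_SucI')
      fix x assume x: "x \<in> ball p r"
      have "((\<lambda>x. integral (cbox 0 1) (\<lambda>t. t ^ m * f (p + t *\<^sub>R (x - p)))) has_derivative
          integral (cbox 0 1) (?F x)) (at x within ball p r)"
      proof (rule leibniz_rule[where f = "\<lambda>x t. t ^ m * f (p + t *\<^sub>R (x - p))" and fx = ?F, OF _ _ contF x convex_ball])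
        fix y and t :: real assume yt: "y \<in> ball p r" "t \<in> cbox 0 1"
        have "((\<lambda>y. p + t *\<^sub>R (y - p)) has_derivative (\<lambda>v. t *\<^sub>R v)) (at y)"
          by (auto intro!: derivative_eq_intros)
        from has_derivative_compose[OF this d[OF in_ball[OF yt]]]
        have "((\<lambda>y. f (p + t *\<^sub>R (y - p))) has_derivative (\<lambda>v. ?f' (p + t *\<^sub>R (y - p)) (t *\<^sub>R v))) (at y)" .
        then have "((\<lambda>y. t ^ m * f (p + t *\<^sub>R (y - p))) has_derivative
            (\<lambda>v. t ^ m * ?f' (p + t *\<^sub>R (y - p)) (t *\<^sub>R v))) (at y)"
          by (rule has_derivative_mult_right)
        moreover have "?f' (p + t *\<^sub>R (y - p)) (t *\<^sub>R v) = t * ?f' (p + t *\<^sub>R (y - p)) v" for v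
          using linear_scale[OF has_derivative_linear[OF d[OF in_ball[OF yt]]]] by simp
        ultimately have "((\<lambda>y. t ^ m * f (p + t *\<^sub>R (y - p))) has_derivative
            blinfun_apply (?F y t)) (at y)"
          using bl[OF yt] by (simp add: bounded_linear_Blinfun_apply mult_ac)
        then show "((\<lambda>y. t ^ m * f (p + t *\<^sub>R (y - p))) has_derivative
            blinfun_apply (?F y t)) (at y within ball p r)"
          by (rule has_derivative_at_withinI)
      next
        fix y assume y: "y \<in> ball p r"
        have "continuous_on (cbox 0 1) (\<lambda>t. t ^ m * f (p + t *\<^sub>R (y - p)))"
          by (intro continuous_intros continuous_on_compose2[OF smooth_on_imp_continuous_on[OF Suc.prems(2)]])
            (use in_ball y in auto)
        then show "(\<lambda>t. t ^ m * f (p + t *\<^sub>R (y - p))) integrable_on cbox 0 1"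
          by (rule integrable_continuous)
      qed
      then show "((\<lambda>x. integral (cbox 0 1) (\<lambda>t. t ^ m * f (p + t *\<^sub>R (x - p)))) has_derivative
          integral (cbox 0 1) (?F x)) (at x)"
        unfolding at_within_open[OF x open_ball] .
    next
      fix v
      have eq: "integral (cbox 0 1) (\<lambda>t. t ^ Suc m * ?f' (p + t *\<^sub>R (x - p)) v)
          = blinfun_apply (integral (cbox 0 1) (?F x)) v" if x: "x \<in> ball p r" for x
      proof -
        have "continuous_on (cbox 0 1) (\<lambda>t. (\<lambda>(x,t). ?F x t) (x, t))"
          by (rule continuous_on_compose2[OF contF]) (use x in \<open>auto intro!: continuous_intros\<close>)
        then have "(?F x) integrable_on cbox 0 1"
          unfolding split_conv by (rule integrable_continuous)
        from blinfun_apply_integral[OF this, of v]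
        show ?thesis
          by (subst integral_cong[OF fun_cong[OF bounded_linear_Blinfun_apply[OF bl[OF x], symmetric]]]) auto
      qed
      have "differentiable_times_on k (ball p r)
         (\<lambda>x. integral (cbox 0 1) (\<lambda>t. t ^ Suc m * ?f' (p + t *\<^sub>R (x - p)) v))"
        using Suc.prems by (intro Suc.IH) (auto intro: smooth_on_frechet_derivative)
      from differentiable_times_on_cong[OF open_ball this eq]
      show "differentiable_times_on k (ball p r) (\<lambda>x. blinfun_apply (integral (cbox 0 1) (?F x)) v)" .
    qed simp
  }
qed

text \<open>The fundamental theorem of calculus along the segment from \<open>p\<close> to
  \<open>x\<close>; \<open>G i\<close> is the mean of the i-th partial derivative over that segment.
  Since the factors \<open>(x - p) \<bullet> i\<close> vanish at \<open>p\<close>, the Leibniz rule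
  will determine a derivation from its values on coordinates.\<close>

lemma Hadamard:
  fixes f :: "'a::euclidean_space \<Rightarrow> real"
  assumes "smooth_on (ball p r) f"
  obtains G where "\<And>i. smooth_on (ball p r) (G i)"
    "\<And>x. x \<in> ball p r \<Longrightarrow> f x = f p + (\<Sum>i\<in>Basis. ((x - p) \<bullet> i) * G i x)"
    "\<And>i. r > 0 \<Longrightarrow> G i p = frechet_derivative f (at p) i"
proof
  let ?f' = "\<lambda>x. frechet_derivative f (at x)"
  \<comment> \<open>The factor \<open>t ^ 0\<close> puts the integral into the shape of the
    preceding lemma with \<open>m = 0\<close>.\<close>
  let ?G = "\<lambda>i x. integral (cbox 0 1) (\<lambda>t. t ^ 0 * ?f' (p + t *\<^sub>R (x - p)) i)"
  have d: "(f has_derivative ?f' x) (at x)" if "x \<in> ball p r" for x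
    using smooth_on_has_derivative[OF assms that] .
  show "smooth_on (ball p r) (?G i)" for i
    unfolding smooth_on_def
    using differentiable_times_on_radial_integral[OF _ smooth_on_frechet_derivative[OF assms], of _ _ 0]
      smooth_on_frechet_derivative[OF assms] unfolding smooth_on_def by blast
  show "?G i p = frechet_derivative f (at p) i" for i by simp
  fix x assume x: "x \<in> ball p r"
  have in_ball: "p + t *\<^sub>R (x - p) \<in> ball p r" if "t \<in> {0..1}" for t
  proof -
    have "norm (t *\<^sub>R (x - p)) \<le> 1 * norm (x - p)"
      using that unfolding norm_scaleR by (intro mult_right_mono) auto
    then show ?thesis using x by (simp add: dist_norm norm_minus_commute)
  qed
  have "((\<lambda>t. ?f' (p + t *\<^sub>R (x - p)) (x - p)) has_integral
      f (p + 1 *\<^sub>R (x - p)) - f (p + 0 *\<^sub>R (x - p))) {0..1}"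
  proof (rule fundamental_theorem_of_calculus)
    fix t :: real assume t: "t \<in> {0..1}"
    have "((\<lambda>t. p + t *\<^sub>R (x - p)) has_derivative (\<lambda>s. s *\<^sub>R (x - p))) (at t within {0..1})"
      by (auto intro!: derivative_eq_intros)
    from has_derivative_compose[OF this d[OF in_ball[OF t]]]
    show "((\<lambda>t. f (p + t *\<^sub>R (x - p))) has_vector_derivative ?f' (p + t *\<^sub>R (x - p)) (x - p))
        (at t within {0..1})"
      using linear_scale[OF has_derivative_linear[OF d[OF in_ball[OF t]]]]
      by (simp add: has_vector_derivative_def)
  qed simp
  then have "f x - f p = integral {0..1} (\<lambda>t. ?f' (p + t *\<^sub>R (x - p)) (x - p))"
    by (simp add: integral_unique)
  also have "\<dots> = integral {0..1} (\<lambda>t. \<Sum>i\<in>Basis. ((x - p) \<bullet> i) * ?f' (p + t *\<^sub>R (x - p)) i)"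
    by (rule integral_cong) (subst has_derivative_eq_sum_Basis[OF d[OF in_ball]], auto)
  also have "\<dots> = (\<Sum>i\<in>Basis. integral {0..1} (\<lambda>t. ((x - p) \<bullet> i) * ?f' (p + t *\<^sub>R (x - p)) i))"
  proof (rule integral_sum)
    fix i :: 'a
    have "continuous_on {0..1} (\<lambda>t. ((x - p) \<bullet> i) * ?f' (p + t *\<^sub>R (x - p)) i)"
      by (intro continuous_intros continuous_on_compose2[OF smooth_on_imp_continuous_on[OF smooth_on_frechet_derivative[OF assms]]])
        (use in_ball in auto)
    then show "(\<lambda>t. ((x - p) \<bullet> i) * ?f' (p + t *\<^sub>R (x - p)) i) integrable_on {0..1}"
      by (rule integrable_continuous_real)
  qed simp
  finally show "f x = f p + (\<Sum>i\<in>Basis. ((x - p) \<bullet> i) * ?G i x)"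
    by (simp add: integral_mult_right)
qed

subsection \<open>Smooth functions on a manifold\<close>

lemma sum_fun_apply: "(\<Sum>i\<in>I. f i) x = (\<Sum>i\<in>I. f i x)"
  by (induction I rule: infinite_finite_induct) auto

lemma isCont_nhds: "isCont f x \<Longrightarrow> filterlim f (nhds (f x)) (nhds x)"
  unfolding isCont_def tendsto_at_iff_tendsto_nhds .

locale manifold =
  fixes A :: "('m::{t2_space, second_countable_topology}, 'a::euclidean_space) atlas"
  assumes atlas: "smooth_atlas A"
begin

lemma chart_at: obtains U c where "(U, c) \<in> A" "p \<in> U"
proof -
  have "p \<in> (\<Union>(U, c)\<in>A. U)" using atlas by (simp add: smooth_atlas_def)
  then show ?thesis using that by auto
qed

lemma
  assumes "(U, c) \<in> A"
  shows open_chart: "open U" and open_chart_image: "open (c ` U)"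
    and homeomorphism_chart: "homeomorphism U (c ` U) c (inv_into U c)"
proof -
  have "\<forall>(U, c)\<in>A. open U \<and> open (c ` U) \<and> homeomorphism U (c ` U) c (inv_into U c)"
    using atlas by (simp add: smooth_atlas_def)
  from bspec[OF this assms]
  show "open U" "open (c ` U)" "homeomorphism U (c ` U) c (inv_into U c)" by simp_all
qed

lemma inv_chart: "(U, c) \<in> A \<Longrightarrow> q \<in> U \<Longrightarrow> inv_into U c (c q) = q"
  using homeomorphism_chart homeomorphism_apply1 by metis

lemma chart_inv: "x \<in> c ` U \<Longrightarrow> c (inv_into U c x) = x"
  by (rule f_inv_into_f)

lemma smooth_on_transition:
  assumes "(U, c) \<in> A" "(V, d) \<in> A" shows "smooth_on (c ` (U \<inter> V)) (d \<circ> inv_into U c)"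
proof -
  have "\<forall>(U, c)\<in>A. \<forall>(V, d)\<in>A. smooth_on (c ` (U \<inter> V)) (d \<circ> inv_into U c)"
    using atlas by (simp add: smooth_atlas_def)
  from bspec[OF this assms(1)] show ?thesis using assms(2) by fast
qed

lemma open_chart_image_subset:
  assumes "(U, c) \<in> A" "open V" "V \<subseteq> U" shows "open (c ` V)"
  using homeomorphism_imp_open_map[OF homeomorphism_chart[OF assms(1)], of V] assms
    open_chart_image[OF assms(1)] open_chart[OF assms(1)]
  by (simp add: openin_open_eq)

lemma tendsto_chart:
  assumes "(U, c) \<in> A" "p \<in> U" shows "filterlim c (nhds (c p)) (nhds p)"
  using assms homeomorphism_cont1[OF homeomorphism_chart[OF assms(1)]] open_chart
  by (simp add: continuous_on_eq_continuous_at isCont_def tendsto_at_iff_tendsto_nhds)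

lemma tendsto_inv_chart:
  assumes "(U, c) \<in> A" "p \<in> U" shows "filterlim (inv_into U c) (nhds p) (nhds (c p))"
proof -
  have *: "isCont (inv_into U c) (c p)"
    using assms homeomorphism_cont2[OF homeomorphism_chart[OF assms(1)]] open_chart_image
    by (simp add: continuous_on_eq_continuous_at)
  show ?thesis
    using isCont_nhds[OF *] inv_chart[OF assms] by simp
qed

lemma eventually_in_chart: "(U, c) \<in> A \<Longrightarrow> p \<in> U \<Longrightarrow> \<forall>\<^sub>F q in nhds p. q \<in> U"
  using open_chart eventually_nhds_in_open by blast

lemma eventually_nhds_chart:
  assumes "(U, c) \<in> A" "p \<in> U"
  shows "eventually P (nhds p) \<longleftrightarrow> (\<forall>\<^sub>F x in nhds (c p). P (inv_into U c x))"
proof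
  show "eventually P (nhds p) \<Longrightarrow> \<forall>\<^sub>F x in nhds (c p). P (inv_into U c x)"
    by (rule eventually_compose_filterlim[OF _ tendsto_inv_chart[OF assms]])
  assume "\<forall>\<^sub>F x in nhds (c p). P (inv_into U c x)"
  from eventually_compose_filterlim[OF this tendsto_chart[OF assms]] eventually_in_chart[OF assms]
  show "eventually P (nhds p)"
    by eventually_elim (simp add: inv_chart[OF assms(1)])
qed

text \<open>\<open>smooth_at\<close> only promises some chart and some neighbourhood; the smooth
  transition maps turn these into any prescribed chart. Balls are used because Hadamard's lemma
  needs segments to the centre.\<close>

lemma smooth_at_chart_iff:
  assumes "(U, c) \<in> A" "p \<in> U"
  shows "smooth_at A p f \<longleftrightarrow> (\<exists>r>0. ball (c p) r \<subseteq> c ` U \<and> smooth_on (ball (c p) r) (f \<circ> inv_into U c))"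
proof
  assume "smooth_at A p f"
  then obtain U' c' V where V: "(U', c') \<in> A" "open V" "p \<in> V" "V \<subseteq> U'"
      "smooth_on (c' ` V) (f \<circ> inv_into U' c')"
    unfolding smooth_at_def by blast
  define S where "S = c ` (U \<inter> V)"
  have S: "open S" unfolding S_def
    by (rule open_chart_image_subset) (use assms V open_chart in auto)
  have "smooth_on S (\<lambda>x. (f \<circ> inv_into U' c') ((c' \<circ> inv_into U c) x))"
  proof (rule smooth_on_compose[OF S open_chart_image_subset[OF V(1,2,4)] _ V(5)])
    show "smooth_on S (c' \<circ> inv_into U c)"
      by (rule smooth_on_subset[OF smooth_on_transition[OF assms(1) V(1)]]) (use V in \<open>auto simp: S_def\<close>)
    show "(c' \<circ> inv_into U c) ` S \<subseteq> c' ` V"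
      using inv_chart[OF assms(1)] by (auto simp: S_def)
  qed
  then have *: "smooth_on S (f \<circ> inv_into U c)"
    by (rule smooth_on_cong[OF S]) (use V inv_chart[OF assms(1)] inv_chart[OF V(1)] in \<open>auto simp: S_def\<close>)
  have "c p \<in> S" using assms V by (auto simp: S_def)
  then obtain r where "r > 0" "ball (c p) r \<subseteq> S" using S openE by blast
  then show "\<exists>r>0. ball (c p) r \<subseteq> c ` U \<and> smooth_on (ball (c p) r) (f \<circ> inv_into U c)"
    using smooth_on_subset[OF *] by (intro exI[of _ r]) (auto simp: S_def)
next
  assume "\<exists>r>0. ball (c p) r \<subseteq> c ` U \<and> smooth_on (ball (c p) r) (f \<circ> inv_into U c)"
  then obtain r where r: "r > 0" "ball (c p) r \<subseteq> c ` U" "smooth_on (ball (c p) r) (f \<circ> inv_into U c)"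
    by blast
  let ?V = "U \<inter> c -` ball (c p) r"
  have "open ?V"
    using homeomorphism_cont1[OF homeomorphism_chart[OF assms(1)]] open_chart[OF assms(1)]
    by (intro continuous_open_preimage) auto
  moreover have "c ` ?V = ball (c p) r" using r(2) by auto
  ultimately show "smooth_at A p f"
    unfolding smooth_at_def using assms r by (intro bexI[of _ "(U, c)"]) (auto intro!: exI[of _ ?V])
qed

lemma smooth_at_chartI:
  assumes "(U, c) \<in> A" "p \<in> U" "open S" "c p \<in> S" "smooth_on S (f \<circ> inv_into U c)"
  shows "smooth_at A p f"
proof -
  have "open (S \<inter> c ` U)" "c p \<in> S \<inter> c ` U" using assms open_chart_image by auto
  then obtain r where "r > 0" "ball (c p) r \<subseteq> S \<inter> c ` U" using openE by blast
  then show ?thesis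
    unfolding smooth_at_chart_iff[OF assms(1,2)] using smooth_on_subset[OF assms(5)] by blast
qed

lemma smooth_at_chartE:
  assumes "smooth_at A p f" "(U, c) \<in> A" "p \<in> U"
  obtains r where "r > 0" "ball (c p) r \<subseteq> c ` U" "smooth_on (ball (c p) r) (f \<circ> inv_into U c)"
  using assms smooth_at_chart_iff by blast

lemma smooth_at_binary:
  assumes op: "\<And>(S :: 'a set) f g. open S \<Longrightarrow> smooth_on S f \<Longrightarrow> smooth_on S g \<Longrightarrow> smooth_on S (\<lambda>x. F (f x) (g x))"
    and "smooth_at A p f" "smooth_at A p g"
  shows "smooth_at A p (\<lambda>q. F (f q) (g q))"
proof -
  obtain U c where c: "(U, c) \<in> A" "p \<in> U" by (rule chart_at)
  obtain r where r: "r > 0" "smooth_on (ball (c p) r) (f \<circ> inv_into U c)"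
    using smooth_at_chartE[OF assms(2) c] .
  obtain s where s: "s > 0" "smooth_on (ball (c p) s) (g \<circ> inv_into U c)"
    using smooth_at_chartE[OF assms(3) c] .
  show ?thesis
  proof (rule smooth_at_chartI[OF c, of "ball (c p) (min r s)"])
    have "smooth_on (ball (c p) (min r s)) (\<lambda>x. F ((f \<circ> inv_into U c) x) ((g \<circ> inv_into U c) x))"
      by (rule op[OF open_ball smooth_on_subset[OF r(2)] smooth_on_subset[OF s(2)]]) auto
    then show "smooth_on (ball (c p) (min r s)) ((\<lambda>q. F (f q) (g q)) \<circ> inv_into U c)"
      by (simp add: o_def)
  qed (use r s in auto)
qed

lemma smooth_at_add: "smooth_at A p f \<Longrightarrow> smooth_at A p g \<Longrightarrow> smooth_at A p (\<lambda>q. f q + g q)"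
  by (rule smooth_at_binary[OF smooth_on_add])

lemma smooth_at_scaleR: "smooth_at A p f \<Longrightarrow> smooth_at A p g \<Longrightarrow> smooth_at A p (\<lambda>q. f q *\<^sub>R g q)"
  by (rule smooth_at_binary[OF smooth_on_scaleR])

lemma smooth_at_mult:
  "smooth_at A p f \<Longrightarrow> smooth_at A p g \<Longrightarrow> smooth_at A p (\<lambda>q. f q * g q :: real)"
  by (rule smooth_at_binary[OF smooth_on_mult])

lemma smooth_at_const: "smooth_at A p (\<lambda>q. k)"
proof -
  obtain U c where c: "(U, c) \<in> A" "p \<in> U" by (rule chart_at)
  show ?thesis
    by (rule smooth_at_chartI[OF c open_UNIV]) (auto simp: o_def smooth_on_const)
qed

lemma smooth_at_minus: "smooth_at A p f \<Longrightarrow> smooth_at A p (\<lambda>q. - f q)"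
  using smooth_at_scaleR[OF smooth_at_const[of p "-1"]] by auto

lemma smooth_at_diff: "smooth_at A p f \<Longrightarrow> smooth_at A p g \<Longrightarrow> smooth_at A p (\<lambda>q. f q - g q)"
  using smooth_at_add[OF _ smooth_at_minus] by auto

lemma smooth_at_sum:
  "(\<And>i. i \<in> I \<Longrightarrow> smooth_at A p (f i)) \<Longrightarrow> smooth_at A p (\<lambda>q. \<Sum>i\<in>I. f i q)"
  by (induction I rule: infinite_finite_induct) (auto intro: smooth_at_const smooth_at_add)

lemma smooth_at_cong:
  assumes "smooth_at A p f" and ev: "\<forall>\<^sub>F q in nhds p. f q = f' q"
  shows "smooth_at A p f'"
proof -
  obtain U c where c: "(U, c) \<in> A" "p \<in> U" by (rule chart_at)
  obtain r where r: "r > 0" "smooth_on (ball (c p) r) (f \<circ> inv_into U c)"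
    using smooth_at_chartE[OF assms(1) c] .
  obtain S where S: "open S" "c p \<in> S" "\<forall>x\<in>S. f (inv_into U c x) = f' (inv_into U c x)"
    using iffD1[OF eventually_nhds iffD1[OF eventually_nhds_chart[OF c] ev]] by auto
  show ?thesis
  proof (rule smooth_at_chartI[OF c, of "S \<inter> ball (c p) r"])
    show "smooth_on (S \<inter> ball (c p) r) (f' \<circ> inv_into U c)"
      by (rule smooth_on_cong[OF _ smooth_on_subset[OF r(2)]]) (use S in auto)
  qed (use S r in auto)
qed

lemma smooth_at_cong_iff:
  "\<forall>\<^sub>F q in nhds p. f q = f' q \<Longrightarrow> smooth_at A p f \<longleftrightarrow> smooth_at A p f'"
  using smooth_at_cong[of p f f'] smooth_at_cong[of p f' f] by (auto simp: eq_commute)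

text \<open>Smoothness at a point is an open condition. This is what allows identities of
  derivations to hold on a neighbourhood and hence to be differentiated again.\<close>

lemma eventually_smooth_at:
  assumes "smooth_at A p f" shows "\<forall>\<^sub>F q in nhds p. smooth_at A q f"
proof -
  obtain U c where c: "(U, c) \<in> A" "p \<in> U" by (rule chart_at)
  obtain r where r: "r > 0" "ball (c p) r \<subseteq> c ` U" "smooth_on (ball (c p) r) (f \<circ> inv_into U c)"
    using smooth_at_chartE[OF assms(1) c] .
  have "\<forall>\<^sub>F x in nhds (c p). x \<in> ball (c p) r"
    using r by (intro eventually_nhds_in_open) auto
  then show ?thesis unfolding eventually_nhds_chart[OF c]
  proof eventually_elim
    case (elim x)
    then have "x \<in> c ` U" using r by auto
    then show ?case
      by (intro smooth_at_chartI[OF c(1) _ open_ball _ r(3)]) (use elim in \<open>auto simp: inv_into_into chart_inv\<close>)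
  qed
qed

lemma smooth_at_compose:
  fixes f :: "'m \<Rightarrow> 'b::euclidean_space" and k :: "'b \<Rightarrow> 'c::real_normed_vector"
  assumes "smooth_at A p f" "open T" "f p \<in> T" "smooth_on T k"
  shows "smooth_at A p (\<lambda>q. k (f q))"
proof -
  obtain U c where c: "(U, c) \<in> A" "p \<in> U" by (rule chart_at)
  obtain r where r: "r > 0" "smooth_on (ball (c p) r) (f \<circ> inv_into U c)"
    using smooth_at_chartE[OF assms(1) c] .
  let ?S = "ball (c p) r \<inter> (f \<circ> inv_into U c) -` T"
  have S: "open ?S"
    by (rule continuous_open_preimage[OF smooth_on_imp_continuous_on[OF r(2)] open_ball assms(2)])
  show ?thesis
  proof (rule smooth_at_chartI[OF c S])
    have "smooth_on ?S (\<lambda>x. k ((f \<circ> inv_into U c) x))"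
      by (rule smooth_on_compose[OF S assms(2) smooth_on_subset[OF r(2)] assms(4)]) auto
    then show "smooth_on ?S ((\<lambda>q. k (f q)) \<circ> inv_into U c)" by (simp add: o_def)
  qed (use r assms c inv_chart in auto)
qed

lemma smooth_at_bounded_linear:
  assumes "smooth_at A p f" "bounded_linear L" shows "smooth_at A p (\<lambda>q. L (f q))"
proof -
  obtain U c where c: "(U, c) \<in> A" "p \<in> U" by (rule chart_at)
  obtain r where r: "r > 0" "smooth_on (ball (c p) r) (f \<circ> inv_into U c)"
    using smooth_at_chartE[OF assms(1) c] .
  show ?thesis
    by (rule smooth_at_chartI[OF c open_ball[of _ r]])
      (use smooth_on_bounded_linear[OF open_ball assms(2) r(2)] r(1) in \<open>auto simp: o_def\<close>)
qed

lemma smooth_at_tendsto: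
  assumes "smooth_at A p f" shows "filterlim f (nhds (f p)) (nhds p)"
proof -
  obtain U c where c: "(U, c) \<in> A" "p \<in> U" by (rule chart_at)
  obtain r where r: "r > 0" "smooth_on (ball (c p) r) (f \<circ> inv_into U c)"
    using smooth_at_chartE[OF assms(1) c] .
  have "isCont (f \<circ> inv_into U c) (c p)"
    using smooth_on_imp_continuous_on[OF r(2)] r(1) by (simp add: continuous_on_eq_continuous_at del: o_apply)
  then have "filterlim (f \<circ> inv_into U c) (nhds (f p)) (nhds (c p))"
    using isCont_nhds inv_chart[OF c] by fastforce
  from filterlim_compose[OF this tendsto_chart[OF c]]
  show ?thesis
    by (rule filterlim_cong[THEN iffD1, rotated 3])
      (auto intro!: eventually_mono[OF eventually_in_chart[OF c]] simp: inv_chart[OF c(1)])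
qed

lemma smooth_at_chart: assumes "(U, c) \<in> A" "p \<in> U" shows "smooth_at A p c"
proof (rule smooth_at_chartI[OF assms open_chart_image[OF assms(1)]])
  show "smooth_on (c ` U) (c \<circ> inv_into U c)"
    by (rule smooth_on_cong[OF _ smooth_on_id]) (use open_chart_image[OF assms(1)] in \<open>auto simp: chart_inv\<close>)
qed (use assms in auto)

lemma smooth_at_coord: "(U, c) \<in> A \<Longrightarrow> p \<in> U \<Longrightarrow> smooth_at A p (\<lambda>q. c q \<bullet> i)"
  using smooth_at_bounded_linear[OF smooth_at_chart bounded_linear_inner_left] .

text \<open>The localisation device: what vanishes on \<open>S\<close> equals its own product with
  this function, while the Leibniz rule at \<open>p\<close> makes every term of that product zero.
  Dependence on germs follows without cut-off functions.\<close>

lemma smooth_at_indicator: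
  assumes "open S" "p \<in> S" shows "smooth_at A p (\<lambda>q. if q \<in> S then 0 else 1 :: real)"
  by (rule smooth_at_cong[OF smooth_at_const[of p 0]])
    (use eventually_nhds_in_open[OF assms] in eventually_elim, simp)

subsection \<open>Tangent vectors\<close>

lemma tangent_nonsmooth: "v \<in> tangent_space A p \<Longrightarrow> \<not> smooth_at A p f \<Longrightarrow> v f = 0"
  by (simp add: tangent_space_def)

lemma tangent_add:
  "v \<in> tangent_space A p \<Longrightarrow> smooth_at A p f \<Longrightarrow> smooth_at A p f' \<Longrightarrow> v (\<lambda>q. f q + f' q) = v f + v f'"
  by (simp add: tangent_space_def)

lemma tangent_mult:
  "v \<in> tangent_space A p \<Longrightarrow> smooth_at A p f \<Longrightarrow> smooth_at A p f' \<Longrightarrow>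
    v (\<lambda>q. f q * f' q) = v f * f' p + f p * v f'"
  by (simp add: tangent_space_def)

lemma tangent_scale:
  "v \<in> tangent_space A p \<Longrightarrow> smooth_at A p f \<Longrightarrow> v (\<lambda>q. r * f q) = r * v f"
  by (simp add: tangent_space_def)

lemma tangent_spaceI:
  assumes "\<And>f. \<not> smooth_at A p f \<Longrightarrow> v f = 0"
    and "\<And>f f'. smooth_at A p f \<Longrightarrow> smooth_at A p f' \<Longrightarrow> v (\<lambda>q. f q + f' q) = v f + v f'"
    and "\<And>f f'. smooth_at A p f \<Longrightarrow> smooth_at A p f' \<Longrightarrow> v (\<lambda>q. f q * f' q) = v f * f' p + f p * v f'"
    and "\<And>f r. smooth_at A p f \<Longrightarrow> v (\<lambda>q. r * f q) = r * v f"
  shows "v \<in> tangent_space A p"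
  using assms by (simp add: tangent_space_def)

lemma tangent_zero_fun: "v \<in> tangent_space A p \<Longrightarrow> v (\<lambda>q. 0) = 0"
  using tangent_scale[of v p "\<lambda>q. 0" 0] by (simp add: smooth_at_const)

lemma tangent_diff:
  assumes "v \<in> tangent_space A p" "smooth_at A p f" "smooth_at A p f'"
  shows "v (\<lambda>q. f q - f' q) = v f - v f'"
  using tangent_add[OF assms(1,2) smooth_at_minus[OF assms(3)]] tangent_scale[OF assms(1,3), of "- 1"]
  by simp

lemma tangent_vanish:
  assumes v: "v \<in> tangent_space A p" and ev: "\<forall>\<^sub>F q in nhds p. f q = 0"
  shows "v f = 0"
proof -
  obtain S where S: "open S" "p \<in> S" "\<forall>q\<in>S. f q = 0"
    using iffD1[OF eventually_nhds ev] by auto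
  have "f = (\<lambda>q. (if q \<in> S then 0 else 1) * f q)" using S(3) by (intro ext) simp
  moreover have "smooth_at A p f"
    unfolding smooth_at_cong_iff[OF ev] by (rule smooth_at_const)
  ultimately show ?thesis
    using tangent_mult[OF v smooth_at_indicator[OF S(1,2)], of f] S by simp
qed

lemma tangent_cong:
  assumes v: "v \<in> tangent_space A p" and ev: "\<forall>\<^sub>F q in nhds p. f q = f' q"
  shows "v f = v f'"
proof (cases "smooth_at A p f")
  case True
  then have "smooth_at A p f'" using smooth_at_cong_iff[OF ev] by simp
  moreover have "v (\<lambda>q. f q - f' q) = 0" by (rule tangent_vanish[OF v]) (use ev in simp)
  ultimately show ?thesis using tangent_diff[OF v True] by simp
next
  case False
  then show ?thesis using smooth_at_cong_iff[OF ev] tangent_nonsmooth[OF v] by metis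
qed

lemma tangent_const: "v \<in> tangent_space A p \<Longrightarrow> v (\<lambda>q. k) = 0"
  using tangent_mult[of v p "\<lambda>q. 1" "\<lambda>q. 1"] tangent_scale[of v p "\<lambda>q. 1" k]
  by (simp add: smooth_at_const)

lemma tangent_sum:
  assumes "v \<in> tangent_space A p" "\<And>i. i \<in> I \<Longrightarrow> smooth_at A p (f i)"
  shows "v (\<lambda>q. \<Sum>i\<in>I. f i q) = (\<Sum>i\<in>I. v (f i))"
  using assms(2)
  by (induction I rule: infinite_finite_induct)
    (auto simp: tangent_zero_fun[OF assms(1)] tangent_add[OF assms(1)] smooth_at_sum)

lemma subspace_tangent_space: "subspace (tangent_space A p)"
proof (rule subspaceI)
  show "0 \<in> tangent_space A p" by (simp add: tangent_space_def)
  show "x + y \<in> tangent_space A p" if "x \<in> tangent_space A p" "y \<in> tangent_space A p" for x y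
    using that by (simp add: tangent_space_def algebra_simps)
  show "r *\<^sub>R x \<in> tangent_space A p" if "x \<in> tangent_space A p" for r x
    using that by (simp add: tangent_space_def scaleR_fun_def algebra_simps)
qed

lemmas tangent_closed = subspace_0[OF subspace_tangent_space] subspace_add[OF subspace_tangent_space]
  subspace_diff[OF subspace_tangent_space] subspace_neg[OF subspace_tangent_space]
  subspace_scale[OF subspace_tangent_space] subspace_sum[OF subspace_tangent_space]

section \<open>Coordinate vector fields\<close>

definition coord_vec :: "'m set \<Rightarrow> ('m \<Rightarrow> 'a) \<Rightarrow> 'a \<Rightarrow> 'm \<Rightarrow> 'm tvec"
  where "coord_vec U c i q =
    (\<lambda>f. if smooth_at A q f then frechet_derivative (f \<circ> inv_into U c) (at (c q)) i else 0)"

lemma smooth_at_has_derivative: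
  assumes "smooth_at A p f" "(U, c) \<in> A" "p \<in> U"
  shows "((f \<circ> inv_into U c) has_derivative frechet_derivative (f \<circ> inv_into U c) (at (c p))) (at (c p))"
  using smooth_at_chartE[OF assms] smooth_on_has_derivative by (metis centre_in_ball)

lemma coord_vec_eqI:
  fixes f :: "'m \<Rightarrow> real"
  assumes "smooth_at A p f" "((f \<circ> inv_into U c) has_derivative f') (at (c p))"
  shows "coord_vec U c i p f = f' i"
  using assms frechet_derivative_at[OF assms(2)] by (simp add: coord_vec_def)

lemma coord_vec_in_tangent_space:
  assumes c: "(U, c) \<in> A" "p \<in> U"
  shows "coord_vec U c i p \<in> tangent_space A p"
proof (rule tangent_spaceI)
  note d = smooth_at_has_derivative[OF _ c]
  fix f f' :: "'m \<Rightarrow> real" assume f: "smooth_at A p f" "smooth_at A p f'"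
  have eq: "coord_vec U c i p f = frechet_derivative (f \<circ> inv_into U c) (at (c p)) i"
    "coord_vec U c i p f' = frechet_derivative (f' \<circ> inv_into U c) (at (c p)) i"
    using f by (auto simp: coord_vec_def)
  show "coord_vec U c i p (\<lambda>q. f q + f' q) = coord_vec U c i p f + coord_vec U c i p f'"
    unfolding eq by (rule coord_vec_eqI[OF smooth_at_add[OF f]])
      (use has_derivative_add[OF d[OF f(1)] d[OF f(2)]] in \<open>simp add: o_def\<close>)
  show "coord_vec U c i p (\<lambda>q. f q * f' q) = coord_vec U c i p f * f' p + f p * coord_vec U c i p f'"
    unfolding eq
    by (rule coord_vec_eqI[OF smooth_at_mult[OF f]])
      (use has_derivative_mult[OF d[OF f(1)] d[OF f(2)]] inv_chart[OF c] in \<open>simp add: o_def add.commute\<close>)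
  show "coord_vec U c i p (\<lambda>q. r * f q) = r * coord_vec U c i p f" for r
    unfolding eq by (rule coord_vec_eqI[OF smooth_at_mult[OF smooth_at_const f(1)]])
      (use has_derivative_mult_right[OF d[OF f(1)]] in \<open>simp add: o_def\<close>)
qed (simp add: coord_vec_def)

lemma coord_vec_coord:
  assumes c: "(U, c) \<in> A" "p \<in> U" and "i \<in> Basis" "j \<in> Basis"
  shows "coord_vec U c i p (\<lambda>q. c q \<bullet> j) = (if i = j then 1 else 0)"
proof -
  have "((\<lambda>x. x \<bullet> j) has_derivative (\<lambda>v. v \<bullet> j)) (at (c p))"
    by (auto intro!: derivative_eq_intros)
  then have "(((\<lambda>q. c q \<bullet> j) \<circ> inv_into U c) has_derivative (\<lambda>v. v \<bullet> j)) (at (c p))"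
    by (rule has_derivative_transform_within_open[OF _ open_chart_image[OF c(1)]])
      (use c in \<open>auto simp: chart_inv\<close>)
  then show ?thesis
    using coord_vec_eqI[OF smooth_at_coord[OF c]] assms by (simp add: inner_Basis)
qed

lemma smooth_at_coord_vec:
  assumes c: "(U, c) \<in> A" "p \<in> U" and f: "smooth_at A p f"
  shows "smooth_at A p (\<lambda>q. coord_vec U c i q f)"
proof -
  obtain r where r: "r > 0" "ball (c p) r \<subseteq> c ` U" "smooth_on (ball (c p) r) (f \<circ> inv_into U c)"
    using smooth_at_chartE[OF f c] .
  show ?thesis
  proof (rule smooth_at_chartI[OF c open_ball])
    show "smooth_on (ball (c p) r) ((\<lambda>q. coord_vec U c i q f) \<circ> inv_into U c)"
    proof (rule smooth_on_cong[OF open_ball smooth_on_frechet_derivative[OF r(3), of i]])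
      fix x assume x: "x \<in> ball (c p) r"
      then have "x \<in> c ` U" using r by auto
      then have "smooth_at A (inv_into U c x) f"
        by (intro smooth_at_chartI[OF c(1) _ open_ball _ r(3)]) (use x in \<open>auto simp: inv_into_into chart_inv\<close>)
      then show "frechet_derivative (f \<circ> inv_into U c) (at x) i = ((\<lambda>q. coord_vec U c i q f) \<circ> inv_into U c) x"
        using \<open>x \<in> c ` U\<close> by (simp add: coord_vec_def chart_inv)
    qed
  qed (use r in auto)
qed

text \<open>By Hadamard's lemma \<open>f\<close> is, near \<open>p\<close>, a constant plus a sum of
  products of centred coordinates with smooth functions. The centred coordinates vanish at
  \<open>p\<close>, so the Leibniz rule leaves only the values of \<open>v\<close> on coordinates
  times the partial derivatives of \<open>f\<close>.\<close>

lemma tangent_expansion: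
  assumes v: "v \<in> tangent_space A p" and c: "(U, c) \<in> A" "p \<in> U"
  shows "v = (\<Sum>i\<in>Basis. v (\<lambda>q. c q \<bullet> i) *\<^sub>R coord_vec U c i p)"
proof
  fix f
  let ?R = "\<Sum>i\<in>Basis. v (\<lambda>q. c q \<bullet> i) *\<^sub>R coord_vec U c i p"
  have R: "?R \<in> tangent_space A p"
    by (intro tangent_closed coord_vec_in_tangent_space[OF c])
  have R_app: "?R f = (\<Sum>i\<in>Basis. v (\<lambda>q. c q \<bullet> i) * coord_vec U c i p f)"
    by (simp add: sum_fun_apply scaleR_fun_def)
  show "v f = ?R f"
  proof (cases "smooth_at A p f")
    case False
    then show ?thesis using tangent_nonsmooth[OF v] tangent_nonsmooth[OF R] by metis
  next
    case True
    obtain r where r: "r > 0" "ball (c p) r \<subseteq> c ` U" "smooth_on (ball (c p) r) (f \<circ> inv_into U c)"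
      using smooth_at_chartE[OF True c] .
    obtain G where G: "\<And>i. smooth_on (ball (c p) r) (G i)"
      "\<And>x. x \<in> ball (c p) r \<Longrightarrow> (f \<circ> inv_into U c) x =
        (f \<circ> inv_into U c) (c p) + (\<Sum>i\<in>Basis. ((x - c p) \<bullet> i) * G i x)"
      "\<And>i. r > 0 \<Longrightarrow> G i (c p) = frechet_derivative (f \<circ> inv_into U c) (at (c p)) i"
      by (rule Hadamard[OF r(3)]) blast
    let ?G = "\<lambda>i q. G i (c q)" and ?x = "\<lambda>i q. c q \<bullet> i - c p \<bullet> i"
    have sG: "smooth_at A p (?G i)" for i
      by (rule smooth_at_compose[OF smooth_at_chart[OF c] open_ball _ G(1)]) (use r in auto)
    have sx: "smooth_at A p (?x i)" for i
      by (intro smooth_at_diff smooth_at_const smooth_at_coord[OF c])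
    have vx: "v (?x i) = v (\<lambda>q. c q \<bullet> i)" for i
      using tangent_diff[OF v smooth_at_coord[OF c] smooth_at_const] tangent_const[OF v] by simp
    have "\<forall>\<^sub>F q in nhds p. c q \<in> ball (c p) r"
      by (rule eventually_compose_filterlim[OF eventually_nhds_in_open[OF open_ball] tendsto_chart[OF c]])
        (use r in simp)
    with eventually_in_chart[OF c]
    have ev: "\<forall>\<^sub>F q in nhds p. f q = f p + (\<Sum>i\<in>Basis. ?x i q * ?G i q)"
      by eventually_elim
        (use G(2) inv_chart[OF c] inv_chart[OF c(1)] in \<open>fastforce simp: inner_diff_left\<close>)
    have "v f = v (\<lambda>q. f p + (\<Sum>i\<in>Basis. ?x i q * ?G i q))"
      by (rule tangent_cong[OF v ev])
    also have "\<dots> = v (\<lambda>q. f p) + v (\<lambda>q. \<Sum>i\<in>Basis. ?x i q * ?G i q)"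
      by (intro tangent_add[OF v] smooth_at_const smooth_at_sum smooth_at_mult sG sx)
    also have "\<dots> = (\<Sum>i\<in>Basis. v (\<lambda>q. ?x i q * ?G i q))"
      by (subst tangent_sum[OF v]) (auto simp: tangent_const[OF v] intro: smooth_at_mult sG sx)
    also have "\<dots> = (\<Sum>i\<in>Basis. v (\<lambda>q. c q \<bullet> i) * G i (c p))"
      by (intro sum.cong refl) (simp add: tangent_mult[OF v sx sG] vx)
    also have "\<dots> = ?R f"
      unfolding R_app G(3)[OF r(1)] using True by (simp add: coord_vec_def)
    finally show ?thesis .
  qed
qed

end

subsection \<open>Sections along a smooth map\<close>

lemma section_atI:
  assumes "\<forall>\<^sub>F q in nhds p. W q \<in> tangent_space B (\<phi> q)"
    and "\<And>f. smooth_at B (\<phi> p) f \<Longrightarrow> smooth_at A p (\<lambda>q. W q f)"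
  shows "section_at A B \<phi> p W"
  using assms by (simp add: section_at_def)

lemma section_tangent_ev: "section_at A B \<phi> p W \<Longrightarrow> \<forall>\<^sub>F q in nhds p. W q \<in> tangent_space B (\<phi> q)"
  by (simp add: section_at_def)

lemma section_tangent: "section_at A B \<phi> p W \<Longrightarrow> W p \<in> tangent_space B (\<phi> p)"
  using section_tangent_ev eventually_nhds_x_imp_x by fastforce

lemma section_smooth: "section_at A B \<phi> p W \<Longrightarrow> smooth_at B (\<phi> p) f \<Longrightarrow> smooth_at A p (\<lambda>q. W q f)"
  by (simp add: section_at_def)

context manifold
begin

lemma smooth_map_id: "smooth_map A A id"
  unfolding smooth_map_def
proof
  fix p
  obtain U c where c: "(U, c) \<in> A" "p \<in> U" by (rule chart_at)
  show "\<exists>(V, d)\<in>A. id p \<in> V \<and> (\<forall>\<^sub>F q in nhds p. id q \<in> V) \<and> smooth_at A p (d \<circ> id)"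
    using c eventually_in_chart[OF c] smooth_at_chart[OF c] by (intro bexI[OF _ c(1)]) auto
qed

lemma coord_vec_field:
  assumes "(U, c) \<in> A" "p \<in> U" shows "vector_field_at A p (coord_vec U c i)"
proof (rule section_atI)
  show "\<forall>\<^sub>F q in nhds p. coord_vec U c i q \<in> tangent_space A (id q)"
    using eventually_in_chart[OF assms] by eventually_elim (simp add: coord_vec_in_tangent_space assms)
qed (simp add: smooth_at_coord_vec[OF assms])

lemma section_zero: "section_at M A \<phi> p (\<lambda>q. 0) \<longleftrightarrow> smooth_at M p (\<lambda>q. 0 :: real)"
proof -
  have "0 \<in> tangent_space A x" for x by (rule tangent_closed)
  moreover have "smooth_at A x (\<lambda>q. 0 :: real)" for x by (rule smooth_at_const)
  ultimately show ?thesis by (auto simp: section_at_def)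
qed

end

locale smooth_mapping = M: manifold A + N: manifold B
  for A :: "('m::{t2_space, second_countable_topology}, 'a::euclidean_space) atlas"
    and B :: "('n::{t2_space, second_countable_topology}, 'b::euclidean_space) atlas" +
  fixes \<phi> :: "'m \<Rightarrow> 'n"
  assumes smooth_map: "smooth_map A B \<phi>"
begin

lemma smooth_at_in_chart:
  obtains V d where "(V, d) \<in> B" "\<phi> p \<in> V" "\<forall>\<^sub>F q in nhds p. \<phi> q \<in> V" "smooth_at A p (d \<circ> \<phi>)"
proof -
  have "\<exists>(V, d)\<in>B. \<phi> p \<in> V \<and> (\<forall>\<^sub>F q in nhds p. \<phi> q \<in> V) \<and> smooth_at A p (d \<circ> \<phi>)"
    using smooth_map by (simp add: smooth_map_def)
  then show ?thesis using that by auto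
qed

lemma tendsto_map: "filterlim \<phi> (nhds (\<phi> p)) (nhds p)"
proof -
  obtain V d where d: "(V, d) \<in> B" "\<phi> p \<in> V" "\<forall>\<^sub>F q in nhds p. \<phi> q \<in> V" "smooth_at A p (d \<circ> \<phi>)"
    by (rule smooth_at_in_chart)
  have *: "filterlim (d \<circ> \<phi>) (nhds (d (\<phi> p))) (nhds p)"
    using M.smooth_at_tendsto[OF d(4)] by simp
  have "filterlim (\<lambda>q. inv_into V d ((d \<circ> \<phi>) q)) (nhds (\<phi> p)) (nhds p)"
    by (rule filterlim_compose[OF N.tendsto_inv_chart[OF d(1,2)] *])
  then show ?thesis
    by (rule filterlim_cong[THEN iffD1, rotated 3])
      (auto intro!: eventually_mono[OF d(3)] simp: N.inv_chart[OF d(1)])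
qed

lemma eventually_map: "eventually P (nhds (\<phi> p)) \<Longrightarrow> \<forall>\<^sub>F q in nhds p. P (\<phi> q)"
  by (rule eventually_compose_filterlim[OF _ tendsto_map])

lemma smooth_at_map:
  assumes "smooth_at B (\<phi> p) f" shows "smooth_at A p (\<lambda>q. f (\<phi> q))"
proof -
  obtain V d where d: "(V, d) \<in> B" "\<phi> p \<in> V" "\<forall>\<^sub>F q in nhds p. \<phi> q \<in> V" "smooth_at A p (d \<circ> \<phi>)"
    by (rule smooth_at_in_chart)
  obtain r where r: "r > 0" "smooth_on (ball (d (\<phi> p)) r) (f \<circ> inv_into V d)"
    using N.smooth_at_chartE[OF assms d(1,2)] .
  have "smooth_at A p (\<lambda>q. (f \<circ> inv_into V d) ((d \<circ> \<phi>) q))"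
    by (rule M.smooth_at_compose[OF d(4) open_ball _ r(2)]) (use r in simp)
  then show ?thesis
    by (rule M.smooth_at_cong) (use d(3) in eventually_elim, simp add: N.inv_chart[OF d(1)])
qed

lemma pushforward_apply: "smooth_at B (\<phi> p) f \<Longrightarrow> pushforward B \<phi> p v f = v (\<lambda>q. f (\<phi> q))"
  by (simp add: pushforward_def o_def)

lemma pushforward_tangent:
  assumes v: "v \<in> tangent_space A p" shows "pushforward B \<phi> p v \<in> tangent_space B (\<phi> p)"
proof (rule N.tangent_spaceI)
  fix f f' :: "'n \<Rightarrow> real" assume f: "smooth_at B (\<phi> p) f" "smooth_at B (\<phi> p) f'"
  note s = smooth_at_map[OF f(1)] smooth_at_map[OF f(2)]
  show "pushforward B \<phi> p v (\<lambda>q. f q + f' q) = pushforward B \<phi> p v f + pushforward B \<phi> p v f'"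
    using M.tangent_add[OF v s] by (simp add: pushforward_apply f N.smooth_at_add)
  show "pushforward B \<phi> p v (\<lambda>q. f q * f' q) =
      pushforward B \<phi> p v f * f' (\<phi> p) + f (\<phi> p) * pushforward B \<phi> p v f'"
    using M.tangent_mult[OF v s] by (simp add: pushforward_apply f N.smooth_at_mult)
  show "pushforward B \<phi> p v (\<lambda>q. r * f q) = r * pushforward B \<phi> p v f" for r
    using M.tangent_scale[OF v s(1)]
    by (simp add: pushforward_apply f N.smooth_at_mult N.smooth_at_const)
qed (simp add: pushforward_def)

lemma pushforward_add: "pushforward B \<phi> p (u + v) = pushforward B \<phi> p u + pushforward B \<phi> p v"
  by (auto simp: pushforward_def fun_eq_iff)

lemma pushforward_scaleR: "pushforward B \<phi> p (r *\<^sub>R v) = r *\<^sub>R pushforward B \<phi> p v"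
  by (auto simp: pushforward_def fun_eq_iff scaleR_fun_def)

abbreviation sect :: "'m \<Rightarrow> ('m \<Rightarrow> 'n tvec) \<Rightarrow> bool"
  where "sect \<equiv> section_at A B \<phi>"

lemma section_0: "sect p (\<lambda>q. 0)"
  by (simp add: N.section_zero M.smooth_at_const)

lemma section_add:
  assumes "sect p W" "sect p W'" shows "sect p (\<lambda>q. W q + W' q)"
proof (rule section_atI)
  show "\<forall>\<^sub>F q in nhds p. W q + W' q \<in> tangent_space B (\<phi> q)"
    using section_tangent_ev[OF assms(1)] section_tangent_ev[OF assms(2)]
    by eventually_elim (rule N.tangent_closed)
  show "smooth_at A p (\<lambda>q. (W q + W' q) k)" if "smooth_at B (\<phi> p) k" for k
    using M.smooth_at_add[OF section_smooth[OF assms(1) that] section_smooth[OF assms(2) that]] by simp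
qed

lemma section_scaleR:
  assumes "smooth_at A p f" "sect p W" shows "sect p (\<lambda>q. f q *\<^sub>R W q)"
proof (rule section_atI)
  show "\<forall>\<^sub>F q in nhds p. f q *\<^sub>R W q \<in> tangent_space B (\<phi> q)"
    using section_tangent_ev[OF assms(2)] by eventually_elim (rule N.tangent_closed)
  show "smooth_at A p (\<lambda>q. (f q *\<^sub>R W q) k)" if "smooth_at B (\<phi> p) k" for k
    using M.smooth_at_mult[OF assms(1) section_smooth[OF assms(2) that]] by (simp add: scaleR_fun_def)
qed

lemma section_minus: "sect p W \<Longrightarrow> sect p (\<lambda>q. - W q)"
  using section_scaleR[of p "\<lambda>q. - 1" W] by (simp add: M.smooth_at_const)

lemma section_diff: "sect p W \<Longrightarrow> sect p W' \<Longrightarrow> sect p (\<lambda>q. W q - W' q)"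
  using section_add[of p W "\<lambda>q. - W' q"] section_minus by simp

lemma section_sum: "(\<And>i. i \<in> I \<Longrightarrow> sect p (W i)) \<Longrightarrow> sect p (\<lambda>q. \<Sum>i\<in>I. W i q)"
  by (induction I rule: infinite_finite_induct) (auto intro: section_0 section_add)

lemma section_cong:
  assumes "sect p W" "\<forall>\<^sub>F q in nhds p. W q = W' q" shows "sect p W'"
proof (rule section_atI)
  show "\<forall>\<^sub>F q in nhds p. W' q \<in> tangent_space B (\<phi> q)"
    using section_tangent_ev[OF assms(1)] assms(2) by eventually_elim simp
  show "smooth_at A p (\<lambda>q. W' q f)" if "smooth_at B (\<phi> p) f" for f
    by (rule M.smooth_at_cong[OF section_smooth[OF assms(1) that]]) (use assms(2) in eventually_elim, simp)
qed

lemma section_of_field: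
  assumes "vector_field_at B (\<phi> p) Y" shows "sect p (\<lambda>q. Y (\<phi> q))"
proof (rule section_atI)
  show "\<forall>\<^sub>F q in nhds p. Y (\<phi> q) \<in> tangent_space B (\<phi> q)"
    using eventually_map[OF section_tangent_ev[OF assms]] by simp
  show "smooth_at A p (\<lambda>q. Y (\<phi> q) f)" if "smooth_at B (\<phi> p) f" for f
    by (rule smooth_at_map[of p "\<lambda>x. Y x f"]) (use section_smooth[OF assms] that in simp)
qed

lemma section_pushforward:
  assumes "vector_field_at A p E" shows "sect p (\<lambda>q. pushforward B \<phi> q (E q))"
proof (rule section_atI)
  show "\<forall>\<^sub>F q in nhds p. pushforward B \<phi> q (E q) \<in> tangent_space B (\<phi> q)"
    using section_tangent_ev[OF assms] by eventually_elim (simp add: pushforward_tangent)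
  fix f :: "'n \<Rightarrow> real" assume f: "smooth_at B (\<phi> p) f"
  have "smooth_at A p (\<lambda>q. E q (\<lambda>q. f (\<phi> q)))"
    by (rule section_smooth[OF assms]) (simp add: smooth_at_map f)
  then show "smooth_at A p (\<lambda>q. pushforward B \<phi> q (E q) f)"
    by (rule M.smooth_at_cong)
      (use eventually_map[OF N.eventually_smooth_at[OF f]] in eventually_elim, simp add: pushforward_apply)
qed

lemma section_expansion:
  assumes d: "(V, d) \<in> B" "\<phi> p \<in> V" and W: "sect p W"
  shows "\<forall>\<^sub>F q in nhds p. W q = (\<Sum>i\<in>Basis. W q (\<lambda>y. d y \<bullet> i) *\<^sub>R N.coord_vec V d i (\<phi> q))"
  using section_tangent_ev[OF W] eventually_map[OF N.eventually_in_chart[OF d]]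
  by eventually_elim (rule N.tangent_expansion[OF _ d(1)])

text \<open>Reduces sections along the map to fields on the target with smooth coefficients on the
  source. The last clause is the one that yields dependence on the value at a single point.\<close>

lemma section_frame:
  assumes "sect p W"
  obtains w and F :: "'b \<Rightarrow> 'n \<Rightarrow> 'n tvec" where "\<forall>i. smooth_at A p (w i)" "\<forall>i. vector_field_at B (\<phi> p) (F i)"
    "\<forall>\<^sub>F q in nhds p. W q = (\<Sum>i\<in>Basis. w i q *\<^sub>R F i (\<phi> q))"
    "W p = 0 \<longrightarrow> (\<forall>i. w i p = 0)"
proof -
  obtain V d where d: "(V, d) \<in> B" "\<phi> p \<in> V" by (rule N.chart_at)
  show ?thesis
  proof (rule that[of "\<lambda>i q. W q (\<lambda>y. d y \<bullet> i)" "N.coord_vec V d"])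
    show "\<forall>i. smooth_at A p (\<lambda>q. W q (\<lambda>y. d y \<bullet> i))"
      using section_smooth[OF assms N.smooth_at_coord[OF d]] by blast
    show "\<forall>i. vector_field_at B (\<phi> p) (N.coord_vec V d i)" using N.coord_vec_field[OF d] by blast
    show "\<forall>\<^sub>F q in nhds p. W q = (\<Sum>i\<in>Basis. W q (\<lambda>y. d y \<bullet> i) *\<^sub>R N.coord_vec V d i (\<phi> q))"
      by (rule section_expansion[OF d assms])
  qed simp
qed

text \<open>Not immediate from \<open>section_at\<close>: at a nearby \<open>q\<close> it tests with
  functions smooth at \<open>\<phi> q\<close>, which need not be smooth at \<open>\<phi> p\<close>.
  The coordinate expansion gets by with finitely many coefficient functions, each smooth near
  \<open>p\<close>.\<close>

lemma eventually_section:
  assumes "sect p W" shows "\<forall>\<^sub>F q in nhds p. sect q W"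
proof -
  obtain V d where d: "(V, d) \<in> B" "\<phi> p \<in> V" by (rule N.chart_at)
  let ?w = "\<lambda>i q. W q (\<lambda>y. d y \<bullet> i)"
  have "\<forall>\<^sub>F q in nhds p. \<forall>i\<in>Basis. smooth_at A q (?w i)"
    by (intro eventually_ball_finite finite_Basis ballI M.eventually_smooth_at
        section_smooth[OF assms N.smooth_at_coord[OF d]])
  moreover have "\<forall>\<^sub>F q in nhds p. \<forall>\<^sub>F q' in nhds q.
      W q' = (\<Sum>i\<in>Basis. ?w i q' *\<^sub>R N.coord_vec V d i (\<phi> q'))"
    using section_expansion[OF d assms] by (simp add: eventually_eventually)
  moreover have "\<forall>\<^sub>F q in nhds p. \<phi> q \<in> V"
    by (rule eventually_map[OF N.eventually_in_chart[OF d]])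
  ultimately show ?thesis
  proof eventually_elim
    case (elim q)
    have "sect q (\<lambda>q'. \<Sum>i\<in>Basis. ?w i q' *\<^sub>R N.coord_vec V d i (\<phi> q'))"
      using elim by (intro section_sum section_scaleR section_of_field N.coord_vec_field[OF d(1)]) auto
    then show ?case
      by (rule section_cong) (use elim(2) in eventually_elim, simp)
  qed
qed


subsection \<open>Tensoriality\<close>

text \<open>Linearity over smooth functions for maps whose value belongs to the point
  \<open>p\<close>. The codomain is any real vector space, so that scalar defects and
  tangent-vector-valued expressions are treated alike.\<close>

definition tensorial_at :: "'m \<Rightarrow> (('m \<Rightarrow> 'n tvec) \<Rightarrow> 'r::real_vector) \<Rightarrow> bool"
  where "tensorial_at p F \<longleftrightarrow>
    (\<forall>W W'. sect p W \<longrightarrow> sect p W' \<longrightarrow> F (\<lambda>q. W q + W' q) = F W + F W') \<and>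
    (\<forall>W f. sect p W \<longrightarrow> smooth_at A p f \<longrightarrow> F (\<lambda>q. f q *\<^sub>R W q) = f p *\<^sub>R F W)"

lemma tensorial_vanish:
  assumes F: "tensorial_at p F" and W: "sect p W" and ev: "\<forall>\<^sub>F q in nhds p. W q = 0"
  shows "F W = 0"
proof -
  obtain S where S: "open S" "p \<in> S" "\<forall>q\<in>S. W q = 0"
    using iffD1[OF eventually_nhds ev] by auto
  have "W = (\<lambda>q. (if q \<in> S then 0 else 1 :: real) *\<^sub>R W q)" using S(3) by (intro ext) simp
  moreover have "F (\<lambda>q. (if q \<in> S then 0 else 1 :: real) *\<^sub>R W q) = (if p \<in> S then 0 else 1) *\<^sub>R F W"
    using F W M.smooth_at_indicator[OF S(1,2)] unfolding tensorial_at_def by blast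
  ultimately show ?thesis using S(2) by simp
qed

lemma tensorial_add:
  "tensorial_at p F \<Longrightarrow> sect p W \<Longrightarrow> sect p W' \<Longrightarrow> F (\<lambda>q. W q + W' q) = F W + F W'"
  by (simp add: tensorial_at_def)

lemma tensorial_scaleR:
  "tensorial_at p F \<Longrightarrow> sect p W \<Longrightarrow> smooth_at A p f \<Longrightarrow> F (\<lambda>q. f q *\<^sub>R W q) = f p *\<^sub>R F W"
  by (simp add: tensorial_at_def)

lemma tensorial_sum:
  assumes F: "tensorial_at p F" and "\<And>i. i \<in> I \<Longrightarrow> sect p (W i)"
  shows "F (\<lambda>q. \<Sum>i\<in>I. W i q) = (\<Sum>i\<in>I. F (W i))"
  using assms(2)
  by (induction I rule: infinite_finite_induct)
    (auto simp: tensorial_vanish[OF F section_0] tensorial_add[OF F] section_sum)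

lemma tensorial_add_diff:
  assumes F: "tensorial_at p F" and W: "sect p W" "sect p W'"
  shows "F W = F W' + F (\<lambda>q. W q - W' q)"
  using tensorial_add[OF F W(2) section_diff[OF W]] by simp

lemma tensorial_cong:
  assumes F: "tensorial_at p F" and W: "sect p W" "sect p W'" and ev: "\<forall>\<^sub>F q in nhds p. W q = W' q"
  shows "F W = F W'"
  using tensorial_add_diff[OF F W] tensorial_vanish[OF F section_diff[OF W]] ev by simp

text \<open>The difference of the two sections has, in a local frame, coefficients that vanish at
  \<open>p\<close>, and these can be pulled out of \<open>F\<close>.\<close>

lemma tensorial_point:
  assumes F: "tensorial_at p F" and W: "sect p W" "sect p W'" and eq: "W p = W' p"
  shows "F W = F W'"
proof -
  let ?Z = "\<lambda>q. W q - W' q"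
  have Z: "sect p ?Z" by (rule section_diff[OF W])
  obtain z and E :: "'b \<Rightarrow> 'n \<Rightarrow> 'n tvec" where z: "\<forall>i. smooth_at A p (z i)" "\<forall>i. vector_field_at B (\<phi> p) (E i)"
    "\<forall>\<^sub>F q in nhds p. ?Z q = (\<Sum>i\<in>Basis. z i q *\<^sub>R E i (\<phi> q))" "?Z p = 0 \<longrightarrow> (\<forall>i. z i p = 0)"
    using section_frame[OF Z] .
  note s = section_of_field[OF spec[OF z(2)]]
  note s' = section_scaleR[OF spec[OF z(1)] s]
  have "F ?Z = F (\<lambda>q. \<Sum>i\<in>Basis. z i q *\<^sub>R E i (\<phi> q))"
    by (rule tensorial_cong[OF F Z section_sum[OF s'] z(3)])
  also have "\<dots> = (\<Sum>i\<in>Basis. z i p *\<^sub>R F (\<lambda>q. E i (\<phi> q)))"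
    by (subst tensorial_sum[OF F s']) (auto simp: tensorial_scaleR[OF F s spec[OF z(1)]])
  also have "\<dots> = 0" using z(4) eq by simp
  finally show ?thesis using tensorial_add_diff[OF F W] by simp
qed

end

sublocale manifold \<subseteq> id: smooth_mapping A A id
  by unfold_locales (rule smooth_map_id)


subsection \<open>Connections\<close>

locale connection = smooth_mapping A B \<phi>
  for A :: "('m::{t2_space, second_countable_topology}, 'a::euclidean_space) atlas"
    and B :: "('n::{t2_space, second_countable_topology}, 'b::euclidean_space) atlas"
    and \<phi> :: "'m \<Rightarrow> 'n" +
  fixes D :: "('m, 'n) conn"
  assumes connection: "connection_along A B \<phi> D"
begin

lemma conn_tangent: "sect p W \<Longrightarrow> v \<in> tangent_space A p \<Longrightarrow> D p v W \<in> tangent_space B (\<phi> p)"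
  using connection unfolding connection_along_def by blast

lemma conn_linear:
  "sect p W \<Longrightarrow> u \<in> tangent_space A p \<Longrightarrow> v \<in> tangent_space A p \<Longrightarrow>
    D p (r *\<^sub>R u + t *\<^sub>R v) W = r *\<^sub>R D p u W + t *\<^sub>R D p v W"
  using connection unfolding connection_along_def by blast

lemma conn_add:
  "sect p W \<Longrightarrow> sect p W' \<Longrightarrow> v \<in> tangent_space A p \<Longrightarrow>
    D p v (\<lambda>q. W q + W' q) = D p v W + D p v W'"
  using connection unfolding connection_along_def by blast

lemma conn_leibniz:
  "sect p W \<Longrightarrow> smooth_at A p f \<Longrightarrow> v \<in> tangent_space A p \<Longrightarrow>
    D p v (\<lambda>q. f q *\<^sub>R W q) = v f *\<^sub>R W p + f p *\<^sub>R D p v W"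
  using connection unfolding connection_along_def by blast

lemma conn_section: "sect p W \<Longrightarrow> vector_field_at A p V \<Longrightarrow> sect p (\<lambda>q. D q (V q) W)"
  using connection unfolding connection_along_def by blast

lemma conn_dir_add:
  "sect p W \<Longrightarrow> u \<in> tangent_space A p \<Longrightarrow> v \<in> tangent_space A p \<Longrightarrow> D p (u + v) W = D p u W + D p v W"
  using conn_linear[of p W u v 1 1] by simp

lemma conn_dir_scaleR:
  "sect p W \<Longrightarrow> v \<in> tangent_space A p \<Longrightarrow> D p (r *\<^sub>R v) W = r *\<^sub>R D p v W"
  using conn_linear[of p W v v r 0] by simp

lemma conn_dir_0: "sect p W \<Longrightarrow> D p 0 W = 0"
  using conn_dir_scaleR[of p W 0 0] M.tangent_closed(1) by simp

lemma conn_dir_diff: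
  "sect p W \<Longrightarrow> u \<in> tangent_space A p \<Longrightarrow> v \<in> tangent_space A p \<Longrightarrow> D p (u - v) W = D p u W - D p v W"
  using conn_linear[of p W u v 1 "-1"] by simp

lemma conn_dir_sum:
  assumes W: "sect p W" and "\<And>i. i \<in> I \<Longrightarrow> v i \<in> tangent_space A p"
  shows "D p (\<Sum>i\<in>I. v i) W = (\<Sum>i\<in>I. D p (v i) W)"
  using assms(2)
  by (induction I rule: infinite_finite_induct)
    (auto simp: conn_dir_0[OF W] conn_dir_add[OF W] M.tangent_closed)

lemma conn_vanish:
  assumes W: "sect p W" and v: "v \<in> tangent_space A p" and ev: "\<forall>\<^sub>F q in nhds p. W q = 0"
  shows "D p v W = 0"
proof -
  obtain S where S: "open S" "p \<in> S" "\<forall>q\<in>S. W q = 0"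
    using iffD1[OF eventually_nhds ev] by auto
  have eq: "W = (\<lambda>q. (if q \<in> S then 0 else 1 :: real) *\<^sub>R W q)" using S(3) by (intro ext) simp
  have "D p v W = D p v (\<lambda>q. (if q \<in> S then 0 else 1 :: real) *\<^sub>R W q)" using eq by simp
  also have "\<dots> = 0"
    by (subst conn_leibniz[OF W M.smooth_at_indicator[OF S(1,2)] v]) (use S in simp)
  finally show ?thesis .
qed

lemma conn_const_scaleR:
  assumes "sect p W" "v \<in> tangent_space A p" shows "D p v (\<lambda>q. r *\<^sub>R W q) = r *\<^sub>R D p v W"
  using conn_leibniz[OF assms(1) M.smooth_at_const assms(2), of r] M.tangent_const[OF assms(2)] by simp

lemma conn_minus:
  assumes "sect p W" "v \<in> tangent_space A p" shows "D p v (\<lambda>q. - W q) = - D p v W"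
  using conn_const_scaleR[OF assms, of "-1"] by simp

lemma conn_diff:
  assumes "sect p W" "sect p W'" "v \<in> tangent_space A p"
  shows "D p v (\<lambda>q. W q - W' q) = D p v W - D p v W'"
  using conn_add[OF assms(1) section_minus[OF assms(2)] assms(3)] conn_minus[OF assms(2,3)] by simp

lemma conn_cong:
  assumes "sect p W" "v \<in> tangent_space A p" and ev: "\<forall>\<^sub>F q in nhds p. W q = W' q"
  shows "D p v W = D p v W'"
proof -
  have W': "sect p W'" by (rule section_cong[OF assms(1) ev])
  have "D p v (\<lambda>q. W q - W' q) = 0"
    by (rule conn_vanish[OF section_diff[OF assms(1) W'] assms(2)]) (use ev in simp)
  then show ?thesis using conn_diff[OF assms(1) W' assms(2)] by simp
qed

end


subsection \<open>Extension of tangent vectors\<close>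

context manifold
begin

lemma exists_local_field:
  assumes "v \<in> tangent_space A p"
  obtains Y where "vector_field_at A p Y" "Y p = v"
proof -
  obtain U c where c: "(U, c) \<in> A" "p \<in> U" by (rule chart_at)
  have "vector_field_at A p (\<lambda>q. \<Sum>i\<in>Basis. v (\<lambda>q. c q \<bullet> i) *\<^sub>R coord_vec U c i q)"
    by (intro id.section_sum id.section_scaleR smooth_at_const coord_vec_field[OF c])
  then show ?thesis by (rule that) (rule tangent_expansion[OF assms c, symmetric])
qed

text \<open>A bump function times a coordinate field with constant coefficients. It serves to
  recover pointwise skewness from the Killing condition, which speaks of global fields.\<close>

lemma exists_global_field:
  assumes v: "v \<in> tangent_space A p"
  obtains Y where "vector_field A Y" "Y p = v"
proof -
  obtain U c where c: "(U, c) \<in> A" "p \<in> U" by (rule chart_at)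
  have "c p \<in> c ` U" using c by simp
  then obtain r where r: "r > 0" "cball (c p) r \<subseteq> c ` U"
    using open_contains_cball_eq[OF open_chart_image[OF c(1)]] by blast
  obtain b where b: "smooth_on UNIV b" "b (c p) = (1::real)" "\<And>x. x \<notin> ball (c p) r \<Longrightarrow> b x = 0"
    using exists_smooth_bump[OF r(1)] by metis
  let ?K = "inv_into U c ` cball (c p) r"
  let ?Z = "\<lambda>q. \<Sum>i\<in>Basis. v (\<lambda>q. c q \<bullet> i) *\<^sub>R coord_vec U c i q"
  let ?Y = "\<lambda>q. if q \<in> U then b (c q) *\<^sub>R ?Z q else 0"
  \<comment> \<open>Being compact in a Hausdorff space, \<open>?K\<close> is closed in the whole
    manifold and not only in \<open>U\<close>; so a point outside \<open>U\<close> has a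
    neighbourhood on which \<open>?Y\<close> vanishes.\<close>
  have "compact ?K"
    by (rule compact_continuous_image[OF continuous_on_subset[OF homeomorphism_cont2[OF homeomorphism_chart[OF c(1)]] r(2)]
          compact_cball])
  then have "closed ?K" by (rule compact_imp_closed)
  have "vector_field_at A q ?Y" for q
  proof (cases "q \<in> U")
    case True
    note c' = c(1) True
    have "smooth_at A q (\<lambda>q. b (c q))"
      by (rule smooth_at_compose[OF smooth_at_chart[OF c'] open_UNIV _ b(1)]) simp
    then have "vector_field_at A q (\<lambda>q. b (c q) *\<^sub>R ?Z q)"
      by (intro id.section_sum id.section_scaleR smooth_at_const coord_vec_field[OF c'])
    then show ?thesis
      by (rule id.section_cong) (use eventually_in_chart[OF c'] in eventually_elim, simp)
  next
    case False
    have "inv_into U c x \<in> U" if "x \<in> cball (c p) r" for x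
      using that r(2) by (intro inv_into_into) auto
    then have "q \<notin> ?K" using False by auto
    then have ev: "\<forall>\<^sub>F q' in nhds q. q' \<in> - ?K"
      using \<open>closed ?K\<close> by (intro eventually_nhds_in_open) auto
    have *: "0 = ?Y q'" if "q' \<in> - ?K" for q'
    proof (cases "q' \<in> U")
      case True
      have "c q' \<notin> ball (c p) r"
      proof
        assume "c q' \<in> ball (c p) r"
        then have "inv_into U c (c q') \<in> ?K" by (intro imageI) auto
        then show False using that inv_chart[OF c(1) True] by simp
      qed
      then show ?thesis using b(3) by simp
    qed simp
    show ?thesis by (rule id.section_cong[OF id.section_0 eventually_mono[OF ev *]])
  qed
  moreover have "?Y p = v" using c b(2) tangent_expansion[OF v c] by simp
  ultimately show ?thesis using that unfolding vector_field_def by blast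
qed

end

subsection \<open>Riemannian metrics and orthonormal frames\<close>

locale metric_manifold = manifold A
  for A :: "('m::{t2_space, second_countable_topology}, 'a::euclidean_space) atlas" +
  fixes g :: "'m \<Rightarrow> 'm tvec \<Rightarrow> 'm tvec \<Rightarrow> real"
  assumes metric: "riemannian_metric A g"
begin

abbreviation TS :: "'m \<Rightarrow> 'm tvec set"
  where "TS \<equiv> tangent_space A"

abbreviation vfield :: "'m \<Rightarrow> ('m \<Rightarrow> 'm tvec) \<Rightarrow> bool"
  where "vfield \<equiv> vector_field_at A"

lemma vfield_tangent: "vfield p X \<Longrightarrow> X p \<in> TS p"
  using section_tangent[of A A id p X] by simp

lemma vfield_tangent_ev: "vfield p X \<Longrightarrow> \<forall>\<^sub>F q in nhds p. X q \<in> TS q"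
  using section_tangent_ev[of A A id p X] by simp

lemma vfield_smooth: "vfield p X \<Longrightarrow> smooth_at A p f \<Longrightarrow> smooth_at A p (\<lambda>q. X q f)"
  using section_smooth[of A A id p X f] by simp

lemma metric_at:
  assumes "u \<in> TS p" "v \<in> TS p"
  shows "g p u v = g p v u \<and> (u \<noteq> 0 \<longrightarrow> g p u u > 0) \<and>
    (\<forall>w\<in>TS p. \<forall>r t. g p (r *\<^sub>R u + t *\<^sub>R v) w = r * g p u w + t * g p v w)"
proof -
  have "\<forall>p. \<forall>u\<in>TS p. \<forall>v\<in>TS p. g p u v = g p v u \<and> (u \<noteq> 0 \<longrightarrow> g p u u > 0) \<and>
    (\<forall>w\<in>TS p. \<forall>r t. g p (r *\<^sub>R u + t *\<^sub>R v) w = r * g p u w + t * g p v w)"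
    using metric by (simp add: riemannian_metric_def)
  then show ?thesis using assms by simp
qed

lemma metric_sym: "u \<in> TS p \<Longrightarrow> v \<in> TS p \<Longrightarrow> g p u v = g p v u"
  using metric_at by blast

lemma metric_pos: "u \<in> TS p \<Longrightarrow> u \<noteq> 0 \<Longrightarrow> g p u u > 0"
  using metric_at by blast

lemma metric_linear:
  "u \<in> TS p \<Longrightarrow> v \<in> TS p \<Longrightarrow> w \<in> TS p \<Longrightarrow> g p (r *\<^sub>R u + t *\<^sub>R v) w = r * g p u w + t * g p v w"
  using metric_at by blast

lemma metric_smooth: "vfield p X \<Longrightarrow> vfield p Y \<Longrightarrow> smooth_at A p (\<lambda>q. g q (X q) (Y q))"
  using metric by (simp add: riemannian_metric_def)

lemma metric_add: "u \<in> TS p \<Longrightarrow> v \<in> TS p \<Longrightarrow> w \<in> TS p \<Longrightarrow> g p (u + v) w = g p u w + g p v w"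
  using metric_linear[of u p v w 1 1] by simp

lemma metric_scaleR: "u \<in> TS p \<Longrightarrow> w \<in> TS p \<Longrightarrow> g p (r *\<^sub>R u) w = r * g p u w"
  using metric_linear[of u p u w r 0] by simp

lemma metric_diff: "u \<in> TS p \<Longrightarrow> v \<in> TS p \<Longrightarrow> w \<in> TS p \<Longrightarrow> g p (u - v) w = g p u w - g p v w"
  using metric_linear[of u p v w 1 "-1"] by simp

lemma metric_minus: "u \<in> TS p \<Longrightarrow> w \<in> TS p \<Longrightarrow> g p (- u) w = - g p u w"
  using metric_scaleR[of u p w "-1"] by simp

lemma metric_0: "w \<in> TS p \<Longrightarrow> g p 0 w = 0"
  using metric_scaleR[of w p w 0] by simp

lemma metric_sum:
  assumes w: "w \<in> TS p" and "\<And>i. i \<in> I \<Longrightarrow> v i \<in> TS p"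
  shows "g p (\<Sum>i\<in>I. v i) w = (\<Sum>i\<in>I. g p (v i) w)"
  using assms(2)
  by (induction I rule: infinite_finite_induct)
    (auto simp: metric_0[OF w] metric_add[OF _ _ w] tangent_closed)

lemma metric_diff_right: "u \<in> TS p \<Longrightarrow> v \<in> TS p \<Longrightarrow> w \<in> TS p \<Longrightarrow> g p w (u - v) = g p w u - g p w v"
  using metric_diff[of u p v w] by (simp add: metric_sym tangent_closed)

lemma metric_nondegenerate:
  assumes "u \<in> TS p" "v \<in> TS p" "\<And>w. w \<in> TS p \<Longrightarrow> g p u w = g p v w"
  shows "u = v"
proof (rule ccontr)
  have d: "u - v \<in> TS p" using assms(1,2) by (rule tangent_closed)
  assume "u \<noteq> v"
  then show False
    using metric_pos[OF d] metric_diff[OF assms(1,2) d] assms(3)[OF d] by simp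
qed

section \<open>Orthonormal systems\<close>

lemma independent_orthogonal:
  assumes "finite S" "S \<subseteq> TS p" and ne: "0 \<notin> S"
    and orth: "\<And>u v. u \<in> S \<Longrightarrow> v \<in> S \<Longrightarrow> u \<noteq> v \<Longrightarrow> g p u v = 0"
  shows "independent S"
proof
  assume "dependent S"
  then obtain a v where v: "v \<in> S" "a v \<noteq> 0" "(\<Sum>u\<in>S. a u *\<^sub>R u) = 0"
    using dependent_finite[OF assms(1)] by auto
  have T: "u \<in> TS p" if "u \<in> S" for u using assms(2) that by auto
  have "0 = g p (\<Sum>u\<in>S. a u *\<^sub>R u) v" using v T metric_0 by simp
  also have "\<dots> = (\<Sum>u\<in>S. a u * g p u v)"
    by (subst metric_sum) (auto simp: metric_scaleR T v tangent_closed)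
  also have "\<dots> = (\<Sum>u\<in>S. if u = v then a v * g p v v else 0)"
    using orth v(1) by (intro sum.cong) auto
  also have "\<dots> = a v * g p v v" using assms(1) v(1) by simp
  finally show False using v metric_pos[OF T[OF v(1)]] ne by auto
qed

text \<open>A nonzero remainder would be orthogonal to all \<open>e i\<close> and thus give one more
  independent vector than the dimension, while the tangent space is spanned by the coordinate
  vectors.\<close>

lemma orthonormal_expansion:
  assumes e: "\<And>i. i \<in> Basis \<Longrightarrow> e i \<in> TS p"
    and on: "\<And>i j. i \<in> (Basis :: 'a set) \<Longrightarrow> j \<in> Basis \<Longrightarrow> g p (e i) (e j) = (if i = j then 1 else 0)"
    and v: "v \<in> TS p"
  shows "v = (\<Sum>i\<in>Basis. g p v (e i) *\<^sub>R e i)"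
proof (rule ccontr)
  let ?w = "v - (\<Sum>i\<in>Basis. g p v (e i) *\<^sub>R e i)"
  assume "v \<noteq> (\<Sum>i\<in>Basis. g p v (e i) *\<^sub>R e i)"
  then have ne: "?w \<noteq> 0" by simp
  have s: "(\<Sum>i\<in>Basis. g p v (e i) *\<^sub>R e i) \<in> TS p" by (intro tangent_closed e)
  have w: "?w \<in> TS p" by (intro tangent_closed v s)
  have orth: "g p ?w (e j) = 0" if j: "j \<in> Basis" for j
  proof -
    have "g p (\<Sum>i\<in>Basis. g p v (e i) *\<^sub>R e i) (e j) = (\<Sum>i\<in>Basis. g p v (e i) * g p (e i) (e j))"
      by (subst metric_sum) (auto simp: metric_scaleR e j tangent_closed)
    also have "\<dots> = (\<Sum>i\<in>Basis. if i = j then g p v (e j) else 0)"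
      by (intro sum.cong) (auto simp: on j)
    also have "\<dots> = g p v (e j)" using j by simp
    finally show ?thesis using metric_diff[OF v s e[OF j]] by simp
  qed
  have inj: "inj_on e Basis"
  proof (rule inj_onI)
    fix i j :: 'a assume "i \<in> Basis" "j \<in> Basis" "e i = e j"
    then show "i = j" using on[of i i] on[of i j] by (auto split: if_splits)
  qed
  have e0: "e i \<noteq> 0" if "i \<in> Basis" for i
    using on[OF that that] metric_0[OF e[OF that]] by auto
  have w_notin: "?w \<notin> e ` Basis"
  proof
    assume "?w \<in> e ` Basis"
    then obtain j where "j \<in> Basis" "?w = e j" by auto
    then show False using orth[of j] on[of j j] by simp
  qed
  have ind: "independent (insert ?w (e ` Basis))"
  proof (rule independent_orthogonal)
    show "g p x y = 0" if xy: "x \<in> insert ?w (e ` Basis)" "y \<in> insert ?w (e ` Basis)" "x \<noteq> y" for x y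
    proof -
      have sym: "g p (e j) ?w = 0" if "j \<in> Basis" for j
        using orth[OF that] metric_sym[OF e[OF that] w] by simp
      consider "x = ?w" "y \<in> e ` Basis" | "x \<in> e ` Basis" "y = ?w" | "x \<in> e ` Basis" "y \<in> e ` Basis"
        using xy by blast
      then show ?thesis
        using orth sym on xy(3) by cases (auto split: if_splits)
    qed
  qed (use w e e0 ne in auto)
  obtain U c where c: "(U, c) \<in> A" "p \<in> U" by (rule chart_at)
  have TS_span: "TS p \<subseteq> span ((\<lambda>i. coord_vec U c i p) ` Basis)"
  proof
    fix u assume "u \<in> TS p"
    show "u \<in> span ((\<lambda>i. coord_vec U c i p) ` Basis)"
      by (subst tangent_expansion[OF \<open>u \<in> TS p\<close> c]) (intro span_sum span_scale span_base imageI)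
  qed
  have "insert ?w (e ` Basis) \<subseteq> TS p" using w e by (simp add: image_subset_iff)
  from independent_span_bound[OF _ ind subset_trans[OF this TS_span]]
  have "card (insert ?w (e ` Basis)) \<le> card ((\<lambda>i. coord_vec U c i p) ` (Basis :: 'a set))" by simp
  also have "\<dots> \<le> card (Basis :: 'a set)" by (intro card_image_le) simp
  finally show False using w_notin card_image[OF inj] by simp
qed

lemma exists_orthonormal_frame: "\<exists>e. local_orthonormal_frame A g p e"
proof -
  obtain U c where c: "(U, c) \<in> A" "p \<in> U" by (rule chart_at)
  let ?x = "\<lambda>j y. c y \<bullet> j"
  \<comment> \<open>Gram-Schmidt; the last condition says that the \<open>e i\<close>, \<open>i \<in> S\<close>, stay in the span of the
    coordinate fields with index in \<open>S\<close>, so that the next coordinate field is independent of them.\<close>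
  have "\<exists>e. (\<forall>i\<in>S. vfield p (e i)) \<and>
      (\<forall>\<^sub>F q in nhds p. \<forall>i\<in>S. \<forall>j\<in>S. g q (e i q) (e j q) = (if i = j then 1 else 0)) \<and>
      (\<forall>\<^sub>F q in nhds p. \<forall>i\<in>S. \<forall>j\<in>Basis - S. e i q (?x j) = 0)" if "finite S" "S \<subseteq> Basis" for S :: "'a set"
    using that
  proof (induction S)
    case empty
    then show ?case by simp
  next
    case (insert k S)
    from insert.prems have "S \<subseteq> Basis" by simp
    from insert.IH[OF this] obtain e where e: "\<forall>i\<in>S. vfield p (e i)"
      "\<forall>\<^sub>F q in nhds p. \<forall>i\<in>S. \<forall>j\<in>S. g q (e i q) (e j q) = (if i = j then 1 else 0)"
      "\<forall>\<^sub>F q in nhds p. \<forall>i\<in>S. \<forall>j\<in>Basis - S. e i q (?x j) = 0" by (elim exE conjE) (rule that)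
    have k: "k \<in> Basis" "k \<notin> S" using insert by auto
    let ?k = "coord_vec U c k"
    define u where "u = (\<lambda>q. ?k q - (\<Sum>i\<in>S. g q (?k q) (e i q) *\<^sub>R e i q))"
    have fk: "vfield p ?k" by (rule coord_vec_field[OF c])
    have fu: "vfield p u" unfolding u_def
      by (intro id.section_diff fk id.section_sum id.section_scaleR metric_smooth) (use e(1) in auto)
    define N where "N = (\<lambda>q. g q (u q) (u q))"
    \<comment> \<open>The normalising factor 1/|u|, written as a power because smoothness of powers
      on the positive reals is available.\<close>
    define a where "a = (\<lambda>q. N q powr (- 1/2))"
    have tang: "\<forall>\<^sub>F q in nhds p. \<forall>i\<in>S. e i q \<in> TS q"
      using insert(1) e(1) vfield_tangent_ev by (intro eventually_ball_finite) auto
    have ev: "\<forall>\<^sub>F q in nhds p. (\<forall>j\<in>S. g q (u q) (e j q) = 0) \<and> (\<forall>j\<in>Basis - insert k S. u q (?x j) = 0)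
        \<and> N q > 0"
      using e(2,3) tang vfield_tangent_ev[OF fk] vfield_tangent_ev[OF fu] eventually_in_chart[OF c]
    proof eventually_elim
      case (elim q)
      have sT: "(\<Sum>i\<in>S. g q (?k q) (e i q) *\<^sub>R e i q) \<in> TS q"
        by (intro tangent_closed) (use elim in auto)
      have "g q (u q) (e j q) = 0" if j: "j \<in> S" for j
      proof -
        have "g q (\<Sum>i\<in>S. g q (?k q) (e i q) *\<^sub>R e i q) (e j q) =
            (\<Sum>i\<in>S. g q (?k q) (e i q) * g q (e i q) (e j q))"
          using elim j by (subst metric_sum) (auto simp: metric_scaleR tangent_closed)
        also have "\<dots> = (\<Sum>i\<in>S. if i = j then g q (?k q) (e j q) else 0)"
          using elim j by (intro sum.cong) auto
        also have "\<dots> = g q (?k q) (e j q)" using j insert(1) by simp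
        finally show ?thesis
          using metric_diff[OF _ sT] elim j by (simp add: u_def)
      qed
      \<comment> \<open>The case \<open>j = k\<close> shows that \<open>u\<close> does not vanish,
        so it can be normalised; the other cases keep the span condition for the next round.\<close>
      moreover have u_coord: "u q (?x j) = (if k = j then 1 else 0)" if "j \<in> Basis - S" for j
      proof -
        have "(\<Sum>i\<in>S. g q (?k q) (e i q) * e i q (?x j)) = 0"
          using elim that by (intro sum.neutral) auto
        then show ?thesis
          using coord_vec_coord[OF c(1) _ k(1), of q j] elim that
          by (simp add: u_def sum_fun_apply scaleR_fun_def)
      qed
      moreover have "u q \<noteq> 0" using u_coord[of k] k by auto
      ultimately show ?case using metric_pos[of "u q" q] elim by (auto simp: N_def)
    qed
    have sa: "smooth_at A p a" unfolding a_def
    proof (rule smooth_at_compose[OF _ _ _ smooth_on_powr])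
      show "smooth_at A p N" unfolding N_def by (rule metric_smooth[OF fu fu])
      show "N p \<in> {0<..}" using eventually_nhds_x_imp_x[OF ev] by simp
    qed simp
    let ?e = "e(k := (\<lambda>q. a q *\<^sub>R u q))"
    have "\<forall>i\<in>insert k S. vfield p (?e i)"
      using e(1) id.section_scaleR[OF sa fu] by auto
    moreover have "\<forall>\<^sub>F q in nhds p. \<forall>i\<in>insert k S. \<forall>j\<in>insert k S. g q (?e i q) (?e j q) = (if i = j then 1 else 0)"
      using e(2) ev tang vfield_tangent_ev[OF fu]
    proof eventually_elim
      case (elim q)
      have 1: "g q (a q *\<^sub>R u q) (e j q) = 0" if "j \<in> S" for j
        using metric_scaleR[of "u q" q "e j q"] elim that by simp
      have 2: "g q (e j q) (a q *\<^sub>R u q) = 0" if "j \<in> S" for j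
        using 1[OF that] metric_sym[of "e j q" q "a q *\<^sub>R u q"] elim that by (simp add: tangent_closed)
      have "g q (a q *\<^sub>R u q) (a q *\<^sub>R u q) = a q * (a q * N q)"
        using elim metric_sym[of "u q" q "a q *\<^sub>R u q"] by (simp add: metric_scaleR tangent_closed N_def)
      also have "\<dots> = 1"
      proof -
        have "a q * a q = inverse (N q)"
          unfolding a_def powr_add[symmetric] using elim powr_minus[of "N q" 1] by simp
        then show ?thesis using elim by (simp add: mult.assoc[symmetric])
      qed
      finally show ?case using 1 2 elim k by auto
    qed
    moreover have "\<forall>\<^sub>F q in nhds p. \<forall>i\<in>insert k S. \<forall>j\<in>Basis - insert k S. ?e i q (?x j) = 0"
      using e(3) ev by eventually_elim (auto simp: scaleR_fun_def)
    ultimately show ?case by blast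
  qed
  from this[of Basis] show ?thesis
    unfolding local_orthonormal_frame_def by auto
qed

section \<open>Traces over orthonormal frames\<close>

abbreviation onframe :: "'m \<Rightarrow> ('a \<Rightarrow> 'm \<Rightarrow> 'm tvec) \<Rightarrow> bool"
  where "onframe \<equiv> local_orthonormal_frame A g"

lemma frame_vfield: "onframe p e \<Longrightarrow> i \<in> Basis \<Longrightarrow> vfield p (e i)"
  by (simp add: local_orthonormal_frame_def)

lemma frame_tangent: "onframe p e \<Longrightarrow> i \<in> Basis \<Longrightarrow> e i p \<in> TS p"
  using frame_vfield vfield_tangent by blast

lemma frame_orthonormal:
  assumes "onframe p e" "i \<in> Basis" "j \<in> Basis"
  shows "g p (e i p) (e j p) = (if i = j then 1 else 0)"
proof -
  have "\<forall>\<^sub>F q in nhds p. \<forall>i\<in>Basis. \<forall>j\<in>Basis. g q (e i q) (e j q) = (if i = j then 1 else 0)"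
    using assms(1) by (simp add: local_orthonormal_frame_def)
  from eventually_nhds_x_imp_x[OF this] show ?thesis using assms(2,3) by simp
qed

lemma frame_expansion:
  assumes e: "onframe p e" and v: "v \<in> TS p"
  shows "v = (\<Sum>i\<in>Basis. g p v (e i p) *\<^sub>R e i p)"
  using orthonormal_expansion[OF frame_tangent[OF e] frame_orthonormal[OF e] v] by blast

text \<open>A frame at \<open>p\<close> is also one at all nearby points. Together with frame
  independence, one fixed frame then computes the trace on a neighbourhood, although
  \<open>frame_trace\<close> chooses a new frame at each point.\<close>

lemma eventually_frame:
  assumes "onframe p e" shows "\<forall>\<^sub>F q in nhds p. onframe q e"
proof -
  have "\<forall>\<^sub>F q in nhds p. \<forall>i\<in>Basis. vfield q (e i)"
    using id.eventually_section frame_vfield[OF assms] by (intro eventually_ball_finite) auto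
  moreover have "\<forall>\<^sub>F q in nhds p. \<forall>\<^sub>F q' in nhds q.
      \<forall>i\<in>Basis. \<forall>j\<in>Basis. g q' (e i q') (e j q') = (if i = j then 1 else 0)"
    using assms by (simp add: local_orthonormal_frame_def eventually_eventually)
  ultimately show ?thesis
    by eventually_elim (simp add: local_orthonormal_frame_def)
qed

text \<open>The matrix \<open>a\<close> of the change of frame at \<open>p\<close> is orthogonal, so
  the double sum collapses. \<open>H\<close> takes fields rather than vectors, because the Laplacian
  and the tension field differentiate the frame; tensoriality in each slot still permits the
  constant coefficients \<open>a i j\<close>.\<close>

lemma trace_frame_independent:
  fixes H :: "('m \<Rightarrow> 'm tvec) \<Rightarrow> ('m \<Rightarrow> 'm tvec) \<Rightarrow> 'r::real_vector"
  assumes e: "onframe p e" and e': "onframe p e'"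
    and H1: "\<And>E. vfield p E \<Longrightarrow> id.tensorial_at p (\<lambda>E'. H E' E)"
    and H2: "\<And>E. vfield p E \<Longrightarrow> id.tensorial_at p (H E)"
  shows "(\<Sum>i\<in>Basis. H (e i) (e i)) = (\<Sum>i\<in>Basis. H (e' i) (e' i))"
proof -
  define a where "a i j = g p (e' i p) (e j p)" for i j
  have fe: "vfield p (e i)" and fe': "vfield p (e' i)" if "i \<in> Basis" for i
    using frame_vfield e e' that by auto
  have expand: "F (e' i) = (\<Sum>j\<in>Basis. a i j *\<^sub>R F (e j))" if F: "id.tensorial_at p F" and i: "i \<in> Basis"
    for F :: "('m \<Rightarrow> 'm tvec) \<Rightarrow> 'r" and i
  proof -
    have s: "vfield p (\<lambda>q. a i j *\<^sub>R e j q)" if "j \<in> Basis" for j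
      by (intro id.section_scaleR smooth_at_const fe that)
    have "F (e' i) = F (\<lambda>q. \<Sum>j\<in>Basis. a i j *\<^sub>R e j q)"
      by (rule id.tensorial_point[OF F fe'[OF i] id.section_sum[OF s]])
        (use frame_expansion[OF e frame_tangent[OF e' i]] in \<open>simp_all add: a_def\<close>)
    also have "\<dots> = (\<Sum>j\<in>Basis. a i j *\<^sub>R F (e j))"
      by (subst id.tensorial_sum[OF F s]) (auto simp: id.tensorial_scaleR[OF F fe smooth_at_const])
    finally show ?thesis .
  qed
  have orth: "(\<Sum>i\<in>Basis. a i j * a i k) = (if j = k then 1 else 0)" if j: "j \<in> Basis" and k: "k \<in> Basis" for j k
  proof -
    have "g p (e j p) (e k p) = g p (\<Sum>i\<in>Basis. g p (e j p) (e' i p) *\<^sub>R e' i p) (e k p)"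
      using frame_expansion[OF e' frame_tangent[OF e j]] by simp
    also have "\<dots> = (\<Sum>i\<in>Basis. g p (e j p) (e' i p) * g p (e' i p) (e k p))"
      by (subst metric_sum) (auto simp: metric_scaleR frame_tangent e e' k tangent_closed)
    also have "\<dots> = (\<Sum>i\<in>Basis. a i j * a i k)"
      by (intro sum.cong refl) (simp add: a_def metric_sym frame_tangent e e' j)
    finally show ?thesis using frame_orthonormal[OF e j k] by simp
  qed
  have "(\<Sum>i\<in>Basis. H (e' i) (e' i)) = (\<Sum>i\<in>Basis. \<Sum>j\<in>Basis. a i j *\<^sub>R H (e j) (e' i))"
    by (intro sum.cong refl) (rule expand[OF H1[OF fe']])
  also have "\<dots> = (\<Sum>i\<in>Basis. \<Sum>j\<in>Basis. a i j *\<^sub>R (\<Sum>k\<in>Basis. a i k *\<^sub>R H (e j) (e k)))"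
    by (intro sum.cong refl arg_cong[where f = "scaleR _"]) (rule expand[OF H2[OF fe]])
  also have "\<dots> = (\<Sum>i\<in>Basis. \<Sum>j\<in>Basis. \<Sum>k\<in>Basis. (a i j * a i k) *\<^sub>R H (e j) (e k))"
    by (simp add: scaleR_sum_right)
  also have "\<dots> = (\<Sum>j\<in>Basis. \<Sum>k\<in>Basis. \<Sum>i\<in>Basis. (a i j * a i k) *\<^sub>R H (e j) (e k))"
    by (rule trans[OF sum.swap]) (intro sum.cong refl sum.swap)
  also have "\<dots> = (\<Sum>j\<in>Basis. \<Sum>k\<in>Basis. (if j = k then 1 else 0) *\<^sub>R H (e j) (e k))"
    by (intro sum.cong refl) (simp add: orth flip: scaleR_sum_left)
  also have "\<dots> = (\<Sum>j\<in>Basis. \<Sum>k\<in>Basis. if j = k then H (e j) (e j) else 0)"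
    by (intro sum.cong refl) auto
  also have "\<dots> = (\<Sum>j\<in>Basis. H (e j) (e j))" by simp
  finally show ?thesis by simp
qed

definition some_frame :: "'m \<Rightarrow> 'a \<Rightarrow> 'm \<Rightarrow> 'm tvec"
  where "some_frame p = (SOME e. onframe p e)"

lemma onframe_some_frame: "onframe p (some_frame p)"
  unfolding some_frame_def by (rule someI_ex[OF exists_orthonormal_frame])

lemma frame_trace_some_frame: "frame_trace A g p F = (\<Sum>i\<in>Basis. F (some_frame p i))"
  by (simp add: frame_trace_def some_frame_def Let_def)

lemma frame_trace_eq:
  fixes H :: "('m \<Rightarrow> 'm tvec) \<Rightarrow> ('m \<Rightarrow> 'm tvec) \<Rightarrow> 'r::real_vector"
  assumes e: "onframe p e"
    and H1: "\<And>E. vfield p E \<Longrightarrow> id.tensorial_at p (\<lambda>E'. H E' E)"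
    and H2: "\<And>E. vfield p E \<Longrightarrow> id.tensorial_at p (H E)"
  shows "frame_trace A g p (\<lambda>E. H E E) = (\<Sum>i\<in>Basis. H (e i) (e i))"
  using trace_frame_independent[OF onframe_some_frame e H1 H2] by (simp add: frame_trace_some_frame)

end

locale riemannian = metric_manifold A g
  for A :: "('m::{t2_space, second_countable_topology}, 'a::euclidean_space) atlas"
    and g :: "'m \<Rightarrow> 'm tvec \<Rightarrow> 'm tvec \<Rightarrow> real" +
  fixes D :: "('m, 'm) conn"
  assumes levi_civita: "levi_civita A g D"
begin

sublocale LC: connection A A id D
  using levi_civita by unfold_locales (simp add: levi_civita_def)

lemma torsion_free:
  "vfield p X \<Longrightarrow> vfield p Y \<Longrightarrow> D p (X p) Y - D p (Y p) X = lie_bracket A X Y p"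
  using levi_civita by (simp add: levi_civita_def)

lemma metric_compatible:
  "vfield p X \<Longrightarrow> vfield p Y \<Longrightarrow> v \<in> TS p \<Longrightarrow>
    v (\<lambda>q. g q (X q) (Y q)) = g p (D p v X) (Y p) + g p (X p) (D p v Y)"
  using levi_civita by (simp add: levi_civita_def)

lemma LC_tangent: "vfield p X \<Longrightarrow> v \<in> TS p \<Longrightarrow> D p v X \<in> TS p"
  using LC.conn_tangent[of p X v] by simp

end

subsection \<open>Second covariant derivatives\<close>

context connection
begin

lemma eventually_conn:
  assumes "sect p W" "vector_field_at A p E"
  shows "\<forall>\<^sub>F q in nhds p. sect q W \<and> E q \<in> tangent_space A q"
  using eventually_section[OF assms(1)] section_tangent_ev[OF assms(2)]
  by eventually_elim simp

lemma conn2_dir_add: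
  assumes W: "sect p W" and E: "vector_field_at A p E" "vector_field_at A p E'" and v: "v \<in> tangent_space A p"
  shows "D p v (\<lambda>q. D q (E q + E' q) W) = D p v (\<lambda>q. D q (E q) W) + D p v (\<lambda>q. D q (E' q) W)"
proof -
  note s = conn_section[OF W E(1)] conn_section[OF W E(2)]
  have "\<forall>\<^sub>F q in nhds p. D q (E q) W + D q (E' q) W = D q (E q + E' q) W"
    using eventually_conn[OF W E(1)] eventually_conn[OF W E(2)]
    by eventually_elim (simp add: conn_dir_add)
  from conn_cong[OF section_add[OF s] v this] conn_add[OF s v] show ?thesis by simp
qed

lemma conn2_dir_scaleR:
  assumes W: "sect p W" and E: "vector_field_at A p E" and f: "smooth_at A p f" and v: "v \<in> tangent_space A p"
  shows "D p v (\<lambda>q. D q (f q *\<^sub>R E q) W) = v f *\<^sub>R D p (E p) W + f p *\<^sub>R D p v (\<lambda>q. D q (E q) W)"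
proof -
  note s = conn_section[OF W E]
  have "\<forall>\<^sub>F q in nhds p. f q *\<^sub>R D q (E q) W = D q (f q *\<^sub>R E q) W"
    using eventually_conn[OF W E] by eventually_elim (simp add: conn_dir_scaleR)
  from conn_cong[OF section_scaleR[OF f s] v this] conn_leibniz[OF s f v] show ?thesis by simp
qed

lemma conn2_add:
  assumes W: "sect p W" "sect p W'" and E: "vector_field_at A p E" and v: "v \<in> tangent_space A p"
  shows "D p v (\<lambda>q. D q (E q) (\<lambda>r. W r + W' r)) = D p v (\<lambda>q. D q (E q) W) + D p v (\<lambda>q. D q (E q) W')"
proof -
  note s = conn_section[OF W(1) E] conn_section[OF W(2) E]
  have "\<forall>\<^sub>F q in nhds p. D q (E q) W + D q (E q) W' = D q (E q) (\<lambda>r. W r + W' r)"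
    using eventually_conn[OF W(1) E] eventually_conn[OF W(2) E]
    by eventually_elim (simp add: conn_add)
  from conn_cong[OF section_add[OF s] v this] conn_add[OF s v] show ?thesis by simp
qed

text \<open>The two mixed terms are symmetric in the two directions, and the first term
  antisymmetrises to the bracket applied to \<open>f\<close>; this makes curvature tensorial in its
  last slot.\<close>

lemma conn2_leibniz:
  assumes W: "sect p W" and E: "vector_field_at A p E" and f: "smooth_at A p f" and v: "v \<in> tangent_space A p"
  shows "D p v (\<lambda>q. D q (E q) (\<lambda>r. f r *\<^sub>R W r)) =
    v (\<lambda>q. E q f) *\<^sub>R W p + E p f *\<^sub>R D p v W + v f *\<^sub>R D p (E p) W + f p *\<^sub>R D p v (\<lambda>q. D q (E q) W)"
proof -
  have Ef: "smooth_at A p (\<lambda>q. E q f)" using section_smooth[OF E] f by simp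
  note s = conn_section[OF W E]
  note s' = section_scaleR[OF Ef W] section_scaleR[OF f s]
  have "\<forall>\<^sub>F q in nhds p. E q f *\<^sub>R W q + f q *\<^sub>R D q (E q) W = D q (E q) (\<lambda>r. f r *\<^sub>R W r)"
    using eventually_conn[OF W E] M.eventually_smooth_at[OF f] by eventually_elim (simp add: conn_leibniz)
  from conn_cong[OF section_add[OF s'] v this] conn_add[OF s' v]
    conn_leibniz[OF W Ef v] conn_leibniz[OF s f v]
  show ?thesis by (simp add: add.assoc)
qed

end


subsection \<open>The curvature tensor\<close>

context riemannian
begin

lemma lie_bracket_apply:
  "smooth_at A p f \<Longrightarrow> lie_bracket A X Y p f = X p (\<lambda>q. Y q f) - Y p (\<lambda>q. X q f)"
  by (simp add: lie_bracket_def)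

lemma LC_field: "vfield p X \<Longrightarrow> vfield p Y \<Longrightarrow> vfield p (\<lambda>q. D q (X q) Y)"
  by (rule LC.conn_section)

text \<open>Torsion-freeness exhibits the bracket as a difference of covariant derivatives, from
  which both the derivation property and smoothness are inherited.\<close>

lemma lie_bracket_field:
  assumes X: "vfield p X" and Y: "vfield p Y" shows "vfield p (lie_bracket A X Y)"
proof (rule id.section_cong)
  show "vfield p (\<lambda>q. D q (X q) Y - D q (Y q) X)"
    by (rule id.section_diff[OF LC_field[OF X Y] LC_field[OF Y X]])
  show "\<forall>\<^sub>F q in nhds p. D q (X q) Y - D q (Y q) X = lie_bracket A X Y q"
    using id.eventually_section[OF X] id.eventually_section[OF Y]
    by eventually_elim (rule torsion_free)
qed

lemma lie_bracket_antisym: "lie_bracket A Y X p = - lie_bracket A X Y p"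
  by (auto simp: lie_bracket_def fun_eq_iff)

lemma Jacobi:
  assumes X: "vfield p X" and Y: "vfield p Y" and Z: "vfield p Z"
  shows "lie_bracket A X (lie_bracket A Y Z) p + lie_bracket A Y (lie_bracket A Z X) p
    + lie_bracket A Z (lie_bracket A X Y) p = 0"
proof
  fix f
  let ?b = "lie_bracket A"
  have expand: "?b X (?b Y Z) p f = X p (\<lambda>q. Y q (\<lambda>r. Z r f)) - X p (\<lambda>q. Z q (\<lambda>r. Y r f))
      - Y p (\<lambda>q. Z q (\<lambda>r. X r f)) + Z p (\<lambda>q. Y q (\<lambda>r. X r f))"
    if f: "smooth_at A p f" and X: "vfield p X" and Y: "vfield p Y" and Z: "vfield p Z" for X Y Z
  proof -
    note s = vfield_smooth[OF X f] vfield_smooth[OF Y f] vfield_smooth[OF Z f]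
    have "X p (\<lambda>q. ?b Y Z q f) = X p (\<lambda>q. Y q (\<lambda>r. Z r f) - Z q (\<lambda>r. Y r f))"
      by (rule tangent_cong[OF vfield_tangent[OF X]])
        (use eventually_smooth_at[OF f] in eventually_elim, simp add: lie_bracket_apply)
    also have "\<dots> = X p (\<lambda>q. Y q (\<lambda>r. Z r f)) - X p (\<lambda>q. Z q (\<lambda>r. Y r f))"
      by (rule tangent_diff[OF vfield_tangent[OF X] vfield_smooth[OF Y s(3)] vfield_smooth[OF Z s(2)]])
    finally show ?thesis using lie_bracket_apply[OF f, of X "?b Y Z"] lie_bracket_apply[OF s(1), of Y Z] by simp
  qed
  show "(?b X (?b Y Z) p + ?b Y (?b Z X) p + ?b Z (?b X Y) p) f = 0 f"
  proof (cases "smooth_at A p f")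
    case True
    then show ?thesis by (simp add: expand X Y Z)
  qed (simp add: lie_bracket_def)
qed

text \<open>Curvature on fields, where the calculus of covariant derivatives applies directly. It is
  identified with the definite description \<open>curvature\<close> once it is known to be
  tensorial.\<close>

definition curv :: "('m \<Rightarrow> 'm tvec) \<Rightarrow> ('m \<Rightarrow> 'm tvec) \<Rightarrow> ('m \<Rightarrow> 'm tvec) \<Rightarrow> 'm \<Rightarrow> 'm tvec"
  where "curv X Y Z p =
    D p (X p) (\<lambda>q. D q (Y q) Z) - D p (Y p) (\<lambda>q. D q (X q) Z) - D p (lie_bracket A X Y p) Z"

lemma curv_tangent:
  assumes "vfield p X" "vfield p Y" "vfield p Z" shows "curv X Y Z p \<in> TS p"
  unfolding curv_def
  by (intro tangent_closed LC_tangent LC_field vfield_tangent lie_bracket_field assms)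

lemma curv_antisym:
  assumes "vfield p X" "vfield p Y" "vfield p Z" shows "curv Y X Z p = - curv X Y Z p"
proof -
  have "D p (lie_bracket A Y X p) Z = - D p (lie_bracket A X Y p) Z"
    using LC.conn_dir_scaleR[OF assms(3) vfield_tangent[OF lie_bracket_field[OF assms(1,2)]], of "-1"]
    by (simp add: lie_bracket_antisym[of Y X])
  then show ?thesis by (simp add: curv_def)
qed

text \<open>\<open>[f X, Y] = f [X, Y] - (Y f) X\<close>, and the derivative of \<open>f\<close>
  that this puts into the bracket term cancels the one arising when \<open>Y\<close> differentiates
  the derivative along \<open>f X\<close>.\<close>

lemma curv_tensorial_1:
  assumes Y: "vfield p Y" and Z: "vfield p Z" shows "id.tensorial_at p (\<lambda>X. curv X Y Z p)"
  unfolding id.tensorial_at_def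
proof (intro conjI allI impI)
  note Yt = vfield_tangent[OF Y]
  fix X X' assume X: "vfield p X" and X': "vfield p X'"
  note Xt = vfield_tangent[OF X] vfield_tangent[OF X']
  have "lie_bracket A (\<lambda>q. X q + X' q) Y p = lie_bracket A X Y p + lie_bracket A X' Y p"
    unfolding torsion_free[OF X Y, symmetric] torsion_free[OF X' Y, symmetric]
      torsion_free[OF id.section_add[OF X X'] Y, symmetric]
      LC.conn_dir_add[OF Y Xt] LC.conn_add[OF X X' Yt] by simp
  moreover have "D p (lie_bracket A X Y p + lie_bracket A X' Y p) Z =
      D p (lie_bracket A X Y p) Z + D p (lie_bracket A X' Y p) Z"
    by (rule LC.conn_dir_add[OF Z vfield_tangent[OF lie_bracket_field[OF X Y]]
          vfield_tangent[OF lie_bracket_field[OF X' Y]]])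
  ultimately show "curv (\<lambda>q. X q + X' q) Y Z p = curv X Y Z p + curv X' Y Z p"
    unfolding curv_def
    using LC.conn_dir_add[OF LC_field[OF Y Z] Xt] LC.conn2_dir_add[OF Z X X' Yt] by simp
next
  note Yt = vfield_tangent[OF Y]
  fix X and f :: "'m \<Rightarrow> real" assume X: "vfield p X" and f: "smooth_at A p f"
  note Xt = vfield_tangent[OF X]
  note b = vfield_tangent[OF lie_bracket_field[OF X Y]]
  have "lie_bracket A (\<lambda>q. f q *\<^sub>R X q) Y p = f p *\<^sub>R lie_bracket A X Y p + (- Y p f) *\<^sub>R X p"
    unfolding torsion_free[OF X Y, symmetric] torsion_free[OF id.section_scaleR[OF f X] Y, symmetric]
      LC.conn_dir_scaleR[OF Y Xt] LC.conn_leibniz[OF X f Yt] by (simp add: scaleR_diff_right)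
  then have "D p (lie_bracket A (\<lambda>q. f q *\<^sub>R X q) Y p) Z = f p *\<^sub>R D p (lie_bracket A X Y p) Z + (- Y p f) *\<^sub>R D p (X p) Z"
    using LC.conn_linear[OF Z b Xt, of "f p" "- Y p f"] by simp
  then show "curv (\<lambda>q. f q *\<^sub>R X q) Y Z p = f p *\<^sub>R curv X Y Z p"
    unfolding curv_def
    using LC.conn_dir_scaleR[OF LC_field[OF Y Z] Xt] LC.conn2_dir_scaleR[OF Z X f Yt]
    by (simp add: scaleR_diff_right)
qed

lemma curv_tensorial_2:
  assumes X: "vfield p X" and Z: "vfield p Z" shows "id.tensorial_at p (\<lambda>Y. curv X Y Z p)"
proof -
  have eq: "curv X Y Z p = - curv Y X Z p" if "vfield p Y" for Y
    by (rule curv_antisym[OF that X Z])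
  note t = curv_tensorial_1[OF X Z]
  show ?thesis
    unfolding id.tensorial_at_def
  proof (intro conjI allI impI)
    fix Y Y' assume Y: "vfield p Y" and Y': "vfield p Y'"
    show "curv X (\<lambda>q. Y q + Y' q) Z p = curv X Y Z p + curv X Y' Z p"
      using id.tensorial_add[OF t Y Y'] eq[OF Y] eq[OF Y'] eq[OF id.section_add[OF Y Y']] by simp
  next
    fix Y and f :: "'m \<Rightarrow> real" assume Y: "vfield p Y" and f: "smooth_at A p f"
    show "curv X (\<lambda>q. f q *\<^sub>R Y q) Z p = f p *\<^sub>R curv X Y Z p"
      using id.tensorial_scaleR[OF t Y f] eq[OF Y] eq[OF id.section_scaleR[OF f Y]] by simp
  qed
qed

lemma curv_tensorial_3:
  assumes X: "vfield p X" and Y: "vfield p Y" shows "id.tensorial_at p (\<lambda>Z. curv X Y Z p)"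
  unfolding id.tensorial_at_def
proof (intro conjI allI impI)
  note Xt = vfield_tangent[OF X] and Yt = vfield_tangent[OF Y]
  note b = vfield_tangent[OF lie_bracket_field[OF X Y]]
  {
    fix Z Z' assume Z: "vfield p Z" and Z': "vfield p Z'"
    show "curv X Y (\<lambda>q. Z q + Z' q) p = curv X Y Z p + curv X Y Z' p"
      unfolding curv_def
      using LC.conn2_add[OF Z Z' Y Xt] LC.conn2_add[OF Z Z' X Yt] LC.conn_add[OF Z Z' b] by simp
  next
    fix Z and f :: "'m \<Rightarrow> real" assume Z: "vfield p Z" and f: "smooth_at A p f"
    show "curv X Y (\<lambda>q. f q *\<^sub>R Z q) p = f p *\<^sub>R curv X Y Z p"
      unfolding curv_def
      using LC.conn2_leibniz[OF Z Y f Xt] LC.conn2_leibniz[OF Z X f Yt] LC.conn_leibniz[OF Z f b]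
      by (simp add: lie_bracket_apply[OF f] scaleR_diff_right scaleR_diff_left)
  }
qed

lemma curv_point:
  assumes X: "vfield p X" "vfield p X'" "X p = X' p" and Y: "vfield p Y" "vfield p Y'" "Y p = Y' p"
    and Z: "vfield p Z" "vfield p Z'" "Z p = Z' p"
  shows "curv X Y Z p = curv X' Y' Z' p"
  using id.tensorial_point[OF curv_tensorial_1[OF Y(1) Z(1)] X]
    id.tensorial_point[OF curv_tensorial_2[OF X(2) Z(1)] Y]
    id.tensorial_point[OF curv_tensorial_3[OF X(2) Y(2)] Z] by simp

text \<open>All extensions of the three vectors give the same value by tensoriality, so the
  description is satisfied; the given fields themselves force its uniqueness.\<close>

lemma curvature_eq:
  assumes X: "vfield p X" and Y: "vfield p Y" and Z: "vfield p Z"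
  shows "curvature A D p (X p) (Y p) (Z p) = curv X Y Z p"
  unfolding curvature_def
proof (rule the_equality)
  show "\<forall>X' Y' Z'. vfield p X' \<and> X' p = X p \<longrightarrow> vfield p Y' \<and> Y' p = Y p \<longrightarrow> vfield p Z' \<and> Z' p = Z p \<longrightarrow>
      curv X Y Z p = D p (X p) (\<lambda>q. D q (Y' q) Z') - D p (Y p) (\<lambda>q. D q (X' q) Z') -
        D p (lie_bracket A X' Y' p) Z'"
  proof (intro allI impI)
    fix X' Y' Z' assume "vfield p X' \<and> X' p = X p" "vfield p Y' \<and> Y' p = Y p" "vfield p Z' \<and> Z' p = Z p"
    then show "curv X Y Z p = D p (X p) (\<lambda>q. D q (Y' q) Z') - D p (Y p) (\<lambda>q. D q (X' q) Z') -
        D p (lie_bracket A X' Y' p) Z'"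
      using curv_point[OF X _ _ Y _ _ Z, of X' Y' Z'] by (simp add: curv_def)
  qed
  fix r assume r: "\<forall>X' Y' Z'. vfield p X' \<and> X' p = X p \<longrightarrow> vfield p Y' \<and> Y' p = Y p \<longrightarrow> vfield p Z' \<and> Z' p = Z p \<longrightarrow>
      r = D p (X p) (\<lambda>q. D q (Y' q) Z') - D p (Y p) (\<lambda>q. D q (X' q) Z') -
        D p (lie_bracket A X' Y' p) Z'"
  from r[rule_format, of X Y Z] X Y Z show "r = curv X Y Z p" by (simp add: curv_def)
qed

text \<open>Differentiate the function \<open>g(Z, W)\<close> twice. In
  \<open>X Y G - Y X G - [X, Y] G = 0\<close> the products of first derivatives cancel, and what
  remains is the sum of the two curvature terms.\<close>

lemma curv_metric_skew:
  assumes X: "vfield p X" and Y: "vfield p Y" and Z: "vfield p Z" and W: "vfield p W"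
  shows "g p (curv X Y Z p) (W p) = - g p (curv X Y W p) (Z p)"
proof -
  let ?G = "\<lambda>q. g q (Z q) (W q)"
  note b = vfield_tangent[OF lie_bracket_field[OF X Y]]
  have G2: "X p (\<lambda>q. Y q ?G) =
      g p (D p (X p) (\<lambda>q. D q (Y q) Z)) (W p) + g p (D p (Y p) Z) (D p (X p) W)
      + (g p (D p (X p) Z) (D p (Y p) W) + g p (Z p) (D p (X p) (\<lambda>q. D q (Y q) W)))"
    if X: "vfield p X" and Y: "vfield p Y" for X Y
  proof -
    note f = LC_field[OF Y Z] LC_field[OF Y W]
    have "X p (\<lambda>q. Y q ?G) = X p (\<lambda>q. g q (D q (Y q) Z) (W q) + g q (Z q) (D q (Y q) W))"
    proof (rule tangent_cong[OF vfield_tangent[OF X]])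
      show "\<forall>\<^sub>F q in nhds p. Y q ?G = g q (D q (Y q) Z) (W q) + g q (Z q) (D q (Y q) W)"
        using id.eventually_section[OF Z] id.eventually_section[OF W] vfield_tangent_ev[OF Y]
        by eventually_elim (rule metric_compatible)
    qed
    also have "\<dots> = X p (\<lambda>q. g q (D q (Y q) Z) (W q)) + X p (\<lambda>q. g q (Z q) (D q (Y q) W))"
      by (rule tangent_add[OF vfield_tangent[OF X] metric_smooth[OF f(1) W] metric_smooth[OF Z f(2)]])
    finally show ?thesis
      unfolding metric_compatible[OF f(1) W vfield_tangent[OF X]] metric_compatible[OF Z f(2) vfield_tangent[OF X]] .
  qed
  note T = vfield_tangent[OF Z] vfield_tangent[OF W]
    LC_tangent[OF LC_field[OF Y Z] vfield_tangent[OF X]] LC_tangent[OF LC_field[OF Y W] vfield_tangent[OF X]]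
    LC_tangent[OF LC_field[OF X Z] vfield_tangent[OF Y]] LC_tangent[OF LC_field[OF X W] vfield_tangent[OF Y]]
    LC_tangent[OF Z b] LC_tangent[OF W b]
  have "g p (curv X Y Z p) (W p) + g p (curv X Y W p) (Z p) =
      X p (\<lambda>q. Y q ?G) - Y p (\<lambda>q. X q ?G) - lie_bracket A X Y p ?G"
    unfolding G2[OF X Y] G2[OF Y X] metric_compatible[OF Z W b] curv_def
    by (simp add: metric_diff metric_diff_right T tangent_closed metric_sym[of "Z p"])
  also have "\<dots> = 0" using lie_bracket_apply[OF metric_smooth[OF Z W]] by simp
  finally show ?thesis by simp
qed

text \<open>Pairing the second derivatives with the same outer direction, torsion-freeness leaves
  derivatives along brackets, which cancel the bracket terms of the curvature, and double brackets,
  which add up to zero by the Jacobi identity.\<close>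

lemma Bianchi:
  assumes X: "vfield p X" and Y: "vfield p Y" and Z: "vfield p Z"
  shows "curv X Y Z p + curv Y Z X p + curv Z X Y p = 0"
proof -
  have torsion2: "D p (X p) (\<lambda>q. D q (Y q) Z) - D p (X p) (\<lambda>q. D q (Z q) Y)
      = D p (lie_bracket A Y Z p) X + lie_bracket A X (lie_bracket A Y Z) p"
    if X: "vfield p X" and Y: "vfield p Y" and Z: "vfield p Z" for X Y Z
  proof -
    note f = LC_field[OF Y Z] LC_field[OF Z Y]
    note Xt = vfield_tangent[OF X]
    have "D p (X p) (\<lambda>q. D q (Y q) Z - D q (Z q) Y) = D p (X p) (lie_bracket A Y Z)"
    proof (rule LC.conn_cong[OF id.section_diff[OF f] Xt])
      show "\<forall>\<^sub>F q in nhds p. D q (Y q) Z - D q (Z q) Y = lie_bracket A Y Z q"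
        using id.eventually_section[OF Y] id.eventually_section[OF Z]
        by eventually_elim (rule torsion_free)
    qed
    then show ?thesis
      using LC.conn_diff[OF f Xt] torsion_free[OF X lie_bracket_field[OF Y Z]]
      by (simp add: diff_eq_eq add.commute)
  qed
  show ?thesis
    using torsion2[OF X Y Z] torsion2[OF Y Z X] torsion2[OF Z X Y] Jacobi[OF X Y Z]
    unfolding curv_def by (simp add: algebra_simps)
qed

text \<open>The classical octahedron argument: the four cyclic Bianchi identities on
  \<open>X\<close>, \<open>Y\<close>, \<open>Z\<close>, \<open>W\<close>, reduced by skewness in the
  first and in the last pair of slots, are linear equations that imply the symmetry.\<close>

lemma curv_pair_sym:
  assumes X: "vfield p X" and Y: "vfield p Y" and Z: "vfield p Z" and W: "vfield p W"
  shows "g p (curv X Y Z p) (W p) = g p (curv Z W X p) (Y p)"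
proof -
  have skew12: "g p (curv Y X Z p) (W p) = - g p (curv X Y Z p) (W p)"
    if "vfield p X" "vfield p Y" "vfield p Z" "vfield p W" for X Y Z W
    unfolding curv_antisym[OF that(1-3)]
    by (rule metric_minus[OF curv_tangent[OF that(1-3)] vfield_tangent[OF that(4)]])
  have bianchi: "g p (curv X Y Z p) (W p) + g p (curv Y Z X p) (W p) + g p (curv Z X Y p) (W p) = 0"
    if "vfield p X" "vfield p Y" "vfield p Z" "vfield p W" for X Y Z W
  proof -
    note T = curv_tangent[OF that(1-3)] curv_tangent[OF that(2,3,1)] curv_tangent[OF that(3,1,2)] vfield_tangent[OF that(4)]
    have "g p (curv X Y Z p + curv Y Z X p + curv Z X Y p) (W p) = 0"
      unfolding Bianchi[OF that(1-3)] by (rule metric_0[OF T(4)])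
    then show ?thesis by (simp add: metric_add T tangent_closed)
  qed
  show ?thesis
    using bianchi[OF X Y Z W] bianchi[OF Y Z W X] bianchi[OF Z W X Y] bianchi[OF W X Y Z]
      curv_metric_skew[OF X Y Z W] curv_metric_skew[OF Y Z X W] curv_metric_skew[OF Z X Y W]
      curv_metric_skew[OF Z W X Y] curv_metric_skew[OF W X Y Z] curv_metric_skew[OF Y W Z X]
      skew12[OF Y W Z X] skew12[OF W Y Z X] skew12[OF X Z W Y] skew12[OF X Z Y W] skew12[OF Y W X Z]
      curv_metric_skew[OF W Y Z X] curv_metric_skew[OF X Z W Y]
    by linarith
qed

section \<open>Curvature on tangent vectors\<close>

lemma curvature_fields:
  assumes "u \<in> TS p" "v \<in> TS p" "w \<in> TS p" "z \<in> TS p"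
  obtains X Y Z W where "vfield p X" "vfield p Y" "vfield p Z" "vfield p W"
    "X p = u" "Y p = v" "Z p = w" "W p = z"
proof -
  obtain X where X: "vfield p X" "X p = u" by (rule exists_local_field[OF assms(1)])
  obtain Y where Y: "vfield p Y" "Y p = v" by (rule exists_local_field[OF assms(2)])
  obtain Z where Z: "vfield p Z" "Z p = w" by (rule exists_local_field[OF assms(3)])
  obtain W where W: "vfield p W" "W p = z" by (rule exists_local_field[OF assms(4)])
  show ?thesis by (rule that[OF X(1) Y(1) Z(1) W(1) X(2) Y(2) Z(2) W(2)])
qed

abbreviation R :: "'m \<Rightarrow> 'm tvec \<Rightarrow> 'm tvec \<Rightarrow> 'm tvec \<Rightarrow> 'm tvec"
  where "R \<equiv> curvature A D"

lemma curvature_tangent: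
  assumes "u \<in> TS p" "v \<in> TS p" "w \<in> TS p" shows "R p u v w \<in> TS p"
proof -
  obtain X Y Z W where "vfield p X" "vfield p Y" "vfield p Z" "vfield p W"
    "X p = u" "Y p = v" "Z p = w" "W p = w"
    by (rule curvature_fields[OF assms assms(3)])
  then show ?thesis using curvature_eq curv_tangent by metis
qed

lemma curvature_symmetries:
  assumes "u \<in> TS p" "v \<in> TS p" "w \<in> TS p" "z \<in> TS p"
  shows curvature_antisym: "R p v u w = - R p u v w"
    and curvature_skew: "g p (R p u v w) z = - g p (R p u v z) w"
    and curvature_pair_sym: "g p (R p u v w) z = g p (R p w z u) v"
proof -
  obtain X Y Z W where f: "vfield p X" "vfield p Y" "vfield p Z" "vfield p W"
    and eq: "X p = u" "Y p = v" "Z p = w" "W p = z"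
    by (rule curvature_fields[OF assms])
  show "R p v u w = - R p u v w"
    using curvature_eq[OF f(2,1,3)] curvature_eq[OF f(1,2,3)] curv_antisym[OF f(1-3)] eq by simp
  show "g p (R p u v w) z = - g p (R p u v z) w"
    using curvature_eq[OF f(1,2,3)] curvature_eq[OF f(1,2,4)] curv_metric_skew[OF f] eq by simp
  show "g p (R p u v w) z = g p (R p w z u) v"
    using curvature_eq[OF f(1,2,3)] curvature_eq[OF f(3,4,1)] curv_pair_sym[OF f] eq by simp
qed


subsection \<open>Killing fields\<close>

text \<open>Extending \<open>u\<close> and \<open>v\<close> to global fields brings the Killing
  condition down to single tangent vectors.\<close>

lemma killing_skew:
  assumes K: "killing_field A g D X" and u: "u \<in> TS p" and v: "v \<in> TS p"
  shows "g p (D p u X) v = - g p (D p v X) u"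
proof -
  obtain U where U: "vector_field A U" "U p = u" by (rule exists_global_field[OF u])
  obtain V where V: "vector_field A V" "V p = v" by (rule exists_global_field[OF v])
  have "\<forall>Y Z. vector_field A Y \<longrightarrow> vector_field A Z \<longrightarrow>
       (\<forall>p. g p (D p (Y p) X) (Z p) + g p (D p (Z p) X) (Y p) = 0)"
    using K by (simp add: killing_field_def)
  from this[rule_format, OF U(1) V(1), of p] show ?thesis using U V by simp
qed

lemma killing_vfield: "killing_field A g D X \<Longrightarrow> vfield p X"
  by (simp add: killing_field_def vector_field_def)

text \<open>Kostant's formula: the second covariant derivative \<open>S(Y,Z)\<close> of a Killing field is skew in its
  last slot, and \<open>S(Y,Z) - S(Z,Y)\<close> is a curvature term by the Ricci identity; permuting the three
  arguments determines \<open>S\<close>.\<close>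

lemma killing_second_derivative:
  assumes K: "killing_field A g D X" and Y: "vfield p Y" and Z: "vfield p Z"
  shows "D p (Y p) (\<lambda>q. D q (Z q) X) - D p (D p (Y p) Z) X = - curv X Y Z p"
proof -
  note X = killing_vfield[OF K]
  define S where "S Y Z = D p (Y p) (\<lambda>q. D q (Z q) X) - D p (D p (Y p) Z) X" for Y Z
  have ST: "S Y Z \<in> TS p" if Y: "vfield p Y" and Z: "vfield p Z" for Y Z
    unfolding S_def
    by (rule tangent_closed(3)[OF LC_tangent[OF LC_field[OF Z X] vfield_tangent[OF Y]]
          LC_tangent[OF X LC_tangent[OF Z vfield_tangent[OF Y]]]])
  have skew: "g p (S Y Z) (W p) = - g p (S Y W) (Z p)"
    if Y: "vfield p Y" and Z: "vfield p Z" and W: "vfield p W" for Y Z W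
  proof -
    note Yt = vfield_tangent[OF Y]
    note f = LC_field[OF Z X] LC_field[OF W X]
    \<comment> \<open>Skewness of the first derivative of \<open>X\<close> holds at all points near
      \<open>p\<close>, so it can be differentiated along \<open>Y\<close>; the sign is written as
      the factor \<open>- 1\<close> to fit \<open>tangent_scale\<close>.\<close>
    have ev: "\<forall>\<^sub>F q in nhds p. g q (D q (Z q) X) (W q) = (- 1) * g q (D q (W q) X) (Z q)"
      using vfield_tangent_ev[OF Z] vfield_tangent_ev[OF W]
    proof eventually_elim
      case (elim q)
      then show ?case using killing_skew[OF K elim] by simp
    qed
    have "Y p (\<lambda>q. g q (D q (Z q) X) (W q)) = Y p (\<lambda>q. (- 1) * g q (D q (W q) X) (Z q))"
      by (rule tangent_cong[OF Yt ev])
    also have "\<dots> = (- 1) * Y p (\<lambda>q. g q (D q (W q) X) (Z q))"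
      by (rule tangent_scale[OF Yt metric_smooth[OF f(2) Z]])
    finally have "g p (D p (Y p) (\<lambda>q. D q (Z q) X)) (W p) + g p (D p (Z p) X) (D p (Y p) W) =
        - (g p (D p (Y p) (\<lambda>q. D q (W q) X)) (Z p) + g p (D p (W p) X) (D p (Y p) Z))"
      unfolding metric_compatible[OF f(1) W Yt] metric_compatible[OF f(2) Z Yt] by simp
    moreover have "g p (D p (Z p) X) (D p (Y p) W) = - g p (D p (D p (Y p) W) X) (Z p)"
      by (rule killing_skew[OF K vfield_tangent[OF Z] LC_tangent[OF W Yt]])
    moreover have "g p (D p (W p) X) (D p (Y p) Z) = - g p (D p (D p (Y p) Z) X) (W p)"
      by (rule killing_skew[OF K vfield_tangent[OF W] LC_tangent[OF Z Yt]])
    ultimately show ?thesis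
      unfolding S_def
      by (simp add: metric_diff LC_tangent f X Y Z W Yt vfield_tangent)
  qed
  have ricci: "g p (S Y Z) (W p) = g p (S Z Y) (W p) + g p (curv Y Z X p) (W p)"
    if Y: "vfield p Y" and Z: "vfield p Z" and W: "vfield p W" for Y Z W
  proof -
    \<comment> \<open>By torsion-freeness the two correction terms differ by the derivative of
      \<open>X\<close> along the bracket, which is the one that the curvature subtracts.\<close>
    have "S Y Z = S Z Y + curv Y Z X p"
      using LC.conn_dir_diff[OF X LC_tangent[OF Z vfield_tangent[OF Y]] LC_tangent[OF Y vfield_tangent[OF Z]]]
        torsion_free[OF Y Z]
      unfolding S_def curv_def by simp
    then show ?thesis
      using metric_add[OF ST[OF Z Y] curv_tangent[OF Y Z X] vfield_tangent[OF W]] by simp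
  qed
  have "g p (S Y Z) w = g p (- curv X Y Z p) w" if w: "w \<in> TS p" for w
  proof -
    obtain W where W: "vfield p W" "W p = w" by (rule exists_local_field[OF w])
    note W' = W(1)
    have b: "g p (curv X W Y p) (Z p) + g p (curv W Y X p) (Z p) + g p (curv Y X W p) (Z p) = 0"
    proof -
      note T = curv_tangent[OF X W' Y] curv_tangent[OF W' Y X] curv_tangent[OF Y X W'] vfield_tangent[OF Z]
      have "g p (curv X W Y p + curv W Y X p + curv Y X W p) (Z p) = 0"
        unfolding Bianchi[OF X W' Y] by (rule metric_0[OF T(4)])
      then show ?thesis by (simp add: metric_add T tangent_closed)
    qed
    have a: "g p (curv Y X W p) (Z p) = - g p (curv X Y W p) (Z p)"
      unfolding curv_antisym[OF X Y W'] by (rule metric_minus[OF curv_tangent[OF X Y W'] vfield_tangent[OF Z]])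
    \<comment> \<open>Going once around the permutations returns to the starting term with the
      opposite sign, so twice the left-hand side is a sum of three curvature terms; pair symmetry
      and the Bianchi identity \<open>b\<close> merge these into one.\<close>
    have "g p (S Y Z) (W p) = - g p (curv X Y Z p) (W p)"
      using skew[OF Y Z W'] skew[OF Z W' Y] skew[OF W' Y Z] ricci[OF Y Z W'] ricci[OF Z W' Y] ricci[OF W' Y Z]
        skew[OF Z Y W'] skew[OF W' Z Y] skew[OF Y W' Z]
        curv_pair_sym[OF Y Z X W'] curv_pair_sym[OF Z W' X Y] a b curv_metric_skew[OF X Y Z W']
      by linarith
    then show ?thesis
      using metric_minus[OF curv_tangent[OF X Y Z] w] W(2) by simp
  qed
  from metric_nondegenerate[OF ST[OF Y Z] tangent_closed(4)[OF curv_tangent[OF X Y Z]] this]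
  show ?thesis unfolding S_def .
qed

end

subsection \<open>The vector field dual to a one-form\<close>

context riemannian
begin

text \<open>Converts the curvature produced by Kostant's formula, where \<open>X\<close> sits in the
  first slot, into that of the tension field, where \<open>X\<close> is the vector paired with the
  result.\<close>

lemma curvature_swap:
  assumes "u \<in> TS p" "v \<in> TS p" "w \<in> TS p" "z \<in> TS p"
  shows "g p (R p u v w) z = g p u (R p z w v)"
proof -
  have "g p (R p u v w) z = - g p (R p w z v) u"
    using curvature_pair_sym[OF assms] curvature_skew[OF assms(3,4,1,2)] by simp
  also have "\<dots> = g p (R p z w v) u"
    using curvature_antisym[OF assms(3,4,2,1)] metric_minus[OF curvature_tangent[OF assms(3,4,2)] assms(1)]
    by simp
  finally show ?thesis
    using metric_sym[OF curvature_tangent[OF assms(4,3,2)] assms(1)] by simp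
qed

text \<open>The sum over a frame that defines the dual vector is taken with a frame depending on the
  point. Since duality determines the vector, it agrees near \<open>p\<close> with the sum over one
  fixed frame, and that sum is smooth.\<close>

lemma exists_dual_field:
  assumes lin: "\<And>p u v r t. u \<in> TS p \<Longrightarrow> v \<in> TS p \<Longrightarrow> \<omega> p (r *\<^sub>R u + t *\<^sub>R v) = r * \<omega> p u + t * \<omega> p v"
    and smooth: "\<And>p E. vfield p E \<Longrightarrow> smooth_at A p (\<lambda>q. \<omega> q (E q) :: real)"
  obtains J where "vector_field A J" "\<forall>p. \<forall>u\<in>TS p. g p (J p) u = \<omega> p u"
proof -
  have lin_sum: "\<omega> p (\<Sum>i\<in>I. r i *\<^sub>R u i) = (\<Sum>i\<in>I. r i * \<omega> p (u i))"
    if "finite I" "\<And>i. i \<in> I \<Longrightarrow> u i \<in> TS p" for I :: "'a set" and r u p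
    using that
  proof (induction I)
    case empty
    have "\<omega> p 0 = 0" using lin[OF tangent_closed(1) tangent_closed(1), of p 0 0] by simp
    then show ?case by (simp only: sum.empty)
  next
    case (insert i I)
    have "\<omega> p (r i *\<^sub>R u i + 1 *\<^sub>R (\<Sum>i\<in>I. r i *\<^sub>R u i)) = r i * \<omega> p (u i) + 1 * \<omega> p (\<Sum>i\<in>I. r i *\<^sub>R u i)"
      using insert by (intro lin tangent_closed) auto
    moreover have "\<omega> p (\<Sum>i\<in>I. r i *\<^sub>R u i) = (\<Sum>i\<in>I. r i * \<omega> p (u i))"
      by (rule insert.IH) (use insert.prems in auto)
    ultimately show ?case unfolding sum.insert[OF insert.hyps] by (simp add: plus_fun_def)
  qed
  define J where "J e p = (\<Sum>i\<in>Basis. \<omega> p (e i p) *\<^sub>R e i p)" for e :: "'a \<Rightarrow> 'm \<Rightarrow> 'm tvec" and p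
  have JT: "J e p \<in> TS p" if "onframe p e" for e p
    unfolding J_def using that by (intro tangent_closed frame_tangent)
  have dual: "g p (J e p) u = \<omega> p u" if e: "onframe p e" and u: "u \<in> TS p" for e p u
  proof -
    have "g p (J e p) u = (\<Sum>i\<in>Basis. g p u (e i p) * \<omega> p (e i p))"
      unfolding J_def
      by (subst metric_sum[OF u])
        (auto intro!: sum.cong tangent_closed simp: frame_tangent[OF e] metric_scaleR u metric_sym[OF u])
    also have "\<dots> = \<omega> p (\<Sum>i\<in>Basis. g p u (e i p) *\<^sub>R e i p)"
      by (rule lin_sum[symmetric]) (auto intro: frame_tangent[OF e])
    finally show ?thesis using frame_expansion[OF e u] by simp
  qed
  let ?J = "\<lambda>p. J (some_frame p) p"
  have "vfield p ?J" for p
  proof (rule id.section_cong)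
    let ?e = "some_frame p"
    show "vfield p (J ?e)"
      unfolding J_def
      by (intro id.section_sum id.section_scaleR smooth frame_vfield onframe_some_frame)
    show "\<forall>\<^sub>F q in nhds p. J ?e q = ?J q"
      using eventually_frame[OF onframe_some_frame[of p]]
    proof eventually_elim
      case (elim q)
      show ?case
        by (rule metric_nondegenerate[OF JT[OF elim] JT[OF onframe_some_frame]])
          (simp add: dual elim onframe_some_frame)
    qed
  qed
  then have "vector_field A ?J" by (simp add: vector_field_def)
  then show ?thesis by (rule that) (simp add: dual onframe_some_frame)
qed

text \<open>The difference \<open>J - J'\<close> is itself an admissible test field, and the metric
  is positive definite.\<close>

lemma dual_field_unique:
  assumes J: "vector_field A J" and J': "vector_field A J'"
    and eq: "\<And>U p. vector_field A U \<Longrightarrow> g p (J p) (U p) = g p (J' p) (U p)"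
  shows "J = J'"
proof
  fix p
  have f: "vfield p J" "vfield p J'" for p using J J' by (auto simp: vector_field_def)
  have "vector_field A (\<lambda>q. J q - J' q)"
    unfolding vector_field_def using id.section_diff[OF f] by blast
  from eq[OF this, of p] have "g p (J p - J' p) (J p - J' p) = 0"
    using metric_diff[OF vfield_tangent[OF f(1)] vfield_tangent[OF f(2)]
        tangent_closed(3)[OF vfield_tangent[OF f(1)] vfield_tangent[OF f(2)]]] by simp
  then show "J p = J' p"
    using metric_pos[OF tangent_closed(3)[OF vfield_tangent[OF f(1)] vfield_tangent[OF f(2)]], of p] by fastforce
qed

end


subsection \<open>Calculus along a map of Riemannian manifolds\<close>

locale riemannian_map = M: riemannian A g D + N: riemannian B h DN + smooth_mapping A B \<phi>
  for A :: "('m::{t2_space, second_countable_topology}, 'a::euclidean_space) atlas"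
    and g :: "'m \<Rightarrow> 'm tvec \<Rightarrow> 'm tvec \<Rightarrow> real" and D :: "('m, 'm) conn"
    and B :: "('n::{t2_space, second_countable_topology}, 'b::euclidean_space) atlas"
    and h :: "'n \<Rightarrow> 'n tvec \<Rightarrow> 'n tvec \<Rightarrow> real" and DN :: "('n, 'n) conn"
    and \<phi> :: "'m \<Rightarrow> 'n" +
  fixes Db :: "('m, 'n) conn"
  assumes pullback: "pullback_connection A B DN \<phi> Db"
begin

sublocale connection A B \<phi> Db
  using pullback by unfold_locales (simp add: pullback_connection_def)

lemma Db_field:
  "N.vfield (\<phi> p) Y \<Longrightarrow> v \<in> M.TS p \<Longrightarrow> Db p v (\<lambda>q. Y (\<phi> q)) = DN (\<phi> p) (pushforward B \<phi> p v) Y"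
  using pullback by (simp add: pullback_connection_def)

abbreviation TN :: "'m \<Rightarrow> 'n tvec set"
  where "TN p \<equiv> N.TS (\<phi> p)"

abbreviation d\<phi> :: "'m \<Rightarrow> 'm tvec \<Rightarrow> 'n tvec"
  where "d\<phi> \<equiv> pushforward B \<phi>"

abbreviation inner_h :: "'m \<Rightarrow> 'n tvec \<Rightarrow> 'n tvec \<Rightarrow> real"
  where "inner_h p \<equiv> h (\<phi> p)"

lemma sect_tangent: "sect p W \<Longrightarrow> W p \<in> TN p"
  by (rule section_tangent)

lemma Db_tangent: "sect p W \<Longrightarrow> v \<in> M.TS p \<Longrightarrow> Db p v W \<in> TN p"
  by (rule conn_tangent)

lemma Db_section: "sect p W \<Longrightarrow> M.vfield p E \<Longrightarrow> sect p (\<lambda>q. Db q (E q) W)"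
  by (rule conn_section)

text \<open>Smoothness of \<open>h\<close> is given for fields on the target only, so both sections
  are expanded in fields pulled back from there.\<close>

lemma inner_h_smooth:
  assumes W: "sect p W" and Z: "sect p Z"
  shows "smooth_at A p (\<lambda>q. inner_h q (W q) (Z q))"
proof -
  obtain w and E :: "'b \<Rightarrow> 'n \<Rightarrow> 'n tvec" where w: "\<forall>i. smooth_at A p (w i)" "\<forall>i. N.vfield (\<phi> p) (E i)"
    "\<forall>\<^sub>F q in nhds p. W q = (\<Sum>i\<in>Basis. w i q *\<^sub>R E i (\<phi> q))" "W p = 0 \<longrightarrow> (\<forall>i. w i p = 0)"
    using section_frame[OF W] .
  obtain z and F :: "'b \<Rightarrow> 'n \<Rightarrow> 'n tvec" where z: "\<forall>i. smooth_at A p (z i)" "\<forall>i. N.vfield (\<phi> p) (F i)"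
    "\<forall>\<^sub>F q in nhds p. Z q = (\<Sum>i\<in>Basis. z i q *\<^sub>R F i (\<phi> q))" "Z p = 0 \<longrightarrow> (\<forall>i. z i p = 0)"
    using section_frame[OF Z] .
  have TE: "\<forall>\<^sub>F q in nhds p. \<forall>i\<in>Basis. E i (\<phi> q) \<in> TN q"
    using w(2) by (intro eventually_ball_finite finite_Basis ballI eventually_map N.vfield_tangent_ev) auto
  have TF: "\<forall>\<^sub>F q in nhds p. \<forall>i\<in>Basis. F i (\<phi> q) \<in> TN q"
    using z(2) by (intro eventually_ball_finite finite_Basis ballI eventually_map N.vfield_tangent_ev) auto
  have hs: "smooth_at A p (\<lambda>q. inner_h q (F j (\<phi> q)) (E i (\<phi> q)))" for i j
    by (rule smooth_at_map[of p "\<lambda>y. h y (F j y) (E i y)"])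
      (rule N.metric_smooth[OF spec[OF z(2)] spec[OF w(2)]])
  have "smooth_at A p (\<lambda>q. \<Sum>i\<in>Basis. w i q * (\<Sum>j\<in>Basis. z j q * inner_h q (F j (\<phi> q)) (E i (\<phi> q))))"
    by (rule M.smooth_at_sum, rule M.smooth_at_mult[OF spec[OF w(1)]],
        rule M.smooth_at_sum, rule M.smooth_at_mult[OF spec[OF z(1)] hs])
  then show ?thesis
  proof (rule M.smooth_at_cong)
    show "\<forall>\<^sub>F q in nhds p. (\<Sum>i\<in>Basis. w i q * (\<Sum>j\<in>Basis. z j q * inner_h q (F j (\<phi> q)) (E i (\<phi> q))))
        = inner_h q (W q) (Z q)"
      using w(3) z(3) TE TF section_tangent_ev[OF Z]
    proof eventually_elim
      case (elim q)
      have 1: "inner_h q (E i (\<phi> q)) (Z q) = (\<Sum>j\<in>Basis. z j q * inner_h q (F j (\<phi> q)) (E i (\<phi> q)))"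
        if i: "i \<in> Basis" for i
      proof -
        have Ei: "E i (\<phi> q) \<in> TN q" using elim i by blast
        have "inner_h q (E i (\<phi> q)) (Z q) = inner_h q (Z q) (E i (\<phi> q))"
          by (rule N.metric_sym[OF Ei elim(5)])
        also have "\<dots> = (\<Sum>j\<in>Basis. z j q * inner_h q (F j (\<phi> q)) (E i (\<phi> q)))"
          unfolding elim(2) using elim(4)
          by (subst N.metric_sum[OF Ei]) (auto intro!: sum.cong N.tangent_closed simp: N.metric_scaleR Ei)
        finally show ?thesis .
      qed
      have "inner_h q (W q) (Z q) = (\<Sum>i\<in>Basis. w i q * inner_h q (E i (\<phi> q)) (Z q))"
        unfolding elim(1) using elim(3)
        by (subst N.metric_sum[OF elim(5)])
          (auto intro!: sum.cong N.tangent_closed simp: N.metric_scaleR elim(5))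
      then show ?case using 1 by simp
    qed
  qed
qed

text \<open>The defect \<open>Q\<close> is symmetric and tensorial, so both sections may be replaced
  by pulled-back fields with the same values at \<open>p\<close>. For those the claim is metric
  compatibility on the target along the pushed-forward vector.\<close>

lemma inner_h_compatible:
  assumes v: "v \<in> M.TS p" and W: "sect p W" and Z: "sect p Z"
  shows "v (\<lambda>q. inner_h q (W q) (Z q)) = inner_h p (Db p v W) (Z p) + inner_h p (W p) (Db p v Z)"
proof -
  define Q where "Q W Z = v (\<lambda>q. inner_h q (W q) (Z q)) - (inner_h p (Db p v W) (Z p) + inner_h p (W p) (Db p v Z))"
    for W Z
  have Q_sym: "Q W Z = Q Z W" if W: "sect p W" and Z: "sect p Z" for W Z
  proof -
    have "v (\<lambda>q. inner_h q (W q) (Z q)) = v (\<lambda>q. inner_h q (Z q) (W q))"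
      by (rule M.tangent_cong[OF v])
        (use section_tangent_ev[OF W] section_tangent_ev[OF Z] in eventually_elim, rule N.metric_sym)
    then show ?thesis
      unfolding Q_def
      using N.metric_sym[OF Db_tangent[OF W v] sect_tangent[OF Z]]
        N.metric_sym[OF Db_tangent[OF Z v] sect_tangent[OF W]] by simp
  qed
  have tens: "tensorial_at p (\<lambda>W. Q W Z)" if Z: "sect p Z" for Z
    unfolding tensorial_at_def
  proof (intro conjI allI impI)
    note Zt = sect_tangent[OF Z] Db_tangent[OF Z v]
    fix W W' assume W: "sect p W" and W': "sect p W'"
    have "v (\<lambda>q. inner_h q (W q + W' q) (Z q)) = v (\<lambda>q. inner_h q (W q) (Z q) + inner_h q (W' q) (Z q))"
      by (rule M.tangent_cong[OF v])
        (use section_tangent_ev[OF W] section_tangent_ev[OF W'] section_tangent_ev[OF Z] in eventually_elim,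
          rule N.metric_add)
    also have "\<dots> = v (\<lambda>q. inner_h q (W q) (Z q)) + v (\<lambda>q. inner_h q (W' q) (Z q))"
      by (rule M.tangent_add[OF v inner_h_smooth[OF W Z] inner_h_smooth[OF W' Z]])
    finally show "Q (\<lambda>q. W q + W' q) Z = Q W Z + Q W' Z"
      unfolding Q_def conn_add[OF W W' v]
      using N.metric_add[OF sect_tangent[OF W] sect_tangent[OF W'] Zt(2)]
        N.metric_add[OF Db_tangent[OF W v] Db_tangent[OF W' v] Zt(1)] by simp
  next
    note Zt = sect_tangent[OF Z] Db_tangent[OF Z v]
    fix W and f :: "'m \<Rightarrow> real" assume W: "sect p W" and f: "smooth_at A p f"
    note Wt = sect_tangent[OF W] Db_tangent[OF W v]
    have "v (\<lambda>q. inner_h q (f q *\<^sub>R W q) (Z q)) = v (\<lambda>q. f q * inner_h q (W q) (Z q))"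
      by (rule M.tangent_cong[OF v])
        (use section_tangent_ev[OF W] section_tangent_ev[OF Z] in eventually_elim, rule N.metric_scaleR)
    also have "\<dots> = v f * inner_h p (W p) (Z p) + f p * v (\<lambda>q. inner_h q (W q) (Z q))"
      by (rule M.tangent_mult[OF v f inner_h_smooth[OF W Z]])
    finally show "Q (\<lambda>q. f q *\<^sub>R W q) Z = f p *\<^sub>R Q W Z"
      unfolding Q_def conn_leibniz[OF W f v] N.metric_linear[OF Wt Zt(1)] N.metric_scaleR[OF Wt(1) Zt(2)]
      by (simp add: algebra_simps)
  qed
  obtain Y where Y: "N.vfield (\<phi> p) Y" "Y (\<phi> p) = W p"
    by (rule N.exists_local_field[OF sect_tangent[OF W]])
  obtain Y' where Y': "N.vfield (\<phi> p) Y'" "Y' (\<phi> p) = Z p"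
    by (rule N.exists_local_field[OF sect_tangent[OF Z]])
  let ?W = "\<lambda>q. Y (\<phi> q)" and ?Z = "\<lambda>q. Y' (\<phi> q)"
  note s = section_of_field[OF Y(1)] section_of_field[OF Y'(1)]
  have "Q W Z = Q ?W Z" by (rule tensorial_point[OF tens[OF Z] W s(1)]) (simp add: Y)
  also have "\<dots> = Q Z ?W" by (rule Q_sym[OF s(1) Z])
  also have "\<dots> = Q ?Z ?W" by (rule tensorial_point[OF tens[OF s(1)] Z s(2)]) (simp add: Y')
  also have "\<dots> = 0"
  proof -
    have "v (\<lambda>q. inner_h q (Y' (\<phi> q)) (Y (\<phi> q))) = d\<phi> p v (\<lambda>y. h y (Y' y) (Y y))"
      by (rule pushforward_apply[symmetric, OF N.metric_smooth[OF Y'(1) Y(1)]])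
    then show ?thesis
      unfolding Q_def Db_field[OF Y(1) v] Db_field[OF Y'(1) v]
      using N.metric_compatible[OF Y'(1) Y(1) pushforward_tangent[OF v]] by simp
  qed
  finally show ?thesis by (simp add: Q_def)
qed

text \<open>Polarised to two fields, the summand is the second covariant derivative of
  \<open>W\<close>. The correction term makes it tensorial in the second field too, so any frame may
  be used.\<close>

lemma rough_laplacian_eq:
  assumes e: "M.onframe p e" and W: "sect p W"
  shows "rough_laplacian A g D Db W p =
    - (\<Sum>i\<in>Basis. Db p (e i p) (\<lambda>q. Db q (e i q) W) - Db p (D p (e i p) (e i)) W)"
proof -
  let ?H = "\<lambda>E E'. Db p (E p) (\<lambda>q. Db q (E' q) W) - Db p (D p (E p) E') W"
  have "frame_trace A g p (\<lambda>E. ?H E E) = (\<Sum>i\<in>Basis. ?H (e i) (e i))"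
  proof (rule M.frame_trace_eq[where H = ?H, OF e])
    fix E assume E: "M.vfield p E"
    note Et = M.vfield_tangent[OF E]
    show "M.id.tensorial_at p (\<lambda>E'. ?H E' E)"
      unfolding M.id.tensorial_at_def
    proof (intro conjI allI impI)
      fix F F' assume F: "M.vfield p F" and F': "M.vfield p F'"
      note t = M.vfield_tangent[OF F] M.vfield_tangent[OF F']
      show "?H (\<lambda>q. F q + F' q) E = ?H F E + ?H F' E"
        using conn_dir_add[OF Db_section[OF W E] t] M.LC.conn_dir_add[OF E t]
          conn_dir_add[OF W M.LC_tangent[OF E t(1)] M.LC_tangent[OF E t(2)]] by simp
    next
      fix F and f :: "'m \<Rightarrow> real" assume F: "M.vfield p F" and f: "smooth_at A p f"
      note t = M.vfield_tangent[OF F]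
      show "?H (\<lambda>q. f q *\<^sub>R F q) E = f p *\<^sub>R ?H F E"
        using conn_dir_scaleR[OF Db_section[OF W E] t] M.LC.conn_dir_scaleR[OF E t]
          conn_dir_scaleR[OF W M.LC_tangent[OF E t]] by (simp add: scaleR_diff_right)
    qed
    show "M.id.tensorial_at p (?H E)"
      unfolding M.id.tensorial_at_def
    proof (intro conjI allI impI)
      fix F F' assume F: "M.vfield p F" and F': "M.vfield p F'"
      show "?H E (\<lambda>q. F q + F' q) = ?H E F + ?H E F'"
        using conn2_dir_add[OF W F F' Et] M.LC.conn_add[OF F F' Et]
          conn_dir_add[OF W M.LC_tangent[OF F Et] M.LC_tangent[OF F' Et]] by simp
    next
      fix F and f :: "'m \<Rightarrow> real" assume F: "M.vfield p F" and f: "smooth_at A p f"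
      show "?H E (\<lambda>q. f q *\<^sub>R F q) = f p *\<^sub>R ?H E F"
        using conn2_dir_scaleR[OF W F f Et] M.LC.conn_leibniz[OF F f Et]
          conn_linear[OF W M.vfield_tangent[OF F] M.LC_tangent[OF F Et], of "E p f" "f p"]
        by (simp add: scaleR_diff_right)
    qed
  qed
  then show ?thesis unfolding rough_laplacian_def by simp
qed

text \<open>One frame defined near \<open>p\<close> replaces the frames chosen separately at each
  point, and the resulting expression is visibly a smooth section.\<close>

lemma rough_laplacian_section:
  assumes W: "sect p W" shows "sect p (rough_laplacian A g D Db W)"
proof -
  note e = M.onframe_some_frame[of p]
  let ?e = "M.some_frame p"
  let ?L = "\<lambda>q. - (\<Sum>i\<in>Basis. Db q (?e i q) (\<lambda>r. Db r (?e i r) W) - Db q (D q (?e i q) (?e i)) W)"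
  have "sect p ?L"
  proof (rule section_minus, rule section_sum)
    fix i :: 'a assume "i \<in> Basis"
    note f = M.frame_vfield[OF e this]
    show "sect p (\<lambda>q. Db q (?e i q) (\<lambda>r. Db r (?e i r) W) - Db q (D q (?e i q) (?e i)) W)"
      by (rule section_diff[OF Db_section[OF Db_section[OF W f] f] Db_section[OF W M.LC_field[OF f f]]])
  qed
  moreover have "\<forall>\<^sub>F q in nhds p. ?L q = rough_laplacian A g D Db W q"
    using M.eventually_frame[OF e] eventually_section[OF W]
    by eventually_elim (rule rough_laplacian_eq[symmetric])
  ultimately show ?thesis by (rule section_cong)
qed

text \<open>The polarised summand is the second fundamental form of the map, tensorial in both
  fields.\<close>

lemma tension_eq:
  assumes e: "M.onframe p e"
  shows "tension A g D B \<phi> Db p =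
    (\<Sum>i\<in>Basis. Db p (e i p) (\<lambda>q. d\<phi> q (e i q)) - d\<phi> p (D p (e i p) (e i)))"
proof -
  let ?H = "\<lambda>E E'. Db p (E p) (\<lambda>q. d\<phi> q (E' q)) - d\<phi> p (D p (E p) E')"
  have "frame_trace A g p (\<lambda>E. ?H E E) = (\<Sum>i\<in>Basis. ?H (e i) (e i))"
  proof (rule M.frame_trace_eq[where H = ?H, OF e])
    fix E assume E: "M.vfield p E"
    note Et = M.vfield_tangent[OF E]
    show "M.id.tensorial_at p (\<lambda>E'. ?H E' E)"
      unfolding M.id.tensorial_at_def
    proof (intro conjI allI impI)
      fix F F' assume F: "M.vfield p F" and F': "M.vfield p F'"
      note t = M.vfield_tangent[OF F] M.vfield_tangent[OF F']
      show "?H (\<lambda>q. F q + F' q) E = ?H F E + ?H F' E"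
        using conn_dir_add[OF section_pushforward[OF E] t] M.LC.conn_dir_add[OF E t]
        by (simp add: pushforward_add)
    next
      fix F and f :: "'m \<Rightarrow> real" assume F: "M.vfield p F" and f: "smooth_at A p f"
      note t = M.vfield_tangent[OF F]
      show "?H (\<lambda>q. f q *\<^sub>R F q) E = f p *\<^sub>R ?H F E"
        using conn_dir_scaleR[OF section_pushforward[OF E] t] M.LC.conn_dir_scaleR[OF E t]
        by (simp add: pushforward_scaleR scaleR_diff_right)
    qed
    show "M.id.tensorial_at p (?H E)"
      unfolding M.id.tensorial_at_def
    proof (intro conjI allI impI)
      fix F F' assume F: "M.vfield p F" and F': "M.vfield p F'"
      show "?H E (\<lambda>q. F q + F' q) = ?H E F + ?H E F'"
        using conn_add[OF section_pushforward[OF F] section_pushforward[OF F'] Et] M.LC.conn_add[OF F F' Et]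
        by (simp add: pushforward_add)
    next
      fix F and f :: "'m \<Rightarrow> real" assume F: "M.vfield p F" and f: "smooth_at A p f"
      show "?H E (\<lambda>q. f q *\<^sub>R F q) = f p *\<^sub>R ?H E F"
        using conn_leibniz[OF section_pushforward[OF F] f Et] M.LC.conn_leibniz[OF F f Et]
        by (simp add: pushforward_add pushforward_scaleR scaleR_diff_right)
    qed
  qed
  then show ?thesis unfolding tension_def by simp
qed

lemma tension_section: "sect p (tension A g D B \<phi> Db)"
proof -
  note e = M.onframe_some_frame[of p]
  let ?e = "M.some_frame p"
  let ?L = "\<lambda>q. \<Sum>i\<in>Basis. Db q (?e i q) (\<lambda>r. d\<phi> r (?e i r)) - d\<phi> q (D q (?e i q) (?e i))"
  have "sect p ?L"
  proof (rule section_sum)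
    fix i :: 'a assume "i \<in> Basis"
    note f = M.frame_vfield[OF e this]
    show "sect p (\<lambda>q. Db q (?e i q) (\<lambda>r. d\<phi> r (?e i r)) - d\<phi> q (D q (?e i q) (?e i)))"
      by (rule section_diff[OF Db_section[OF section_pushforward[OF f] f]
            section_pushforward[OF M.LC_field[OF f f]]])
  qed
  moreover have "\<forall>\<^sub>F q in nhds p. ?L q = tension A g D B \<phi> Db q"
    using M.eventually_frame[OF e] by eventually_elim (rule tension_eq[symmetric])
  ultimately show ?thesis by (rule section_cong)
qed

abbreviation T :: "nat \<Rightarrow> 'm \<Rightarrow> 'n tvec"
  where "T \<equiv> laplacian_tension A g D B \<phi> Db"

lemma T_section: "sect p (T k)"
proof (induction k arbitrary: p)
  case 0
  then show ?case by (simp add: laplacian_tension_def tension_section)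
next
  case (Suc k)
  then show ?case using rough_laplacian_section by (simp add: laplacian_tension_def)
qed

lemma T_Suc: "T (Suc k) = rough_laplacian A g D Db (T k)"
  by (simp add: laplacian_tension_def)

text \<open>The trace of the covariant derivative of a one-form, which permits splitting the current
  into pieces without naming the field dual to each. It uses the frame that
  \<open>frame_trace\<close> chooses, so the comparison with \<open>divergence\<close> is term by
  term.\<close>

definition div_form :: "('m \<Rightarrow> 'm tvec \<Rightarrow> real) \<Rightarrow> 'm \<Rightarrow> real"
  where "div_form \<omega> p = (let e = M.some_frame p in
    \<Sum>i\<in>Basis. e i p (\<lambda>q. \<omega> q (e i q)) - \<omega> p (D p (e i p) (e i)))"

lemma divergence_eq_div_form:
  assumes J: "vector_field A J" and dual: "\<And>p u. u \<in> M.TS p \<Longrightarrow> g p (J p) u = \<omega> p u"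
  shows "divergence A g D J p = div_form \<omega> p"
  unfolding divergence_def M.frame_trace_some_frame div_form_def Let_def
proof (rule sum.cong[OF refl])
  fix i :: 'a assume "i \<in> Basis"
  let ?E = "M.some_frame p i"
  have E: "M.vfield p ?E" by (rule M.frame_vfield[OF M.onframe_some_frame \<open>i \<in> Basis\<close>])
  note Et = M.vfield_tangent[OF E]
  have J': "M.vfield p J" using J by (simp add: vector_field_def)
  have "?E p (\<lambda>q. \<omega> q (?E q)) = ?E p (\<lambda>q. g q (J q) (?E q))"
    by (rule M.tangent_cong[OF Et]) (use M.vfield_tangent_ev[OF E] in eventually_elim, simp add: dual)
  also have "\<dots> = g p (D p (?E p) J) (?E p) + g p (J p) (D p (?E p) ?E)"
    by (rule M.metric_compatible[OF J' E Et])
  finally show "g p (D p (?E p) J) (?E p) = ?E p (\<lambda>q. \<omega> q (?E q)) - \<omega> p (D p (?E p) ?E)"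
    using dual[OF M.LC_tangent[OF E Et]] by simp
qed

section \<open>Linearity of the divergence on smooth one-forms\<close>

definition smooth_form :: "('m \<Rightarrow> 'm tvec \<Rightarrow> real) \<Rightarrow> bool"
  where "smooth_form \<omega> \<longleftrightarrow> (\<forall>p E. M.vfield p E \<longrightarrow> smooth_at A p (\<lambda>q. \<omega> q (E q)))"

lemma smooth_formI: "(\<And>p E. M.vfield p E \<Longrightarrow> smooth_at A p (\<lambda>q. \<omega> q (E q))) \<Longrightarrow> smooth_form \<omega>"
  by (simp add: smooth_form_def)

lemma smooth_formD: "smooth_form \<omega> \<Longrightarrow> M.vfield p E \<Longrightarrow> smooth_at A p (\<lambda>q. \<omega> q (E q))"
  by (simp add: smooth_form_def)

lemma smooth_form_add:
  assumes "smooth_form \<omega>" "smooth_form \<omega>'" shows "smooth_form (\<lambda>q u. \<omega> q u + \<omega>' q u)"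
proof (rule smooth_formI)
  fix p E assume E: "M.vfield p E"
  show "smooth_at A p (\<lambda>q. \<omega> q (E q) + \<omega>' q (E q))"
    by (rule M.smooth_at_add[OF smooth_formD[OF assms(1) E] smooth_formD[OF assms(2) E]])
qed

lemma smooth_form_diff:
  assumes "smooth_form \<omega>" "smooth_form \<omega>'" shows "smooth_form (\<lambda>q u. \<omega> q u - \<omega>' q u)"
proof (rule smooth_formI)
  fix p E assume E: "M.vfield p E"
  show "smooth_at A p (\<lambda>q. \<omega> q (E q) - \<omega>' q (E q))"
    by (rule M.smooth_at_diff[OF smooth_formD[OF assms(1) E] smooth_formD[OF assms(2) E]])
qed

lemma smooth_form_sum:
  assumes "\<And>l. smooth_form (\<omega> l)" shows "smooth_form (\<lambda>q u. \<Sum>l\<in>I. \<omega> l q u)"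
proof (rule smooth_formI)
  fix p E assume E: "M.vfield p E"
  show "smooth_at A p (\<lambda>q. \<Sum>l\<in>I. \<omega> l q (E q))"
    by (rule M.smooth_at_sum) (rule smooth_formD[OF assms E])
qed

lemma
  assumes \<omega>: "smooth_form \<omega>" and \<omega>': "smooth_form \<omega>'"
  shows div_form_add: "div_form (\<lambda>q u. \<omega> q u + \<omega>' q u) p = div_form \<omega> p + div_form \<omega>' p"
    and div_form_diff: "div_form (\<lambda>q u. \<omega> q u - \<omega>' q u) p = div_form \<omega> p - div_form \<omega>' p"
proof -
  let ?e = "M.some_frame p"
  have *: "?e i p (\<lambda>q. \<omega> q (?e i q) + \<omega>' q (?e i q)) = ?e i p (\<lambda>q. \<omega> q (?e i q)) + ?e i p (\<lambda>q. \<omega>' q (?e i q))"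
    "?e i p (\<lambda>q. \<omega> q (?e i q) - \<omega>' q (?e i q)) = ?e i p (\<lambda>q. \<omega> q (?e i q)) - ?e i p (\<lambda>q. \<omega>' q (?e i q))"
    if "i \<in> Basis" for i
  proof -
    have E: "M.vfield p (?e i)" by (rule M.frame_vfield[OF M.onframe_some_frame that])
    show "?e i p (\<lambda>q. \<omega> q (?e i q) + \<omega>' q (?e i q)) = ?e i p (\<lambda>q. \<omega> q (?e i q)) + ?e i p (\<lambda>q. \<omega>' q (?e i q))"
      by (rule M.tangent_add[OF M.vfield_tangent[OF E] smooth_formD[OF \<omega> E] smooth_formD[OF \<omega>' E]])
    show "?e i p (\<lambda>q. \<omega> q (?e i q) - \<omega>' q (?e i q)) = ?e i p (\<lambda>q. \<omega> q (?e i q)) - ?e i p (\<lambda>q. \<omega>' q (?e i q))"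
      by (rule M.tangent_diff[OF M.vfield_tangent[OF E] smooth_formD[OF \<omega> E] smooth_formD[OF \<omega>' E]])
  qed
  show "div_form (\<lambda>q u. \<omega> q u + \<omega>' q u) p = div_form \<omega> p + div_form \<omega>' p"
    "div_form (\<lambda>q u. \<omega> q u - \<omega>' q u) p = div_form \<omega> p - div_form \<omega>' p"
    unfolding div_form_def Let_def by (simp_all add: * sum.distrib sum_subtractf)
qed

lemma div_form_sum:
  assumes \<omega>: "\<And>l. smooth_form (\<omega> l)"
  shows "div_form (\<lambda>q u. \<Sum>l\<in>I. \<omega> l q u) p = (\<Sum>l\<in>I. div_form (\<omega> l) p)"
proof (induction I rule: infinite_finite_induct)
  case (insert l I)
  have "div_form (\<lambda>q u. \<omega> l q u + (\<Sum>l\<in>I. \<omega> l q u)) p = div_form (\<omega> l) p + div_form (\<lambda>q u. \<Sum>l\<in>I. \<omega> l q u) p"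
    by (rule div_form_add[OF \<omega> smooth_form_sum[OF \<omega>]])
  then show ?case using insert by simp
qed (simp_all add: div_form_def Let_def M.tangent_zero_fun[OF M.frame_tangent[OF M.onframe_some_frame]])

definition \<sigma> :: "('m \<Rightarrow> 'n tvec) \<Rightarrow> ('m \<Rightarrow> 'n tvec) \<Rightarrow> 'm \<Rightarrow> 'm tvec \<Rightarrow> real"
  where "\<sigma> W Z p u = inner_h p (Db p u W) (Z p)"

lemma \<sigma>_linear:
  assumes "sect p W" "sect p Z" "u \<in> M.TS p" "v \<in> M.TS p"
  shows "\<sigma> W Z p (r *\<^sub>R u + t *\<^sub>R v) = r * \<sigma> W Z p u + t * \<sigma> W Z p v"
  unfolding \<sigma>_def conn_linear[OF assms(1,3,4)]
  by (rule N.metric_linear[OF Db_tangent[OF assms(1,3)] Db_tangent[OF assms(1,4)] sect_tangent[OF assms(2)]])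

lemma smooth_form_\<sigma>:
  assumes "\<And>q. sect q W" "\<And>q. sect q Z" shows "smooth_form (\<sigma> W Z)"
proof (rule smooth_formI)
  fix p E assume E: "M.vfield p E"
  show "smooth_at A p (\<lambda>q. \<sigma> W Z q (E q))"
    unfolding \<sigma>_def by (rule inner_h_smooth[OF Db_section[OF assms(1) E] assms(2)])
qed

text \<open>Metric compatibility applied to the derivative of \<open>W\<close> paired with
  \<open>Z\<close>: the second derivatives of \<open>W\<close> combine with the correction terms to
  minus the rough Laplacian, by its sign convention.\<close>

lemma div_form_\<sigma>:
  assumes W: "sect p W" and Z: "sect p Z"
  shows "div_form (\<sigma> W Z) p = - inner_h p (rough_laplacian A g D Db W p) (Z p)
    + (\<Sum>i\<in>Basis. inner_h p (Db p (M.some_frame p i p) W) (Db p (M.some_frame p i p) Z))"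
proof -
  let ?e = "M.some_frame p"
  let ?S = "\<lambda>i. Db p (?e i p) (\<lambda>q. Db q (?e i q) W) - Db p (D p (?e i p) (?e i)) W"
  note Zt = sect_tangent[OF Z]
  note fr = M.frame_vfield[OF M.onframe_some_frame[of p]]
  have ST: "?S i \<in> TN p" if "i \<in> Basis" for i
  proof -
    note f = fr[OF that]
    note ft = M.vfield_tangent[OF f]
    show ?thesis
      by (rule N.tangent_closed(3)[OF Db_tangent[OF Db_section[OF W f] ft] Db_tangent[OF W M.LC_tangent[OF f ft]]])
  qed
  have sum_T: "(\<Sum>i\<in>Basis. ?S i) \<in> TN p" by (rule N.tangent_closed(6)) (rule ST)
  have "inner_h p (\<Sum>i\<in>Basis. ?S i) (Z p) = (\<Sum>i\<in>Basis. inner_h p (?S i) (Z p))"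
    by (rule N.metric_sum[OF Zt ST])
  then have "inner_h p (rough_laplacian A g D Db W p) (Z p) = - (\<Sum>i\<in>Basis. inner_h p (?S i) (Z p))"
    unfolding rough_laplacian_eq[OF M.onframe_some_frame W] N.metric_minus[OF sum_T Zt] by simp
  moreover have "?e i p (\<lambda>q. \<sigma> W Z q (?e i q)) - \<sigma> W Z p (D p (?e i p) (?e i)) =
      inner_h p (?S i) (Z p) + inner_h p (Db p (?e i p) W) (Db p (?e i p) Z)" if "i \<in> Basis" for i
  proof -
    note f = fr[OF that]
    note ft = M.vfield_tangent[OF f]
    note s = Db_section[OF W f]
    show ?thesis
      unfolding \<sigma>_def inner_h_compatible[OF ft s Z]
        N.metric_diff[OF Db_tangent[OF s ft] Db_tangent[OF W M.LC_tangent[OF f ft]] Zt]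
      by simp
  qed
  ultimately show ?thesis
    unfolding div_form_def Let_def by (simp add: sum.distrib)
qed

end


subsection \<open>The current of a Killing field\<close>

locale killing_map = riemannian_map A g D B h DN \<phi> Db
  for A :: "('m::{t2_space, second_countable_topology}, 'a::euclidean_space) atlas"
    and g :: "'m \<Rightarrow> 'm tvec \<Rightarrow> 'm tvec \<Rightarrow> real" and D :: "('m, 'm) conn"
    and B :: "('n::{t2_space, second_countable_topology}, 'b::euclidean_space) atlas"
    and h :: "'n \<Rightarrow> 'n tvec \<Rightarrow> 'n tvec \<Rightarrow> real" and DN :: "('n, 'n) conn"
    and \<phi> :: "'m \<Rightarrow> 'n" and Db :: "('m, 'n) conn" +
  fixes X :: "'n \<Rightarrow> 'n tvec"
  assumes killing: "killing_field B h DN X"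
begin

abbreviation X\<phi> :: "'m \<Rightarrow> 'n tvec"
  where "X\<phi> \<equiv> \<lambda>q. X (\<phi> q)"

definition S :: "('m \<Rightarrow> 'n tvec) \<Rightarrow> 'm \<Rightarrow> 'n tvec"
  where "S W q = DN (\<phi> q) (W q) X"

lemma X_field: "N.vfield y X"
  by (rule N.killing_vfield[OF killing])

lemma X\<phi>_section: "sect p X\<phi>"
  by (rule section_of_field[OF X_field])

text \<open>\<open>W\<close> need not come from a field on the target. It enters only as a
  direction, so the coefficients of its local expansion come out without being
  differentiated.\<close>

lemma S_section:
  assumes W: "sect p W" shows "sect p (S W)"
proof -
  obtain w and E :: "'b \<Rightarrow> 'n \<Rightarrow> 'n tvec" where w: "\<forall>i. smooth_at A p (w i)" "\<forall>i. N.vfield (\<phi> p) (E i)"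
    "\<forall>\<^sub>F q in nhds p. W q = (\<Sum>i\<in>Basis. w i q *\<^sub>R E i (\<phi> q))" "W p = 0 \<longrightarrow> (\<forall>i. w i p = 0)"
    using section_frame[OF W] .
  have "sect p (\<lambda>q. \<Sum>i\<in>Basis. w i q *\<^sub>R DN (\<phi> q) (E i (\<phi> q)) X)"
    by (rule section_sum, rule section_scaleR[OF spec[OF w(1)]],
        rule section_of_field[OF N.LC_field[OF spec[OF w(2)] X_field]])
  moreover have TE: "\<forall>\<^sub>F q in nhds p. \<forall>i\<in>Basis. E i (\<phi> q) \<in> TN q"
    using w(2) by (intro eventually_ball_finite finite_Basis ballI eventually_map N.vfield_tangent_ev) auto
  have "\<forall>\<^sub>F q in nhds p. (\<Sum>i\<in>Basis. w i q *\<^sub>R DN (\<phi> q) (E i (\<phi> q)) X) = S W q"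
    using w(3) TE
  proof eventually_elim
    case (elim q)
    have t: "w i q *\<^sub>R E i (\<phi> q) \<in> TN q" if "i \<in> Basis" for i
      using elim(2) that by (auto intro: N.tangent_closed)
    have "S W q = (\<Sum>i\<in>Basis. DN (\<phi> q) (w i q *\<^sub>R E i (\<phi> q)) X)"
      unfolding S_def elim(1) by (rule N.LC.conn_dir_sum[OF X_field t])
    also have "\<dots> = (\<Sum>i\<in>Basis. w i q *\<^sub>R DN (\<phi> q) (E i (\<phi> q)) X)"
      using elim(2) by (intro sum.cong refl N.LC.conn_dir_scaleR[OF X_field]) auto
    finally show ?case by simp
  qed
  ultimately show ?thesis by (rule section_cong)
qed

lemma S_skew:
  assumes "u \<in> TN p" "v \<in> TN p"
  shows "inner_h p (DN (\<phi> p) u X) v = - inner_h p u (DN (\<phi> p) v X)"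
  using N.killing_skew[OF killing assms] N.metric_sym[OF assms(1) N.LC_tangent[OF X_field assms(2)]] by simp

text \<open>The failure of \<open>S\<close> to commute with the connection is tensorial in
  \<open>W\<close>, so \<open>W\<close> may be taken to be \<open>Y \<circ> \<phi>\<close>; then
  Kostant's formula applies, with a field \<open>V\<close> on the target that extends the
  pushforward of \<open>v\<close>.\<close>

lemma Db_S:
  assumes W: "sect p W" and v: "v \<in> M.TS p"
  shows "Db p v (S W) = DN (\<phi> p) (Db p v W) X - N.R (\<phi> p) (X (\<phi> p)) (d\<phi> p v) (W p)"
proof -
  define F where "F W = Db p v (S W) - DN (\<phi> p) (Db p v W) X" for W
  have tens: "tensorial_at p F"
    unfolding tensorial_at_def
  proof (intro conjI allI impI)
    fix W W' assume W: "sect p W" and W': "sect p W'"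
    have "\<forall>\<^sub>F q in nhds p. S W q + S W' q = S (\<lambda>q. W q + W' q) q"
      using section_tangent_ev[OF W] section_tangent_ev[OF W']
      unfolding S_def by eventually_elim (rule N.LC.conn_dir_add[OF X_field, symmetric])
    from conn_cong[OF section_add[OF S_section[OF W] S_section[OF W']] v this]
    show "F (\<lambda>q. W q + W' q) = F W + F W'"
      unfolding F_def conn_add[OF W W' v]
      using conn_add[OF S_section[OF W] S_section[OF W'] v]
        N.LC.conn_dir_add[OF X_field Db_tangent[OF W v] Db_tangent[OF W' v]]
      by simp
  next
    fix W and f :: "'m \<Rightarrow> real" assume W: "sect p W" and f: "smooth_at A p f"
    have "\<forall>\<^sub>F q in nhds p. f q *\<^sub>R S W q = S (\<lambda>q. f q *\<^sub>R W q) q"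
      using section_tangent_ev[OF W]
      unfolding S_def by eventually_elim (rule N.LC.conn_dir_scaleR[OF X_field, symmetric])
    from conn_cong[OF section_scaleR[OF f S_section[OF W]] v this]
    show "F (\<lambda>q. f q *\<^sub>R W q) = f p *\<^sub>R F W"
      unfolding F_def conn_leibniz[OF W f v] N.LC.conn_linear[OF X_field sect_tangent[OF W] Db_tangent[OF W v]]
      using conn_leibniz[OF S_section[OF W] f v]
      by (simp add: S_def[of W p] scaleR_diff_right diff_eq_eq add.commute)
  qed
  obtain Y where Y: "N.vfield (\<phi> p) Y" "Y (\<phi> p) = W p"
    by (rule N.exists_local_field[OF sect_tangent[OF W]])
  have "F W = F (\<lambda>q. Y (\<phi> q))"
    by (rule tensorial_point[OF tens W section_of_field[OF Y(1)]]) (simp add: Y)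
  also have "\<dots> = - N.R (\<phi> p) (X (\<phi> p)) (d\<phi> p v) (W p)"
  proof -
    obtain V where V: "N.vfield (\<phi> p) V" "V (\<phi> p) = d\<phi> p v"
      by (rule N.exists_local_field[OF pushforward_tangent[OF v]])
    have "S (\<lambda>q. Y (\<phi> q)) = (\<lambda>q. (\<lambda>y. DN y (Y y) X) (\<phi> q))" by (simp add: S_def fun_eq_iff)
    then show ?thesis
      unfolding F_def Db_field[OF Y(1) v]
      using Db_field[OF N.LC_field[OF Y(1) X_field] v] N.killing_second_derivative[OF killing V(1) Y(1)]
        N.curvature_eq[OF X_field V(1) Y(1)] V(2) Y(2)
      by simp
  qed
  finally show ?thesis by (simp add: F_def algebra_simps)
qed

lemma Db_X\<phi>: "v \<in> M.TS p \<Longrightarrow> Db p v X\<phi> = DN (\<phi> p) (d\<phi> p v) X"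
  by (rule Db_field[OF X_field])

text \<open>The first derivative of \<open>X \<circ> \<phi>\<close> along \<open>e\<close> is
  \<open>S\<close> of the pushforward of \<open>e\<close>, so \<open>Db_S\<close> gives the second
  one. The trace of the second fundamental form is \<open>T 0\<close>, which produces the term
  \<open>S (T 0)\<close>.\<close>

lemma rough_laplacian_X\<phi>:
  "rough_laplacian A g D Db X\<phi> p =
    (\<Sum>i\<in>Basis. N.R (\<phi> p) (X (\<phi> p)) (d\<phi> p (M.some_frame p i p)) (d\<phi> p (M.some_frame p i p)))
    - S (T 0) p"
proof -
  let ?e = "M.some_frame p"
  let ?R = "\<lambda>i. N.R (\<phi> p) (X (\<phi> p)) (d\<phi> p (?e i p)) (d\<phi> p (?e i p))"
  let ?B = "\<lambda>i. Db p (?e i p) (\<lambda>q. d\<phi> q (?e i q)) - d\<phi> p (D p (?e i p) (?e i))"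
  note e = M.onframe_some_frame[of p]
  have BT: "?B i \<in> TN p" if "i \<in> Basis" for i
  proof -
    note f = M.frame_vfield[OF e that]
    note ft = M.vfield_tangent[OF f]
    show ?thesis
      by (rule N.tangent_closed(3)[OF Db_tangent[OF section_pushforward[OF f] ft]
            pushforward_tangent[OF M.LC_tangent[OF f ft]]])
  qed
  have "Db p (?e i p) (\<lambda>q. Db q (?e i q) X\<phi>) - Db p (D p (?e i p) (?e i)) X\<phi> = DN (\<phi> p) (?B i) X - ?R i"
    if "i \<in> Basis" for i
  proof -
    note f = M.frame_vfield[OF e that]
    note ft = M.vfield_tangent[OF f]
    note s = section_pushforward[OF f]
    have ev: "\<forall>\<^sub>F q in nhds p. S (\<lambda>q. d\<phi> q (?e i q)) q = Db q (?e i q) X\<phi>"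
      using M.vfield_tangent_ev[OF f] by eventually_elim (simp add: S_def Db_X\<phi>)
    have "Db p (?e i p) (\<lambda>q. Db q (?e i q) X\<phi>) = Db p (?e i p) (S (\<lambda>q. d\<phi> q (?e i q)))"
      by (rule conn_cong[OF S_section[OF s] ft ev, symmetric])
    then show ?thesis
      using Db_S[OF s ft] Db_X\<phi>[OF M.LC_tangent[OF f ft]]
        N.LC.conn_dir_diff[OF X_field Db_tangent[OF s ft] pushforward_tangent[OF M.LC_tangent[OF f ft]]]
      by simp
  qed
  moreover have B_sum: "DN (\<phi> p) (\<Sum>i\<in>Basis. ?B i) X = (\<Sum>i\<in>Basis. DN (\<phi> p) (?B i) X)"
    by (rule N.LC.conn_dir_sum[OF X_field BT])
  ultimately have "rough_laplacian A g D Db X\<phi> p = - (\<Sum>i\<in>Basis. DN (\<phi> p) (?B i) X - ?R i)"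
    unfolding rough_laplacian_eq[OF e X\<phi>_section] by simp
  also have "(\<Sum>i\<in>Basis. DN (\<phi> p) (?B i) X - ?R i) = DN (\<phi> p) (\<Sum>i\<in>Basis. ?B i) X - (\<Sum>i\<in>Basis. ?R i)"
    unfolding B_sum by (rule sum_subtractf)
  also have "(\<Sum>i\<in>Basis. ?B i) = T 0 p"
    by (simp add: laplacian_tension_def tension_eq[OF e])
  finally show ?thesis by (simp add: S_def fun_diff_def)
qed

text \<open>Differentiating \<open>S Z\<close> and \<open>S W\<close> gives terms containing
  \<open>S\<close> of a derivative, which cancel because \<open>S\<close> is skew, and curvature
  terms, which \<open>curvature_swap\<close> brings into the shape found in
  \<open>even_tension\<close>.\<close>

lemma div_form_pair:
  assumes W: "\<And>q. sect q W" and Z: "\<And>q. sect q Z"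
  shows "div_form (\<lambda>q u. \<sigma> W (S Z) q u + \<sigma> Z (S W) q u) p =
    - inner_h p (rough_laplacian A g D Db W p) (S Z p) - inner_h p (rough_laplacian A g D Db Z p) (S W p)
    - (\<Sum>i\<in>Basis. inner_h p (N.R (\<phi> p) (Db p (M.some_frame p i p) W) (Z p) (d\<phi> p (M.some_frame p i p))
        - N.R (\<phi> p) (W p) (Db p (M.some_frame p i p) Z) (d\<phi> p (M.some_frame p i p))) (X (\<phi> p)))"
proof -
  let ?e = "M.some_frame p"
  let ?d = "\<lambda>i. d\<phi> p (?e i p)"
  note SW = S_section[OF W] and SZ = S_section[OF Z]
  note t = sect_tangent[OF W, of p] sect_tangent[OF Z, of p] sect_tangent[OF X\<phi>_section, of p]
  have pointwise: "inner_h p (Db p (?e i p) W) (Db p (?e i p) (S Z)) + inner_h p (Db p (?e i p) Z) (Db p (?e i p) (S W)) =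
      - inner_h p (N.R (\<phi> p) (Db p (?e i p) W) (Z p) (?d i) - N.R (\<phi> p) (W p) (Db p (?e i p) Z) (?d i)) (X (\<phi> p))"
    if "i \<in> Basis" for i
  proof -
    let ?R = "N.R (\<phi> p)" and ?W = "Db p (?e i p) W" and ?Z = "Db p (?e i p) Z" and ?x = "X (\<phi> p)"
    have et: "?e i p \<in> M.TS p" by (rule M.frame_tangent[OF M.onframe_some_frame that])
    note dt = pushforward_tangent[OF et] and Wt = Db_tangent[OF W et] and Zt = Db_tangent[OF Z et]
    note At = N.LC_tangent[OF X_field Wt] N.LC_tangent[OF X_field Zt]
    note Rt = N.curvature_tangent[OF t(3) dt t(1)] N.curvature_tangent[OF t(3) dt t(2)]
    have "inner_h p ?W (DN (\<phi> p) ?Z X) + inner_h p ?Z (DN (\<phi> p) ?W X) = 0"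
      using S_skew[OF Zt Wt] N.metric_sym[OF Wt At(2)] by simp
    moreover have "inner_h p ?W (Db p (?e i p) (S Z)) = inner_h p ?W (DN (\<phi> p) ?Z X) - inner_h p ?W (?R ?x (?d i) (Z p))"
      unfolding Db_S[OF Z et] by (rule N.metric_diff_right[OF At(2) Rt(2) Wt])
    moreover have "inner_h p ?Z (Db p (?e i p) (S W)) = inner_h p ?Z (DN (\<phi> p) ?W X) - inner_h p ?Z (?R ?x (?d i) (W p))"
      unfolding Db_S[OF W et] by (rule N.metric_diff_right[OF At(1) Rt(1) Zt])
    moreover have "inner_h p (?R ?W (Z p) (?d i)) ?x = inner_h p ?W (?R ?x (?d i) (Z p))"
      by (rule N.curvature_swap[OF Wt t(2) dt t(3)])
    moreover have "inner_h p (?R ?Z (W p) (?d i)) ?x = inner_h p ?Z (?R ?x (?d i) (W p))"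
      by (rule N.curvature_swap[OF Zt t(1) dt t(3)])
    moreover have "inner_h p (?R ?Z (W p) (?d i)) ?x = - inner_h p (?R (W p) ?Z (?d i)) ?x"
      unfolding N.curvature_antisym[OF t(1) Zt dt dt]
      by (rule N.metric_minus[OF N.curvature_tangent[OF t(1) Zt dt] t(3)])
    moreover have "inner_h p (?R ?W (Z p) (?d i) - ?R (W p) ?Z (?d i)) ?x =
        inner_h p (?R ?W (Z p) (?d i)) ?x - inner_h p (?R (W p) ?Z (?d i)) ?x"
      by (rule N.metric_diff[OF N.curvature_tangent[OF Wt t(2) dt] N.curvature_tangent[OF t(1) Zt dt] t(3)])
    ultimately show ?thesis by linarith
  qed
  have "div_form (\<lambda>q u. \<sigma> W (S Z) q u + \<sigma> Z (S W) q u) p = div_form (\<sigma> W (S Z)) p + div_form (\<sigma> Z (S W)) p"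
    by (rule div_form_add[OF smooth_form_\<sigma>[OF W SZ] smooth_form_\<sigma>[OF Z SW]])
  also have "\<dots> = - inner_h p (rough_laplacian A g D Db W p) (S Z p) - inner_h p (rough_laplacian A g D Db Z p) (S W p)
      + (\<Sum>i\<in>Basis. inner_h p (Db p (?e i p) W) (Db p (?e i p) (S Z)) + inner_h p (Db p (?e i p) Z) (Db p (?e i p) (S W)))"
    unfolding div_form_\<sigma>[OF W SZ] div_form_\<sigma>[OF Z SW] by (simp add: sum.distrib)
  finally show ?thesis using pointwise by (simp add: sum_negf)
qed

section \<open>The current as a one-form\<close>

definition pair_form :: "nat \<Rightarrow> nat \<Rightarrow> 'm \<Rightarrow> 'm tvec \<Rightarrow> real"
  where "pair_form s l p u =
    \<sigma> (T (s + l - 2)) (S (T (s - l - 1))) p u + \<sigma> (T (s - l - 1)) (S (T (s + l - 2))) p u"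

text \<open>Agrees with \<open>current_form\<close> on tangent vectors. Moving the derivative of
  \<open>X\<close> onto the other factor reverses the sign, hence the minus before the sum; all
  terms now have the form \<open>\<sigma>\<close>, whose divergence is known.\<close>

definition current :: "nat \<Rightarrow> 'm \<Rightarrow> 'm tvec \<Rightarrow> real"
  where "current s p u = \<sigma> (T (2 * s - 2)) X\<phi> p u - \<sigma> X\<phi> (T (2 * s - 2)) p u - (\<Sum>l = 1..s - 1. pair_form s l p u)"

lemma current_form_eq:
  assumes u: "u \<in> M.TS p"
  shows "current_form A g D B h DN \<phi> Db s X p u = current s p u"
proof -
  have eq: "inner_h p (DN (\<phi> p) (Db p u (T k)) X) (T m p) = - \<sigma> (T k) (S (T m)) p u" for k m
    unfolding \<sigma>_def S_def by (rule S_skew[OF Db_tangent[OF T_section u] sect_tangent[OF T_section]])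
  have "(\<Sum>l = 1..s - 1. - \<sigma> (T (s + l - 2)) (S (T (s - l - 1))) p u + - \<sigma> (T (s - l - 1)) (S (T (s + l - 2))) p u)
      = - (\<Sum>l = 1..s - 1. pair_form s l p u)"
    unfolding sum_negf[symmetric] by (intro sum.cong refl) (simp add: pair_form_def)
  then show ?thesis
    unfolding current_form_def current_def Let_def eq by (simp add: \<sigma>_def)
qed

lemma pair_form_linear:
  assumes "u \<in> M.TS p" "v \<in> M.TS p"
  shows "pair_form s l p (r *\<^sub>R u + t *\<^sub>R v) = r * pair_form s l p u + t * pair_form s l p v"
  unfolding pair_form_def \<sigma>_linear[OF T_section S_section[OF T_section] assms] by (simp add: algebra_simps)

lemma current_linear:
  assumes "u \<in> M.TS p" "v \<in> M.TS p"
  shows "current s p (r *\<^sub>R u + t *\<^sub>R v) = r * current s p u + t * current s p v"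
  unfolding current_def \<sigma>_linear[OF T_section X\<phi>_section assms] \<sigma>_linear[OF X\<phi>_section T_section assms]
    pair_form_linear[OF assms]
  by (simp add: algebra_simps sum.distrib sum_distrib_left)

lemma smooth_pair_form: "smooth_form (pair_form s l)"
  unfolding pair_form_def[abs_def]
  by (rule smooth_form_add[OF smooth_form_\<sigma>[OF T_section S_section[OF T_section]]
        smooth_form_\<sigma>[OF T_section S_section[OF T_section]]])

lemma smooth_current: "smooth_form (current s)"
  unfolding current_def[abs_def]
  by (rule smooth_form_diff[OF smooth_form_diff[OF smooth_form_\<sigma>[OF T_section X\<phi>_section]
        smooth_form_\<sigma>[OF X\<phi>_section T_section]] smooth_form_sum[OF smooth_pair_form]])

lemma S_T_skew: "inner_h p (T k p) (S (T m) p) = - inner_h p (T m p) (S (T k) p)"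
proof -
  have "inner_h p (T k p) (S (T m) p) = inner_h p (S (T m) p) (T k p)"
    by (rule N.metric_sym[OF sect_tangent[OF T_section] sect_tangent[OF S_section[OF T_section]]])
  also have "\<dots> = - inner_h p (T m p) (S (T k) p)"
    unfolding S_def by (rule S_skew[OF sect_tangent[OF T_section] sect_tangent[OF T_section]])
  finally show ?thesis .
qed

text \<open>Skewness of \<open>S\<close> turns the second summand into minus the first one at
  \<open>l - 1\<close>, so the sum is \<open>c (s - 1) - c 0\<close>.\<close>

lemma telescoping:
  assumes "s \<ge> 1"
  shows "(\<Sum>l = 1..s - 1. inner_h p (T (s + l - 1) p) (S (T (s - l - 1)) p) + inner_h p (T (s - l) p) (S (T (s + l - 2)) p))
    = inner_h p (T (2 * s - 2) p) (S (T 0) p)"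
proof -
  define c where "c l = inner_h p (T (s + l - 1) p) (S (T (s - l - 1)) p)" for l
  have "(\<Sum>l = 1..s - 1. inner_h p (T (s + l - 1) p) (S (T (s - l - 1)) p) + inner_h p (T (s - l) p) (S (T (s + l - 2)) p))
      = (\<Sum>l = Suc 0..s - 1. c l - c (l - 1))"
  proof (rule sum.cong)
    fix l assume l: "l \<in> {Suc 0..s - 1}"
    then have "s + (l - 1) - 1 = s + l - 2" "s - (l - 1) - 1 = s - l" by auto
    then show "inner_h p (T (s + l - 1) p) (S (T (s - l - 1)) p) + inner_h p (T (s - l) p) (S (T (s + l - 2)) p)
        = c l - c (l - 1)"
      unfolding c_def by (simp add: S_T_skew[of p "s - l" "s + l - 2"])
  qed simp
  also have "\<dots> = c (s - 1) - c 0" by (rule sum_telescope'') simp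
  \<comment> \<open>At \<open>l = 0\<close> both indices equal \<open>s - 1\<close>, and a skew map
    pairs to zero on the diagonal.\<close>
  moreover have "c 0 = 0" using S_T_skew[of p "s - 1" "s - 1"] by (simp add: c_def)
  moreover have "c (s - 1) = inner_h p (T (2 * s - 2) p) (S (T 0) p)"
  proof -
    have "s + (s - 1) - 1 = 2 * s - 2" "s - (s - 1) - 1 = 0" using assms by auto
    then show ?thesis unfolding c_def by (simp only:)
  qed
  ultimately show ?thesis by simp
qed

text \<open>In the two leading terms the products of first derivatives cancel by symmetry, leaving
  the Laplacians of \<open>T (2 * s - 2)\<close> and of \<open>X \<circ> \<phi>\<close>. The latter
  supplies the first curvature term of \<open>even_tension\<close> and a pairing with
  \<open>S (T 0)\<close>, which is exactly what the sum over \<open>l\<close> telescopes to.\<close>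

lemma div_form_current:
  assumes s: "s \<ge> 1"
  shows "div_form (current s) p = - inner_h p (even_tension A g D B DN \<phi> Db s p) (X (\<phi> p))"
proof -
  let ?e = "M.some_frame p" and ?R = "N.R (\<phi> p)" and ?x = "X (\<phi> p)" and ?W = "T (2 * s - 2)"
  let ?d = "\<lambda>i. d\<phi> p (?e i p)"
  define q1 where "q1 i = ?R (?W p) (?d i) (?d i)" for i
  define q2 where "q2 l i = ?R (Db p (?e i p) (T (s + l - 2))) (T (s - l - 1) p) (?d i)
      - ?R (T (s + l - 2) p) (Db p (?e i p) (T (s - l - 1))) (?d i)" for l i
  have et: "?e i p \<in> M.TS p" if "i \<in> Basis" for i by (rule M.frame_tangent[OF M.onframe_some_frame that])
  note dt = pushforward_tangent[OF et]
  note xt = sect_tangent[OF X\<phi>_section, of p]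
  have Tt: "T k p \<in> TN p" for k by (rule sect_tangent[OF T_section])
  have ST: "S (T k) p \<in> TN p" for k by (rule sect_tangent[OF S_section[OF T_section]])
  have q1t: "q1 i \<in> TN p" if "i \<in> Basis" for i
    unfolding q1_def by (rule N.curvature_tangent[OF Tt dt[OF that] dt[OF that]])
  have q2t: "q2 l i \<in> TN p" if "i \<in> Basis" for l i
    unfolding q2_def
    by (rule N.tangent_closed(3)[OF N.curvature_tangent[OF Db_tangent[OF T_section et[OF that]] Tt dt[OF that]]
          N.curvature_tangent[OF Tt Db_tangent[OF T_section et[OF that]] dt[OF that]]])
  have q1s: "(\<Sum>i\<in>Basis. q1 i) \<in> TN p" by (rule N.tangent_closed(6)) (rule q1t)
  have q2s: "(\<Sum>i\<in>Basis. q2 l i) \<in> TN p" for l by (rule N.tangent_closed(6)) (rule q2t)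
  have q2ss: "(\<Sum>l = 1..s - 1. \<Sum>i\<in>Basis. q2 l i) \<in> TN p" by (rule N.tangent_closed(6)) (rule q2s)
  have "even_tension A g D B DN \<phi> Db s p = T (2 * s - 1) p - (\<Sum>i\<in>Basis. q1 i) - (\<Sum>l = 1..s - 1. \<Sum>i\<in>Basis. q2 l i)"
    unfolding even_tension_def Let_def M.frame_trace_some_frame q1_def q2_def ..
  then have even: "inner_h p (even_tension A g D B DN \<phi> Db s p) ?x = inner_h p (T (2 * s - 1) p) ?x
      - (\<Sum>i\<in>Basis. inner_h p (q1 i) ?x) - (\<Sum>l = 1..s - 1. \<Sum>i\<in>Basis. inner_h p (q2 l i) ?x)"
    by (simp only: N.metric_diff[OF N.tangent_closed(3)[OF Tt q1s] q2ss xt] N.metric_diff[OF Tt q1s xt]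
        N.metric_sum[OF xt q1t] N.metric_sum[OF xt q2s] N.metric_sum[OF xt q2t])
  have lapX: "inner_h p (rough_laplacian A g D Db X\<phi> p) (?W p) =
      (\<Sum>i\<in>Basis. inner_h p (q1 i) ?x) - inner_h p (?W p) (S (T 0) p)"
  proof -
    have Rt: "?R ?x (?d i) (?d i) \<in> TN p" if "i \<in> Basis" for i
      by (rule N.curvature_tangent[OF xt dt[OF that] dt[OF that]])
    have Rs: "(\<Sum>i\<in>Basis. ?R ?x (?d i) (?d i)) \<in> TN p" by (rule N.tangent_closed(6)) (rule Rt)
    have "inner_h p (?R ?x (?d i) (?d i)) (?W p) = inner_h p (q1 i) ?x" if "i \<in> Basis" for i
      unfolding q1_def N.curvature_swap[OF xt dt[OF that] dt[OF that] Tt]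
      by (rule N.metric_sym[OF xt q1t[OF that, unfolded q1_def]])
    moreover have "inner_h p (S (T 0) p) (?W p) = inner_h p (?W p) (S (T 0) p)"
      by (rule N.metric_sym[OF ST Tt])
    moreover have "inner_h p (\<Sum>i\<in>Basis. ?R ?x (?d i) (?d i)) (?W p) =
        (\<Sum>i\<in>Basis. inner_h p (?R ?x (?d i) (?d i)) (?W p))"
      by (rule N.metric_sum[OF Tt Rt])
    ultimately show ?thesis
      unfolding rough_laplacian_X\<phi> N.metric_diff[OF Rs ST Tt] by simp
  qed
  have pair: "div_form (pair_form s l) p = - (inner_h p (T (s + l - 1) p) (S (T (s - l - 1)) p)
      + inner_h p (T (s - l) p) (S (T (s + l - 2)) p)) - (\<Sum>i\<in>Basis. inner_h p (q2 l i) ?x)"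
    if l: "l \<in> {1..s - 1}" for l
  proof -
    \<comment> \<open>The range of \<open>l\<close> keeps these subtractions from being
      truncated.\<close>
    have "Suc (s + l - 2) = s + l - 1" "Suc (s - l - 1) = s - l" using l by auto
    then have "rough_laplacian A g D Db (T (s + l - 2)) = T (s + l - 1)"
      "rough_laplacian A g D Db (T (s - l - 1)) = T (s - l)"
      by (simp_all flip: T_Suc)
    then show ?thesis
      using div_form_pair[OF T_section T_section, of "s + l - 2" "s - l - 1" p]
      by (simp add: pair_form_def[abs_def] q2_def)
  qed
  have lapW: "rough_laplacian A g D Db ?W = T (2 * s - 1)"
  proof -
    \<comment> \<open>False for \<open>s = 0\<close>, where both subtractions would be
      truncated.\<close>
    have "Suc (2 * s - 2) = 2 * s - 1" using s by simp
    then show ?thesis by (simp flip: T_Suc)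
  qed
  have sym: "inner_h p (Db p (?e i p) ?W) (Db p (?e i p) X\<phi>) = inner_h p (Db p (?e i p) X\<phi>) (Db p (?e i p) ?W)"
    if "i \<in> Basis" for i
    by (rule N.metric_sym[OF Db_tangent[OF T_section et[OF that]] Db_tangent[OF X\<phi>_section et[OF that]]])
  have "div_form (current s) p = div_form (\<sigma> ?W X\<phi>) p - div_form (\<sigma> X\<phi> ?W) p - (\<Sum>l = 1..s - 1. div_form (pair_form s l) p)"
  proof -
    note s1 = smooth_form_\<sigma>[OF T_section X\<phi>_section] and s2 = smooth_form_\<sigma>[OF X\<phi>_section T_section]
    have "div_form (current s) p = div_form (\<lambda>q u. \<sigma> ?W X\<phi> q u - \<sigma> X\<phi> ?W q u) p
        - div_form (\<lambda>q u. \<Sum>l = 1..s - 1. pair_form s l q u) p"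
      unfolding current_def[abs_def]
      by (rule div_form_diff[OF smooth_form_diff[OF s1 s2] smooth_form_sum[OF smooth_pair_form]])
    moreover have "div_form (\<lambda>q u. \<Sum>l = 1..s - 1. pair_form s l q u) p = (\<Sum>l = 1..s - 1. div_form (pair_form s l) p)"
      by (rule div_form_sum[OF smooth_pair_form])
    ultimately show ?thesis using div_form_diff[OF s1 s2] by simp
  qed
  also have "\<dots> = - inner_h p (T (2 * s - 1) p) ?x + inner_h p (rough_laplacian A g D Db X\<phi> p) (?W p)
      - (\<Sum>l = 1..s - 1. div_form (pair_form s l) p)"
    unfolding div_form_\<sigma>[OF T_section X\<phi>_section] div_form_\<sigma>[OF X\<phi>_section T_section] lapW
    using sym by simp
  finally have "div_form (current s) p = - inner_h p (T (2 * s - 1) p) ?x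
      + inner_h p (rough_laplacian A g D Db X\<phi> p) (?W p) - (\<Sum>l = 1..s - 1. div_form (pair_form s l) p)" .
  moreover have "(\<Sum>l = 1..s - 1. div_form (pair_form s l) p) = - inner_h p (?W p) (S (T 0) p)
      - (\<Sum>l = 1..s - 1. \<Sum>i\<in>Basis. inner_h p (q2 l i) ?x)"
    unfolding telescoping[OF s, symmetric] by (simp add: pair sum_subtractf sum_negf sum.distrib)
  ultimately show ?thesis unfolding even lapX by linarith
qed

text \<open>\<open>is_current\<close> tests with global fields, whereas \<open>dual\<close> covers
  all tangent vectors; \<open>dual_field_unique\<close> closes this gap.\<close>

lemma current_iff:
  assumes J: "vector_field A J" and dual: "\<And>p u. u \<in> M.TS p \<Longrightarrow> g p (J p) u = current s p u"
  shows "is_current A g D B h DN \<phi> Db s X J' \<longleftrightarrow> J' = J"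
proof
  have eq: "g p (J p) (U p) = current_form A g D B h DN \<phi> Db s X p (U p)" if "vector_field A U" for U p
  proof -
    have "U p \<in> M.TS p" using that M.vfield_tangent by (simp add: vector_field_def)
    then show ?thesis by (simp add: dual current_form_eq)
  qed
  show "is_current A g D B h DN \<phi> Db s X J'" if "J' = J"
    using J eq that by (simp add: is_current_def)
  assume J': "is_current A g D B h DN \<phi> Db s X J'"
  show "J' = J"
    by (rule M.dual_field_unique[OF _ J]) (use J' eq in \<open>simp_all add: is_current_def\<close>)
qed

lemma current_exists_divergence:
  assumes s: "s \<ge> 1"
  shows "(\<exists>!J. is_current A g D B h DN \<phi> Db s X J) \<and>
    (\<forall>J. is_current A g D B h DN \<phi> Db s X J \<longrightarrow>
       (\<forall>p. divergence A g D J p = - inner_h p (even_tension A g D B DN \<phi> Db s p) (X (\<phi> p))))"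
proof -
  obtain J where J: "vector_field A J" "\<forall>p. \<forall>u\<in>M.TS p. g p (J p) u = current s p u"
    by (rule M.exists_dual_field[of "current s", OF current_linear smooth_formD[OF smooth_current]])
  note J' = J(1) J(2)[rule_format]
  have "divergence A g D J p = - inner_h p (even_tension A g D B DN \<phi> Db s p) (X (\<phi> p))" for p
    using divergence_eq_div_form[OF J'] div_form_current[OF s] by simp
  moreover have "is_current A g D B h DN \<phi> Db s X J' \<longleftrightarrow> J' = J" for J'
    by (rule current_iff[OF J'])
  ultimately show ?thesis by simp
qed

end

theorem theorem3p2:
  fixes A :: "('m::{t2_space, second_countable_topology}, 'a::euclidean_space) atlas"
    and g :: "'m \<Rightarrow> 'm tvec \<Rightarrow> 'm tvec \<Rightarrow> real"
    and D :: "('m, 'm) conn"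
    and B :: "('n::{t2_space, second_countable_topology}, 'b::euclidean_space) atlas"
    and h :: "'n \<Rightarrow> 'n tvec \<Rightarrow> 'n tvec \<Rightarrow> real"
    and DN :: "('n, 'n) conn"
    and \<phi> :: "'m \<Rightarrow> 'n"
    and Db :: "('m, 'n) conn"
    and X :: "'n \<Rightarrow> 'n tvec"
    and s :: nat
  assumes "smooth_atlas A" and "riemannian_metric A g" and "levi_civita A g D"
    and "smooth_atlas B" and "riemannian_metric B h" and "levi_civita B h DN"
    and "smooth_map A B \<phi>" and "pullback_connection A B DN \<phi> Db"
    and "killing_field B h DN X"
    and "s \<ge> 1"
  shows "(\<exists>!J. is_current A g D B h DN \<phi> Db s X J) \<and>
    (\<forall>J. is_current A g D B h DN \<phi> Db s X J \<longrightarrow>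
       (\<forall>p. divergence A g D J p = - h (\<phi> p) (even_tension A g D B DN \<phi> Db s p) (X (\<phi> p))) \<and>
       ((\<forall>p. even_tension A g D B DN \<phi> Db s p = 0) \<longrightarrow> (\<forall>p. divergence A g D J p = 0)))"
proof -
  interpret killing_map A g D B h DN \<phi> Db X
    using assms by unfold_locales
  have zero: "h (\<phi> p) 0 (X (\<phi> p)) = 0" for p
    by (rule N.metric_0[OF sect_tangent[OF X\<phi>_section]])
  show ?thesis
  proof (intro conjI allI impI)
    show "\<exists>!J. is_current A g D B h DN \<phi> Db s X J"
      using current_exists_divergence[OF assms(10)] by (rule conjunct1)
    fix J p assume J: "is_current A g D B h DN \<phi> Db s X J"
    show div: "divergence A g D J p = - h (\<phi> p) (even_tension A g D B DN \<phi> Db s p) (X (\<phi> p))"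
      using conjunct2[OF current_exists_divergence[OF assms(10)], rule_format, OF J] .
    assume ev: "\<forall>p. even_tension A g D B DN \<phi> Db s p = 0"
    show "divergence A g D J p = 0" unfolding div spec[OF ev, of p] zero by simp
  qed
qed

end
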